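(* Let $\mathbb R^{1,1}$ be $\mathbb R^2$ with the quadratic form $Q(x_1,x_2)=x_1^2-x_2^2$, let $\iota_+(x)=x/Q(x)$ for $Q(x)\ne0$, let $\mathcal Z=\mathbb Z\left(\tfrac12,\tfrac12\right)\oplus\mathbb Z\left(\tfrac12,-\tfrac12\right)$, and let $K$ be the little diamond $\{(x_1,x_2):|x_1-\tfrac12|+|x_2|\le\tfrac12\}$ (taken half-open, so as to be a fundamental domain for $\mathcal Z$: $0\le x_1+x_2<1$, $0\le x_1-x_2<1$). The continued fraction (CF) algorithm given by $(\mathbb R^{1,1},\iota_+,\mathcal Z,K)$, with generalized Gauss map $T:K\to K$, satisfies: (a) A point $x=(x_1,x_2)\in\mathbb R^{1,1}$ has an infinite expansion if and only if $x$ is diagonally-completely irrational, i.e. both $x_1+x_2$ and $x_1-x_2$ are irrational. (b) Identifying $\mathbb R^{1,1}$ with the algebra $\mathbb R[\mathbb j]=\{x_1+x_2\mathbb j:\mathbb j^2=1\}$, a point $x\in\mathbb R^{1,1}$ has an eventually-repeating expansion if and only if it is a root of a non-degenerate quadratic equation $ax^2+bx+c=0$ with coefficients in $\mathcal Z$. (c) For a diagonally-completely irrational point $x\in K$ with digits $a_1,a_2,\dots$, one has $x=\iota_+(a_1+\iota_+(a_2+\cdots))$, in the sense of convergence in the Euclidean topology, and therefore also relative to $Q$. (d) $T$ leaves invariant the probability measure on $K$ $$\frac{2}{(\log2)^2}\,\frac{dx_1\,dx_2}{(1+x_1)^2-x_2^2}.$$ (e) $T$ has full cylinders and satisfies Renyi's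 condition, and therefore is exact, mixing of all orders, and ergodic (with respect to the measure in (d)).
   Context: Let $\mathcal N=\{x:Q(x)=0\}$. For $x\in\mathbb R^{1,1}$, $[x]_K\in\mathcal Z$ is the unique lattice point with $x-[x]_K\in K$. The generalized Gauss map is $T(x)=\iota_+(x)-[\iota_+(x)]_K$ for $x\in K\setminus\mathcal N$. The digits of $x\in K$ are $a_i=a_i(x)=[\iota_+(T^{i-1}x)]_K$, defined as long as $T^{i-1}x\notin\mathcal N$; for general $x\in\mathbb R^{1,1}$ one sets $a_0=[x]_K$ and uses the digits of $x-a_0$. The expansion is infinite if the orbit of the point of $K$ never enters $\mathcal N$; it is eventually-repeating if it is infinite and the digit sequence is eventually periodic. Convergence in (c): with $x_n=\iota_+(a_1+\iota_+(a_2+\cdots+\iota_+(a_n)))$, one has $x_n\to x$ in the Euclidean topology, and convergence relative to $Q$ means $Q(x_n-x)\to0$. In $\mathbb R[\mathbb j]$, $(x_1,x_2)$ corresponds to $x_1+x_2\mathbb j$, so $\mathcal Z=\mathbb Z\frac{1+\mathbb j}{2}\oplus\mathbb Z\frac{1-\mathbb j}{2}$. The map $x_1+x_2\mathbb j\mapsto(x_1+x_2,x_1-x_2)$ is an algebra isomorphism onto $\mathbb R^2$ with coordinate-wise operations, taking $\mathcal Z$ to $\mathbb Z^2$. A quadratic equation $ax^2+bx+c=0$ with $a,b,c\in\mathcal Z$ is non-degenerate if both of the integer polynomials obtained from it by applying the two coordinates of this isomorphism to its coefficients have degree $2$ and are irreducible over $\mathbb Q$. Let $\mu$ be the measure in (d).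 For a finite digit sequence $s=(b_1,\dots,b_n)$, $|s|=n$, the cylinder is $C_s=\{x\in K:a_i(x)=b_i,\ 1\le i\le n\}$. The system has full cylinders if $\mu(T^{|s|}(C_s))=1$ for every cylinder of positive measure. Renyi's condition: there is $\lambda>0$ such that for every cylinder $C_s$ of positive measure and every measurable $B\subset C_s$, $\mu(T^{|s|}B)\le\lambda\,\mu(B)/\mu(C_s)$. A map $T$ preserving a probability measure $\mu$ is exact if $\mu(A)>0$ implies $\lim_{n\to\infty}\mu(T^nA)=1$; equivalently, every set in $\bigcap_{n>0}T^{-n}\mathcal M$ is null or co-null, where $\mathcal M$ is the $\sigma$-algebra of measurable sets. *)

theory Defs
  imports "HOL-Probability.Probability" "HOL-Computational_Algebra.Computational_Algebra"
begin

section \<open>The continued fraction algorithm on the plane with the split quadratic form\<close>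

type_synonym R11 = "real \<times> real"

definition Q :: "R11 \<Rightarrow> real" where
  "Q x = (fst x)\<^sup>2 - (snd x)\<^sup>2"

definition null_cone :: "R11 set" where
  "null_cone = {x. Q x = 0}"

text \<open>Since \<open>inverse 0 = 0\<close>, this is \<open>0\<close> on the null cone, where the inversion is undefined.\<close>

definition iota :: "R11 \<Rightarrow> R11" where
  "iota x = x /\<^sub>R Q x"

definition lattice :: "R11 set" where
  "lattice = {of_int m *\<^sub>R (1/2, 1/2) + of_int n *\<^sub>R (1/2, - 1/2) |m n :: int. True}"

definition diamond :: "R11 set" where
  "diamond = {x. 0 \<le> fst x + snd x \<and> fst x + snd x < 1 \<and> 0 \<le> fst x - snd x \<and> fst x - snd x < 1}"

definition lattice_part :: "R11 \<Rightarrow> R11" where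
  "lattice_part x = (THE z. z \<in> lattice \<and> x - z \<in> diamond)"

text \<open>The map is meaningful on \<open>diamond - null_cone\<close>. On the null cone it takes the value
  \<open>0\<close>, which lies in the null cone again, so an orbit that enters the null cone stays there.
  The part of the diamond lying in the null cone is a Lebesgue null set.\<close>

definition gauss_map :: "R11 \<Rightarrow> R11" where
  "gauss_map x = iota x - lattice_part (iota x)"

text \<open>Digits of a point of the diamond, numbered from \<open>i = 1\<close>; the value is only meaningful if the
  iterate of order \<open>i - 1\<close> is not in the null cone.\<close>

definition digit :: "R11 \<Rightarrow> nat \<Rightarrow> R11" where
  "digit x i = lattice_part (iota ((gauss_map ^^ (i - 1)) x))"

definition infinite_expansion :: "R11 \<Rightarrow> bool" where
  "infinite_expansion x \<longleftrightarrow> (\<forall>n. (gauss_map ^^ n) (x - lattice_part x) \<notin> null_cone)"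

definition eventually_repeating :: "R11 \<Rightarrow> bool" where
  "eventually_repeating x \<longleftrightarrow> infinite_expansion x \<and>
     (\<exists>m\<ge>1. \<exists>p\<ge>1. \<forall>i\<ge>m. digit (x - lattice_part x) (i + p) = digit (x - lattice_part x) i)"

definition diagonally_completely_irrational :: "R11 \<Rightarrow> bool" where
  "diagonally_completely_irrational x \<longleftrightarrow> fst x + snd x \<notin> \<rat> \<and> fst x - snd x \<notin> \<rat>"

definition convergent_of :: "R11 \<Rightarrow> nat \<Rightarrow> R11" where
  "convergent_of x n = foldr (\<lambda>a y. iota (a + y)) (map (digit x) [1..<Suc n]) 0"

lemma diamond_eq:
  "diamond = {x. \<bar>fst x - 1/2\<bar> + \<bar>snd x\<bar> \<le> 1/2 \<and> fst x + snd x < 1 \<and> fst x - snd x < 1}"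
  unfolding diamond_def by (auto simp: abs_if split: if_splits)

lemma lattice_part_ex1: "\<exists>!z. z \<in> lattice \<and> x - z \<in> diamond"
proof -
  define pt :: "int \<Rightarrow> int \<Rightarrow> R11" where
    "pt m n = of_int m *\<^sub>R (1/2, 1/2) + of_int n *\<^sub>R (1/2, - 1/2)" for m n
  have lat: "z \<in> lattice \<longleftrightarrow> (\<exists>m n. z = pt m n)" for z
    by (auto simp: lattice_def pt_def)
  have mem: "x - pt m n \<in> diamond \<longleftrightarrow> m = \<lfloor>fst x + snd x\<rfloor> \<and> n = \<lfloor>fst x - snd x\<rfloor>" for m n
  proof -
    have u: "fst (x - pt m n) + snd (x - pt m n) = (fst x + snd x) - of_int m"
      and v: "fst (x - pt m n) - snd (x - pt m n) = (fst x - snd x) - of_int n"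
      by (simp_all add: pt_def field_simps)
    have fl: "0 \<le> r - of_int k \<and> r - of_int k < 1 \<longleftrightarrow> k = \<lfloor>r\<rfloor>" for r :: real and k
      by linarith
    show ?thesis
      unfolding diamond_def mem_Collect_eq u v using fl by blast
  qed
  show ?thesis
    unfolding lat by (metis mem)
qed

lemma gauss_map_in_diamond: "gauss_map x \<in> diamond"
  using theI'[OF lattice_part_ex1[of "iota x"]] unfolding gauss_map_def lattice_part_def by simp

section \<open>The algebra of split complex numbers\<close>

text \<open>The pair \<open>(x1, x2)\<close> stands for \<open>x1 + x2 j\<close> with \<open>j * j = 1\<close>.\<close>

definition split_mult :: "R11 \<Rightarrow> R11 \<Rightarrow> R11" where
  "split_mult x y = (fst x * fst y + snd x * snd y, fst x * snd y + snd x * fst y)"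

definition diag1 :: "R11 \<Rightarrow> real" where "diag1 x = fst x + snd x"

definition diag2 :: "R11 \<Rightarrow> real" where "diag2 x = fst x - snd x"

lemma diag_split_mult:
  "diag1 (split_mult x y) = diag1 x * diag1 y" "diag2 (split_mult x y) = diag2 x * diag2 y"
  by (simp_all add: diag1_def diag2_def split_mult_def algebra_simps)

definition nondegenerate_quadratic :: "R11 \<Rightarrow> R11 \<Rightarrow> R11 \<Rightarrow> bool" where
  "nondegenerate_quadratic a b c \<longleftrightarrow> a \<in> lattice \<and> b \<in> lattice \<and> c \<in> lattice \<and>
     (\<forall>f\<in>{diag1, diag2}. \<exists>p :: int poly. map_poly real_of_int p = [:f c, f b, f a:] \<and>
        degree p = 2 \<and> irreducible (map_poly rat_of_int p))"

definition root_of_nondegenerate_quadratic :: "R11 \<Rightarrow> bool" where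
  "root_of_nondegenerate_quadratic x \<longleftrightarrow>
     (\<exists>a b c. nondegenerate_quadratic a b c \<and>
        split_mult a (split_mult x x) + split_mult b x + c = 0)"

section \<open>Measure-theoretic notions\<close>

definition gauss_measure :: "R11 measure" where
  "gauss_measure = density (restrict_space lborel diamond)
     (\<lambda>x. ennreal (2 / (ln 2)\<^sup>2 * (1 / ((1 + fst x)\<^sup>2 - (snd x)\<^sup>2))))"

definition cylinder :: "R11 list \<Rightarrow> R11 set" where
  "cylinder s = {x \<in> diamond. \<forall>i\<in>{1..length s}.
     (gauss_map ^^ (i - 1)) x \<notin> null_cone \<and> digit x i = s ! (i - 1)}"

text \<open>The function \<open>measure\<close> vanishes on sets that are not measurable. Measurability is therefore
  demanded explicitly below wherever the conditions could otherwise hold for that reason alone.\<close>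

definition full_cylinders :: bool where
  "full_cylinders \<longleftrightarrow> (\<forall>s. cylinder s \<in> sets gauss_measure \<and>
     (measure gauss_measure (cylinder s) > 0 \<longrightarrow>
        measure gauss_measure ((gauss_map ^^ length s) ` cylinder s) = 1))"

definition renyi_condition :: bool where
  "renyi_condition \<longleftrightarrow> (\<exists>C>0. \<forall>s. cylinder s \<in> sets gauss_measure \<and>
     (measure gauss_measure (cylinder s) > 0 \<longrightarrow>
       (\<forall>B\<in>sets gauss_measure. B \<subseteq> cylinder s \<longrightarrow>
          (gauss_map ^^ length s) ` B \<in> sets gauss_measure \<and>
          measure gauss_measure ((gauss_map ^^ length s) ` B)
            \<le> C * measure gauss_measure B / measure gauss_measure (cylinder s))))"

definition preserves_measure :: "'a measure \<Rightarrow> ('a \<Rightarrow> 'a) \<Rightarrow> bool" where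
  "preserves_measure M T \<longleftrightarrow> T \<in> measurable M M \<and> distr M M T = M"

definition exact_map :: "'a measure \<Rightarrow> ('a \<Rightarrow> 'a) \<Rightarrow> bool" where
  "exact_map M T \<longleftrightarrow>
     (\<forall>A\<in>sets M. measure M A > 0 \<longrightarrow> (\<lambda>n. measure M ((T ^^ n) ` A)) \<longlonglongrightarrow> 1)"

text \<open>Mixing of order \<open>k\<close> for every \<open>k\<close>: the measure of
  \<open>A 0 \<inter> T^{-n 0} A 1 \<inter> \<dots> \<inter> T^{-(n 0 + \<dots> + n (k-1))} A k\<close> tends to the product of the measures as
  all gaps \<open>n 0, \<dots>, n (k-1)\<close> tend to infinity.\<close>

definition mixing_of_all_orders :: "'a measure \<Rightarrow> ('a \<Rightarrow> 'a) \<Rightarrow> bool" where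
  "mixing_of_all_orders M T \<longleftrightarrow>
     (\<forall>k :: nat. \<forall>A :: nat \<Rightarrow> 'a set. (\<forall>i\<le>k. A i \<in> sets M) \<longrightarrow>
       (\<forall>\<epsilon>>0. \<exists>N. \<forall>n :: nat \<Rightarrow> nat. (\<forall>j<k. n j \<ge> N) \<longrightarrow>
          \<bar>measure M (\<Inter>i\<le>k. (T ^^ (\<Sum>j<i. n j)) -` A i \<inter> space M)
             - (\<Prod>i\<le>k. measure M (A i))\<bar> < \<epsilon>))"

definition ergodic_map :: "'a measure \<Rightarrow> ('a \<Rightarrow> 'a) \<Rightarrow> bool" where
  "ergodic_map M T \<longleftrightarrow>
     (\<forall>A\<in>sets M. T -` A \<inter> space M = A \<longrightarrow> measure M A = 0 \<or> measure M A = 1)"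

end

theory Submission
  imports Defs "HOL-Real_Asymp.Real_Asymp"
begin

text \<open>In the diagonal coordinates \<open>u = x1 + x2\<close>, \<open>v = x1 - x2\<close> the lattice is the integer lattice, the
  diamond is the unit square and the map is \<open>(u, v) \<mapsto> (G v, G u)\<close>, where \<open>G\<close> is the classical Gauss
  map. The arithmetic statements thus reduce to classical ones on each coordinate (Euclid's
  algorithm, Lagrange's theorem), and the measure is the square of Gauss's measure.

  For the ergodic properties, a cylinder of length \<open>n\<close> pushed forward by \<open>T^n\<close> has a density between
  two positive constants, so \<open>\<mu> (C \<inter> T^{-n} B) \<ge> c \<mu> C \<mu> B\<close>. This contains fullness and Renyi's
  condition. It also makes the distance to equilibrium of pushforwards of absolutely continuous
  measures contract by the factor \<open>1 - c\<close>, since cylinders generate; hence \<open>\<mu> (A \<inter> T^{-n} B)\<close> tends to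
  \<open>\<mu> A \<mu> B\<close> uniformly in \<open>B\<close>, which yields exactness, mixing of all orders and ergodicity.\<close>

text \<open>The two coordinates interact only through the swap and through termination: the orbit
  stops as soon as one of them reaches \<open>0\<close>. Odd powers of the map exchange the
  coordinates, so contraction and periods are handled for even numbers of steps.

  The bounds for cylinders must not depend on their length. Instead of convergents of unbounded
  size, the proof follows one parameter in \<open>[0, 1]\<close> per coordinate: Lebesgue measure on
  a cylinder is carried by \<open>T^n\<close> to a multiple of a product of two Moebius densities,
  and on the unit interval each factor lies between 1/2 and 2. Gauss's density, multiplied by
  \<open>ln 2\<close>, lies between 1/2 and 1. Together these comparisons give
  \<open>c = (ln 2)^2 / 64\<close>.

  Exactness speaks of forward images \<open>T^n A\<close>, which vary with \<open>n\<close>, and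
  mixing of higher order applies the two-set estimate to a set that depends on all later gaps. This
  is why the estimate is wanted uniformly in \<open>B\<close>. The contraction is proved for all
  nonnegative integrable densities at once, because what remains of a cylinder after one round is an
  arbitrary such density.\<close>

section \<open>The one-dimensional Gauss map and Euclid's algorithm\<close>

definition gauss1 :: "real \<Rightarrow> real" where
  "gauss1 x = frac (1 / x)"

lemma gauss1_range: "0 \<le> gauss1 x" "gauss1 x < 1"
  by (simp_all add: gauss1_def frac_lt_1)

text \<open>By the convention \<open>1 / 0 = 0\<close> the point \<open>0\<close> is absorbing, so
  that termination of an expansion can be expressed as reaching \<open>0\<close>.\<close>

lemma gauss1_0 [simp]: "gauss1 0 = 0"
  by (simp add: gauss1_def)

lemma inverse_eq_floor_plus_gauss1: "1 / x = of_int \<lfloor>1 / x\<rfloor> + gauss1 x"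
  by (simp add: gauss1_def frac_def)

lemma gauss1_irrational:
  assumes "x \<notin> \<rat>" shows "gauss1 x \<notin> \<rat>"
proof
  assume "gauss1 x \<in> \<rat>"
  then have "1 / x \<in> \<rat>"
    by (subst inverse_eq_floor_plus_gauss1) auto
  then have "inverse (1 / x) \<in> \<rat>" by (rule Rats_inverse)
  with assms show False by simp
qed

lemma funpow_gauss1_irrational: "x \<notin> \<rat> \<Longrightarrow> (gauss1 ^^ n) x \<notin> \<rat>"
  by (induction n) (simp_all add: gauss1_irrational)

lemma funpow_gauss1_range:
  assumes "0 \<le> x" "x < 1" shows "0 \<le> (gauss1 ^^ n) x \<and> (gauss1 ^^ n) x < 1"
  using assms by (cases n) (auto simp: gauss1_range)

text \<open>One division step of Euclid's algorithm: the pair \<open>(q, p)\<close> becomes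
  \<open>(p, q mod p)\<close>. For \<open>p = 0\<close> both sides are \<open>0\<close> by the
  conventions for division by zero.\<close>

lemma gauss1_quotient: "gauss1 (real p / real q) = real (q mod p) / real p"
proof (cases "p = 0")
  case False
  have "real q = real p * real (q div p) + real (q mod p)"
    by (metis mult_div_mod_eq of_nat_add of_nat_mult)
  moreover have "\<lfloor>real q / real p\<rfloor> = int (q div p)"
    by (rule floor_divide_of_nat_eq)
  ultimately show ?thesis
    using False by (simp add: gauss1_def frac_def field_simps)
qed simp

text \<open>Strong induction on the denominator, which the Euclidean step replaces by the smaller
  number \<open>p\<close>.\<close>

lemma gauss1_quotient_reaches_0: "p < q \<Longrightarrow> \<exists>n. (gauss1 ^^ n) (real p / real q) = 0"
proof (induction q arbitrary: p rule: less_induct)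
  case (less q)
  show ?case
  proof (cases "p = 0")
    case True
    then show ?thesis by (intro exI[of _ 0]) simp
  next
    case False
    then obtain n where "(gauss1 ^^ n) (real (q mod p) / real p) = 0"
      using less.IH[of p "q mod p"] less.prems by auto
    then have "(gauss1 ^^ Suc n) (real p / real q) = 0"
      by (simp add: funpow_swap1 gauss1_quotient)
    then show ?thesis ..
  qed
qed

lemma rational_gauss1_reaches_0:
  assumes "x \<in> \<rat>" "0 \<le> x" "x < 1" shows "\<exists>n. (gauss1 ^^ n) x = 0"
proof -
  obtain p q :: nat where "q \<noteq> 0" "\<bar>x\<bar> = real p / real q"
    using Rats_abs_nat_div_natE[OF assms(1)] by metis
  moreover from this have "p < q"
    using assms by (simp add: abs_of_nonneg)
  ultimately show ?thesis
    using gauss1_quotient_reaches_0[of p q] assms(2) by simp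
qed

section \<open>Diagonal coordinates\<close>

lemma diag_add [simp]: "diag1 (x + y) = diag1 x + diag1 y" "diag2 (x + y) = diag2 x + diag2 y"
  by (simp_all add: diag1_def diag2_def)

lemma diag_diff [simp]: "diag1 (x - y) = diag1 x - diag1 y" "diag2 (x - y) = diag2 x - diag2 y"
  by (simp_all add: diag1_def diag2_def)

lemma diag_0 [simp]: "diag1 0 = 0" "diag2 0 = 0"
  by (simp_all add: diag1_def diag2_def)

lemma diag_eq_iff: "x = y \<longleftrightarrow> diag1 x = diag1 y \<and> diag2 x = diag2 y"
  by (auto simp: diag1_def diag2_def prod_eq_iff)

lemma Q_diag: "Q x = diag1 x * diag2 x"
  by (simp add: Q_def diag1_def diag2_def power2_eq_square algebra_simps)

lemma null_cone_iff: "x \<in> null_cone \<longleftrightarrow> diag1 x = 0 \<or> diag2 x = 0"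
  by (simp add: null_cone_def Q_diag)

lemma diamond_iff: "x \<in> diamond \<longleftrightarrow> 0 \<le> diag1 x \<and> diag1 x < 1 \<and> 0 \<le> diag2 x \<and> diag2 x < 1"
  by (simp add: diamond_def diag1_def diag2_def)

text \<open>\<open>Q x\<close> is the product of the diagonal coordinates, so dividing by it cancels
  one coordinate and leaves the inverse of the other. This is the origin of the swap.\<close>

lemma diag_iota:
  assumes "x \<notin> null_cone"
  shows "diag1 (iota x) = 1 / diag2 x" "diag2 (iota x) = 1 / diag1 x"
proof -
  have "diag1 (iota x) = diag1 x / Q x" "diag2 (iota x) = diag2 x / Q x"
    by (simp_all add: iota_def diag1_def diag2_def divide_inverse algebra_simps)
  then show "diag1 (iota x) = 1 / diag2 x" "diag2 (iota x) = 1 / diag1 x"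
    using assms by (simp_all add: Q_diag null_cone_iff)
qed

lemma iota_null_cone: "x \<in> null_cone \<Longrightarrow> iota x = 0"
  by (simp add: iota_def null_cone_def)

lemma lattice_iff: "z \<in> lattice \<longleftrightarrow> diag1 z \<in> \<int> \<and> diag2 z \<in> \<int>"
proof
  assume "z \<in> lattice"
  then show "diag1 z \<in> \<int> \<and> diag2 z \<in> \<int>"
    by (auto simp: lattice_def diag1_def diag2_def field_simps)
next
  assume "diag1 z \<in> \<int> \<and> diag2 z \<in> \<int>"
  then obtain m n where "diag1 z = of_int m" "diag2 z = of_int n"
    by (auto elim!: Ints_cases)
  then have "z = of_int m *\<^sub>R (1/2, 1/2) + of_int n *\<^sub>R (1/2, - 1/2)"
    by (subst diag_eq_iff) (auto simp: diag1_def diag2_def field_simps)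
  then show "z \<in> lattice"
    unfolding lattice_def by blast
qed

lemma lattice_part_props: "lattice_part x \<in> lattice" "x - lattice_part x \<in> diamond"
  using theI'[OF lattice_part_ex1[of x]] unfolding lattice_part_def by auto

lemma diag_lattice_part:
  "diag1 (lattice_part x) = of_int \<lfloor>diag1 x\<rfloor>" "diag2 (lattice_part x) = of_int \<lfloor>diag2 x\<rfloor>"
proof -
  obtain m n where mn: "diag1 (lattice_part x) = of_int m" "diag2 (lattice_part x) = of_int n"
    using lattice_part_props(1)[of x] by (auto simp: lattice_iff elim!: Ints_cases)
  have "m = \<lfloor>diag1 x\<rfloor>" "n = \<lfloor>diag2 x\<rfloor>"
    using lattice_part_props(2)[of x] mn by (auto simp: diamond_iff intro!: floor_unique[symmetric])
  with mn show "diag1 (lattice_part x) = of_int \<lfloor>diag1 x\<rfloor>" "diag2 (lattice_part x) = of_int \<lfloor>diag2 x\<rfloor>"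
    by simp_all
qed

lemma diag_fractional_part:
  "diag1 (x - lattice_part x) = frac (diag1 x)" "diag2 (x - lattice_part x) = frac (diag2 x)"
  by (simp_all add: diag_lattice_part frac_def)

lemma diag_gauss_map:
  assumes "x \<notin> null_cone"
  shows "diag1 (gauss_map x) = gauss1 (diag2 x)" "diag2 (gauss_map x) = gauss1 (diag1 x)"
  unfolding gauss_map_def diag_fractional_part gauss1_def by (simp_all add: diag_iota assms)

lemma gauss_map_null_cone: "x \<in> null_cone \<Longrightarrow> gauss_map x = 0"
  unfolding diag_eq_iff gauss_map_def iota_null_cone diag_fractional_part by simp

lemma funpow_gauss_map_in_diamond: "x \<in> diamond \<Longrightarrow> (gauss_map ^^ n) x \<in> diamond"
  by (induction n) (auto simp: gauss_map_in_diamond)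

text \<open>Parity decides which starting coordinate is seen. The hypothesis is on all earlier
  iterates because \<open>gauss_map\<close> sends both coordinates to \<open>0\<close> on the null
  cone even if only one of them vanishes there.\<close>

lemma diag_funpow_gauss_map:
  assumes "\<And>i. i < n \<Longrightarrow> (gauss_map ^^ i) x \<notin> null_cone"
  shows "diag1 ((gauss_map ^^ n) x) = (gauss1 ^^ n) (if even n then diag1 x else diag2 x)"
    and "diag2 ((gauss_map ^^ n) x) = (gauss1 ^^ n) (if even n then diag2 x else diag1 x)"
  using assms by (induction n) (auto simp: diag_gauss_map)

section \<open>Finite and infinite expansions\<close>

lemma infinite_orbit_iff:
  assumes "x \<in> diamond"
  shows "(\<forall>n. (gauss_map ^^ n) x \<notin> null_cone) \<longleftrightarrow> diag1 x \<notin> \<rat> \<and> diag2 x \<notin> \<rat>"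
proof
  assume inf: "\<forall>n. (gauss_map ^^ n) x \<notin> null_cone"
  have nz: "(gauss1 ^^ n) (diag1 x) \<noteq> 0 \<and> (gauss1 ^^ n) (diag2 x) \<noteq> 0" for n
    using inf diag_funpow_gauss_map[of n x] by (auto simp: null_cone_iff split: if_splits)
  show "diag1 x \<notin> \<rat> \<and> diag2 x \<notin> \<rat>"
    using nz rational_gauss1_reaches_0[of "diag1 x"] rational_gauss1_reaches_0[of "diag2 x"] assms
    by (auto simp: diamond_iff)
next
  assume irr: "diag1 x \<notin> \<rat> \<and> diag2 x \<notin> \<rat>"
  have "diag1 ((gauss_map ^^ n) x) \<notin> \<rat> \<and> diag2 ((gauss_map ^^ n) x) \<notin> \<rat>" for n
  proof (induction n)
    case (Suc n)
    then have "(gauss_map ^^ n) x \<notin> null_cone"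
      by (auto simp: null_cone_iff)
    with Suc show ?case
      by (simp add: diag_gauss_map gauss1_irrational)
  qed (use irr in simp)
  then show "\<forall>n. (gauss_map ^^ n) x \<notin> null_cone"
    by (metis Rats_0 null_cone_iff)
qed

lemma frac_in_Rats_iff: "frac (x::real) \<in> \<rat> \<longleftrightarrow> x \<in> \<rat>"
proof
  assume "frac x \<in> \<rat>"
  then have "frac x + of_int \<lfloor>x\<rfloor> \<in> \<rat>" by (intro Rats_add) auto
  then show "x \<in> \<rat>" by (simp add: frac_def)
qed (simp add: frac_def)

theorem infinite_expansion_iff: "infinite_expansion x \<longleftrightarrow> diagonally_completely_irrational x"
  unfolding infinite_expansion_def infinite_orbit_iff[OF lattice_part_props(2)]
    diag_fractional_part frac_in_Rats_iff diagonally_completely_irrational_def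
  by (simp add: diag1_def diag2_def)

section \<open>Convergents\<close>

lemma diag_iota_add:
  assumes "1 \<le> diag1 a" "1 \<le> diag2 a" "0 \<le> diag1 y" "0 \<le> diag2 y"
  shows "diag1 (iota (a + y)) = 1 / (diag2 a + diag2 y)" "diag2 (iota (a + y)) = 1 / (diag1 a + diag1 y)"
  using assms by (simp_all add: diag_iota null_cone_iff)

abbreviation cf_fold :: "R11 list \<Rightarrow> R11 \<Rightarrow> R11" where
  "cf_fold as t \<equiv> foldr (\<lambda>a y. iota (a + y)) as t"

text \<open>The closed square is used instead of \<open>diamond\<close> because a finite continued
  fraction may have the coordinate 1, for instance with last digit coordinate 1 and tail
  \<open>0\<close>.\<close>

definition closed_diamond :: "R11 set" where
  "closed_diamond = {x. 0 \<le> diag1 x \<and> diag1 x \<le> 1 \<and> 0 \<le> diag2 x \<and> diag2 x \<le> 1}"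

definition admissible :: "R11 \<Rightarrow> bool" where
  "admissible a \<longleftrightarrow> 1 \<le> diag1 a \<and> 1 \<le> diag2 a"

lemma iota_add_in_closed_diamond:
  "admissible a \<Longrightarrow> y \<in> closed_diamond \<Longrightarrow> iota (a + y) \<in> closed_diamond"
  by (auto simp: closed_diamond_def admissible_def diag_iota_add field_simps)

lemma cf_fold_in_closed_diamond:
  "\<lbrakk>\<forall>a\<in>set as. admissible a; t \<in> closed_diamond\<rbrakk> \<Longrightarrow> cf_fold as t \<in> closed_diamond"
  by (induction as) (auto intro: iota_add_in_closed_diamond)

text \<open>A single branch \<open>1 / (A + t)\<close> can have a derivative of absolute value 1 at
  the boundary, so only two branches together contract uniformly. The composite is a Moebius map of
  determinant 1, hence the difference of its values is \<open>(s - t) / (X * Y)\<close> with both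
  denominators at least 2.\<close>

lemma two_step_contraction:
  fixes A B s t :: real
  assumes "1 \<le> A" "1 \<le> B" "0 \<le> s" "0 \<le> t"
  shows "\<bar>1 / (A + 1 / (B + s)) - 1 / (A + 1 / (B + t))\<bar> \<le> \<bar>s - t\<bar> / 4"
proof -
  define X where "X = A * (B + s) + 1"
  define Y where "Y = A * (B + t) + 1"
  have "1 * 1 \<le> A * (B + s)" "1 * 1 \<le> A * (B + t)"
    using assms by (intro mult_mono; simp)+
  then have ge: "2 \<le> X" "2 \<le> Y"
    by (auto simp: X_def Y_def)
  have e: "1 / (A + 1 / (B + r)) = (B + r) / (A * (B + r) + 1)" if "0 \<le> r" for r
  proof -
    have "B + r \<noteq> 0" using that assms by auto
    then have "A + 1 / (B + r) = (A * (B + r) + 1) / (B + r)"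
      by (simp add: field_simps)
    then show ?thesis by simp
  qed
  have "1 / (A + 1 / (B + s)) - 1 / (A + 1 / (B + t)) = (B + s) / X - (B + t) / Y"
    using e[of s] e[of t] assms by (simp add: X_def Y_def)
  also have "\<dots> = ((B + s) * Y - (B + t) * X) / (X * Y)"
    using ge by (simp add: field_simps)
  also have "(B + s) * Y - (B + t) * X = s - t"
    by (simp add: X_def Y_def algebra_simps)
  finally have "\<bar>1 / (A + 1 / (B + s)) - 1 / (A + 1 / (B + t))\<bar> = \<bar>s - t\<bar> / (X * Y)"
    using ge by (simp add: abs_mult)
  moreover have "2 * 2 \<le> X * Y" using ge by (intro mult_mono) auto
  then have "\<bar>s - t\<bar> / (X * Y) \<le> \<bar>s - t\<bar> / 4"
    by (intro divide_left_mono) auto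
  ultimately show ?thesis by simp
qed

text \<open>Digits are consumed in pairs: this gives the factor 1/4, and after two swaps each
  diagonal coordinate is compared with itself.\<close>

lemma cf_fold_contraction:
  assumes "\<forall>a\<in>set as. admissible a" "s \<in> closed_diamond" "t \<in> closed_diamond"
  shows "\<bar>diag1 (cf_fold as s) - diag1 (cf_fold as t)\<bar> \<le> (1/4) ^ (length as div 2)
       \<and> \<bar>diag2 (cf_fold as s) - diag2 (cf_fold as t)\<bar> \<le> (1/4) ^ (length as div 2)"
  using assms(1)
proof (induction as rule: induct_list012)
  case 1
  then show ?case using assms(2,3) by (auto simp: closed_diamond_def)
next
  case (2 a)
  then show ?case
    using cf_fold_in_closed_diamond[of "[a]" s] cf_fold_in_closed_diamond[of "[a]" t] assms(2,3)
    by (auto simp: closed_diamond_def)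
next
  case (3 a b as)
  let ?S = "cf_fold as s" and ?T = "cf_fold as t"
  have adm: "admissible a" "admissible b" using "3.prems" by auto
  have cl: "?S \<in> closed_diamond" "?T \<in> closed_diamond"
    using "3.prems" assms(2,3) by (auto intro!: cf_fold_in_closed_diamond)
  have e: "diag1 (iota (a + iota (b + r))) = 1 / (diag2 a + 1 / (diag1 b + diag1 r))"
    "diag2 (iota (a + iota (b + r))) = 1 / (diag1 a + 1 / (diag2 b + diag2 r))"
    if "r \<in> closed_diamond" for r
    using adm that iota_add_in_closed_diamond[OF adm(2) that]
    by (simp_all add: closed_diamond_def admissible_def diag_iota_add)
  have "\<bar>diag1 (iota (a + iota (b + ?S))) - diag1 (iota (a + iota (b + ?T)))\<bar>
      \<le> \<bar>diag1 ?S - diag1 ?T\<bar> / 4"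
    unfolding e[OF cl(1)] e[OF cl(2)]
    using adm cl by (intro two_step_contraction) (auto simp: admissible_def closed_diamond_def)
  moreover have "\<bar>diag2 (iota (a + iota (b + ?S))) - diag2 (iota (a + iota (b + ?T)))\<bar>
      \<le> \<bar>diag2 ?S - diag2 ?T\<bar> / 4"
    unfolding e[OF cl(1)] e[OF cl(2)]
    using adm cl by (intro two_step_contraction) (auto simp: admissible_def closed_diamond_def)
  ultimately show ?case
    using "3.IH"(1) "3.prems" by auto
qed

lemma diag_digit:
  assumes "(gauss_map ^^ i) x \<notin> null_cone"
  shows "diag1 (digit x (Suc i)) = of_int \<lfloor>1 / diag2 ((gauss_map ^^ i) x)\<rfloor>"
    "diag2 (digit x (Suc i)) = of_int \<lfloor>1 / diag1 ((gauss_map ^^ i) x)\<rfloor>"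
  using assms by (simp_all add: digit_def diag_lattice_part diag_iota)

lemma digit_lattice: "digit x i \<in> lattice"
  by (simp add: digit_def lattice_part_props)

lemma digit_admissible:
  assumes "x \<in> diamond" "(gauss_map ^^ i) x \<notin> null_cone"
  shows "admissible (digit x (Suc i))"
proof -
  let ?y = "(gauss_map ^^ i) x"
  have "0 < diag1 ?y" "diag1 ?y < 1" "0 < diag2 ?y" "diag2 ?y < 1"
    using funpow_gauss_map_in_diamond[OF assms(1), of i] assms(2)
    by (auto simp: diamond_iff null_cone_iff)
  then show ?thesis
    using assms by (simp add: admissible_def diag_digit)
qed

definition digits :: "R11 \<Rightarrow> nat \<Rightarrow> R11 list" where
  "digits x n = map (digit x) [1..<Suc n]"

lemma length_digits [simp]: "length (digits x n) = n"
  by (simp add: digits_def)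

lemma digits_nth: "i < n \<Longrightarrow> digits x n ! i = digit x (Suc i)"
  by (simp add: digits_def del: upt_Suc)

lemma digits_Suc: "digits x (Suc n) = digit x 1 # digits (gauss_map x) n"
proof (rule nth_equalityI)
  fix i assume "i < length (digits x (Suc n))"
  then show "digits x (Suc n) ! i = (digit x 1 # digits (gauss_map x) n) ! i"
    by (cases i) (simp_all add: digits_nth digit_def funpow_swap1)
qed simp

lemma iota_iota: "x \<notin> null_cone \<Longrightarrow> iota (iota x) = x"
  by (subst diag_eq_iff) (simp add: diag_iota null_cone_iff)

lemma digit_1_add_gauss_map: "digit x 1 + gauss_map x = iota x"
  by (simp add: digit_def gauss_map_def)

text \<open>Unwinds \<open>x = iota (digit x 1 + gauss_map x)\<close>. Thus \<open>cf_fold\<close>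
  of the digits is the inverse branch of the iterate, and a point is determined by its first
  \<open>n\<close> digits and its \<open>n\<close>-th iterate.\<close>

lemma cf_fold_digits:
  "(\<And>i. i < n \<Longrightarrow> (gauss_map ^^ i) x \<notin> null_cone) \<Longrightarrow> cf_fold (digits x n) ((gauss_map ^^ n) x) = x"
proof (induction n arbitrary: x)
  case 0
  then show ?case by (simp add: digits_def)
next
  case (Suc n)
  have "cf_fold (digits (gauss_map x) n) ((gauss_map ^^ n) (gauss_map x)) = gauss_map x"
  proof (rule Suc.IH)
    fix i assume "i < n"
    then show "(gauss_map ^^ i) (gauss_map x) \<notin> null_cone"
      using Suc.prems[of "Suc i"] by (simp add: funpow_swap1)
  qed
  then show ?case
    using iota_iota[of x] Suc.prems[of 0] digit_1_add_gauss_map[of x]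
    by (simp add: digits_Suc funpow_swap1)
qed

lemma digits_admissible:
  assumes "x \<in> diamond" "\<And>i. i < n \<Longrightarrow> (gauss_map ^^ i) x \<notin> null_cone"
  shows "\<forall>a\<in>set (digits x n). admissible a"
proof
  fix a assume "a \<in> set (digits x n)"
  then obtain i where "i < n" "a = digit x (Suc i)"
    by (metis digits_nth in_set_conv_nth length_digits)
  then show "admissible a" using assms digit_admissible by simp
qed

lemma diamond_subset_closed_diamond: "x \<in> diamond \<Longrightarrow> x \<in> closed_diamond"
  by (auto simp: diamond_iff closed_diamond_def)

text \<open>Both points are images of points of the square under the same inverse branch.\<close>

lemma same_digits_close:
  assumes "x \<in> diamond" "\<And>i. i < n \<Longrightarrow> (gauss_map ^^ i) x \<notin> null_cone"
    "y \<in> diamond" "\<And>i. i < n \<Longrightarrow> (gauss_map ^^ i) y \<notin> null_cone"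
    "digits x n = digits y n"
  shows "\<bar>diag1 x - diag1 y\<bar> \<le> (1/4) ^ (n div 2)" "\<bar>diag2 x - diag2 y\<bar> \<le> (1/4) ^ (n div 2)"
proof -
  have c: "(gauss_map ^^ n) x \<in> closed_diamond" "(gauss_map ^^ n) y \<in> closed_diamond"
    using assms by (auto intro!: diamond_subset_closed_diamond funpow_gauss_map_in_diamond)
  have "cf_fold (digits x n) ((gauss_map ^^ n) x) = x" "cf_fold (digits y n) ((gauss_map ^^ n) y) = y"
    "\<forall>a\<in>set (digits x n). admissible a"
    using cf_fold_digits[of n x] cf_fold_digits[of n y] digits_admissible[of x n] assms by simp_all
  with c show "\<bar>diag1 x - diag1 y\<bar> \<le> (1/4) ^ (n div 2)" "\<bar>diag2 x - diag2 y\<bar> \<le> (1/4) ^ (n div 2)"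
    using cf_fold_contraction[of "digits x n" "(gauss_map ^^ n) x" "(gauss_map ^^ n) y"] assms(5)
    by simp_all
qed

lemma tendsto_quarter_power: "(\<lambda>n. (1/4 :: real) ^ (n div 2)) \<longlonglongrightarrow> 0"
proof -
  have "filterlim (\<lambda>n::nat. n div 2) at_top at_top"
    by (rule filterlim_at_top_div_const_nat) simp
  then show ?thesis
    using filterlim_compose[OF LIMSEQ_realpow_zero[of "1/4 :: real"]] by simp
qed

text \<open>The convergent and \<open>x\<close> arise from one inverse branch, with tail
  \<open>0\<close> and tail \<open>(gauss_map ^^ n) x\<close> respectively. The error is small in
  both diagonal coordinates, and \<open>Q\<close> of it is their product.\<close>

theorem convergent_of_tendsto:
  assumes "x \<in> diamond" "diagonally_completely_irrational x"
  shows "(\<lambda>n. convergent_of x n) \<longlonglongrightarrow> x" "(\<lambda>n. Q (convergent_of x n - x)) \<longlonglongrightarrow> 0"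
proof -
  have nn: "(gauss_map ^^ i) x \<notin> null_cone" for i
    using assms(2) infinite_orbit_iff[OF assms(1)]
    by (simp add: diagonally_completely_irrational_def diag1_def diag2_def)
  have conv: "convergent_of x n = cf_fold (digits x n) 0" for n
    by (simp add: convergent_of_def digits_def)
  have b: "\<bar>diag1 (convergent_of x n - x)\<bar> \<le> (1/4) ^ (n div 2) \<and>
     \<bar>diag2 (convergent_of x n - x)\<bar> \<le> (1/4) ^ (n div 2)" for n
    using cf_fold_contraction[OF digits_admissible[OF assms(1)], of n 0 "(gauss_map ^^ n) x"]
      cf_fold_digits[of n x] nn
      diamond_subset_closed_diamond[OF funpow_gauss_map_in_diamond[OF assms(1), of n]]
    by (simp add: conv closed_diamond_def)
  have l1: "(\<lambda>n. diag1 (convergent_of x n - x)) \<longlonglongrightarrow> 0"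
    using b by (intro tendsto_rabs_zero_cancel[OF tendsto_sandwich[OF _ _ tendsto_const tendsto_quarter_power]]) auto
  have l2: "(\<lambda>n. diag2 (convergent_of x n - x)) \<longlonglongrightarrow> 0"
    using b by (intro tendsto_rabs_zero_cancel[OF tendsto_sandwich[OF _ _ tendsto_const tendsto_quarter_power]]) auto
  show "(\<lambda>n. Q (convergent_of x n - x)) \<longlonglongrightarrow> 0"
    using tendsto_mult[OF l1 l2] by (simp add: Q_diag)
  have e: "convergent_of x n = (fst x + (diag1 (convergent_of x n - x) + diag2 (convergent_of x n - x)) / 2,
     snd x + (diag1 (convergent_of x n - x) - diag2 (convergent_of x n - x)) / 2)" for n
    by (auto simp: prod_eq_iff diag1_def diag2_def field_simps)
  have "(\<lambda>n. (fst x + (diag1 (convergent_of x n - x) + diag2 (convergent_of x n - x)) / 2,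
     snd x + (diag1 (convergent_of x n - x) - diag2 (convergent_of x n - x)) / 2))
     \<longlonglongrightarrow> (fst x + (0 + 0) / 2, snd x + (0 - 0) / 2)"
    by (intro tendsto_intros l1 l2) auto
  then show "(\<lambda>n. convergent_of x n) \<longlonglongrightarrow> x"
    by (subst e) simp
qed

section \<open>Quadratic irrationals\<close>

text \<open>Irrationality together with \<open>a \<noteq> 0\<close> stands in for irreducibility,
  which \<open>quadratic_irreducible\<close> recovers. In this form invariance under translation and
  inversion is elementary.\<close>

definition quadratic_irrational :: "real \<Rightarrow> bool" where
  "quadratic_irrational x \<longleftrightarrow> x \<notin> \<rat> \<and>
     (\<exists>a b c :: int. a \<noteq> 0 \<and> of_int a * x\<^sup>2 + of_int b * x + of_int c = 0)"

lemma quadratic_irrational_add_int: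
  assumes "quadratic_irrational x" shows "quadratic_irrational (x + of_int k)"
proof -
  obtain a b c :: int where a: "a \<noteq> 0" and e: "of_int a * x\<^sup>2 + of_int b * x + of_int c = 0"
    using assms by (auto simp: quadratic_irrational_def)
  have "x + of_int k \<notin> \<rat>"
    using assms Rats_diff[of "x + of_int k" "of_int k"] by (auto simp: quadratic_irrational_def)
  moreover have "of_int a * (x + of_int k)\<^sup>2 + of_int (b - 2 * a * k) * (x + of_int k)
      + of_int (c - b * k + a * k\<^sup>2) = of_int a * x\<^sup>2 + of_int b * x + of_int c"
    by (simp add: power2_eq_square algebra_simps)
  ultimately show ?thesis
    using a e unfolding quadratic_irrational_def by metis
qed

lemma quadratic_irrational_inverse:
  assumes "quadratic_irrational x" shows "quadratic_irrational (1 / x)"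
proof -
  obtain a b c :: int where a: "a \<noteq> 0" and e: "of_int a * x\<^sup>2 + of_int b * x + of_int c = 0"
    using assms by (auto simp: quadratic_irrational_def)
  have x: "x \<notin> \<rat>" using assms by (simp add: quadratic_irrational_def)
  then have x0: "x \<noteq> 0" by auto
  have "1 / x \<notin> \<rat>" using x Rats_inverse[of "1 / x"] by auto
  \<comment> \<open>\<open>c\<close> is the leading coefficient of the reversed polynomial, of which
    \<open>1 / x\<close> is a root.\<close>
  moreover have "c \<noteq> 0"
  proof
    assume "c = 0"
    with e have "x * (of_int a * x + of_int b) = 0"
      by (simp add: power2_eq_square algebra_simps)
    with x0 have "of_int a * x = - of_int b" by simp
    then have "x = - of_int b / of_int a" using a by (simp add: field_simps)
    then show False using x by auto
  qed
  moreover have "of_int c * (1 / x)\<^sup>2 + of_int b * (1 / x) + of_int a = 0"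
    using e x0 by (simp add: power2_eq_square field_simps)
  ultimately show ?thesis
    unfolding quadratic_irrational_def by metis
qed

lemma quadratic_irrational_frac_iff: "quadratic_irrational (frac x) \<longleftrightarrow> quadratic_irrational x"
  using quadratic_irrational_add_int[of x "- \<lfloor>x\<rfloor>"] quadratic_irrational_add_int[of "frac x" "\<lfloor>x\<rfloor>"]
  by (auto simp: frac_def)

lemma quadratic_irrational_gauss1_iff: "quadratic_irrational (gauss1 x) \<longleftrightarrow> quadratic_irrational x"
  unfolding gauss1_def quadratic_irrational_frac_iff
  using quadratic_irrational_inverse[of x] quadratic_irrational_inverse[of "1 / x"] by auto

lemma quadratic_irrational_funpow_gauss1_iff:
  "quadratic_irrational ((gauss1 ^^ n) x) \<longleftrightarrow> quadratic_irrational x"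
  by (induction n) (simp_all add: quadratic_irrational_gauss1_iff)

text \<open>\<open>p / q\<close> and \<open>p' / q'\<close> are consecutive convergents of \<open>x\<close> and \<open>x = (p + p' y) / (q + q' y)\<close>
  where \<open>y\<close> is the \<open>n\<close>-th iterate; the last identity combines this with \<open>\<bar>p q' - p' q\<bar> = 1\<close>.\<close>

lemma gauss1_convergents:
  assumes x: "x \<notin> \<rat>" "0 \<le> x" "x < 1"
  shows "\<exists>p q p' q' :: int. 1 \<le> q \<and> 0 \<le> q' \<and> q' \<le> q \<and> (0 < n \<longrightarrow> 1 \<le> q') \<and>
    of_int q * x - of_int p = - (gauss1 ^^ n) x * (of_int q' * x - of_int p') \<and>
    \<bar>of_int q' * x - of_int p'\<bar> * (of_int q + of_int q' * (gauss1 ^^ n) x) = 1"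
proof (induction n)
  case 0
  \<comment> \<open>The starting pair is \<open>0 / 1\<close> and the formal convergent
    \<open>1 / 0\<close>, which is why \<open>1 \<le> q'\<close> is claimed only for
    \<open>0 < n\<close>.\<close>
  show ?case by (rule exI[of _ 0], rule exI[of _ 1], rule exI[of _ 1], rule exI[of _ 0]) simp
next
  case (Suc n)
  define y where "y = (gauss1 ^^ n) x"
  define z where "z = gauss1 y"
  define k where "k = \<lfloor>1 / y\<rfloor>"
  have y: "y \<notin> \<rat>" "0 \<le> y" "y < 1"
    using funpow_gauss1_irrational[OF x(1)] funpow_gauss1_range[OF x(2,3)] by (auto simp: y_def)
  then have "y \<noteq> 0" by auto
  with y have y0: "0 < y" by simp
  have k1: "1 \<le> k" using y0 y(3) by (simp add: k_def)
  have yz: "1 / y = of_int k + z"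
    unfolding k_def z_def by (rule inverse_eq_floor_plus_gauss1)
  then have yz': "y * (of_int k + z) = 1" using y0 by (simp add: field_simps)
  obtain p q p' q' :: int where q: "1 \<le> q" "0 \<le> q'" "q' \<le> q"
    and d: "of_int q * x - of_int p = - y * (of_int q' * x - of_int p')"
    and e: "\<bar>of_int q' * x - of_int p'\<bar> * (of_int q + of_int q' * y) = 1"
    using Suc by (auto simp: y_def)
  have 1: "of_int (q * k + q') * x - of_int (p * k + p') = - z * (of_int q * x - of_int p)"
  proof -
    have "(of_int q * x - of_int p) * (of_int k + z) = - (of_int q' * x - of_int p') * (y * (of_int k + z))"
      unfolding d by (simp only: minus_mult_left mult.assoc mult.commute mult.left_commute)
    then have "(of_int q * x - of_int p) * (of_int k + z) = - (of_int q' * x - of_int p')"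
      unfolding yz' by simp
    then show ?thesis by (simp add: algebra_simps)
  qed
  have 2: "\<bar>of_int q * x - of_int p\<bar> * (of_int (q * k + q') + of_int q * z) = 1"
  proof -
    have "\<bar>of_int q * x - of_int p\<bar> * (of_int (q * k + q') + of_int q * z)
      = \<bar>of_int q' * x - of_int p'\<bar> * (of_int q * (y * (of_int k + z)) + of_int q' * y)"
      unfolding d using y0 by (simp add: abs_mult) (simp add: algebra_simps)
    then show ?thesis unfolding yz' using e by simp
  qed
  have "q * 1 \<le> q * k" using q k1 by (intro mult_left_mono) auto
  then have 3: "1 \<le> q * k + q'" "q \<le> q * k + q'" using q by linarith+
  show ?case
    \<comment> \<open>The usual recursion for numerators and denominators, with the next partial
      quotient \<open>k\<close>.\<close>
    by (rule exI[of _ "p * k + p'"], rule exI[of _ "q * k + q'"], rule exI[of _ p], rule exI[of _ q])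
      (use 1 2 3 q in \<open>simp add: y_def z_def\<close>)
qed

text \<open>With the \<open>n\<close>-th iterate equal to \<open>x\<close>, the Moebius relation of
  \<open>gauss1_convergents\<close> becomes a quadratic equation for \<open>x\<close> with leading
  coefficient \<open>q'\<close>, positive because \<open>0 < n\<close>.\<close>

lemma gauss1_fixed_point_quadratic:
  assumes x: "x \<notin> \<rat>" "0 \<le> x" "x < 1" and "0 < n" "(gauss1 ^^ n) x = x"
  shows "quadratic_irrational x"
proof -
  obtain p q p' q' :: int where q: "1 \<le> q'"
    and d: "of_int q * x - of_int p = - x * (of_int q' * x - of_int p')"
    using gauss1_convergents[OF x, of n] assms(4,5) by auto
  have "of_int q' * x\<^sup>2 + of_int (q - p') * x + of_int (- p) = 0"
    using d by (simp add: power2_eq_square algebra_simps)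
  with q x(1) show ?thesis
    unfolding quadratic_irrational_def by (metis not_one_le_zero)
qed

text \<open>The two roots have the rational sum \<open>- b / a\<close>, so a rational root would
  make \<open>x\<close> rational.\<close>

lemma quadratic_other_root:
  assumes "x \<notin> \<rat>" "a \<noteq> 0" "of_int a * x\<^sup>2 + of_int b * x + of_int c = (0::real)" "r \<in> \<rat>"
  shows "of_int a * r\<^sup>2 + of_int b * r + of_int c \<noteq> (0::real)"
proof
  assume "of_int a * r\<^sup>2 + of_int b * r + of_int c = (0::real)"
  then have "(x - r) * (of_int a * (x + r) + of_int b) = 0"
    using assms(3) by (simp add: power2_eq_square algebra_simps)
  moreover have "x \<noteq> r" using assms by auto
  ultimately have "of_int a * (x + r) + of_int b = 0" by simp
  then have "x = - of_int b / of_int a - r"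
    using assms(2) by (simp add: field_simps)
  then show False using assms(1,4) by auto
qed

lemma finite_quadratic_roots:
  fixes a b c :: real assumes "a \<noteq> 0" shows "finite {y. a * y\<^sup>2 + b * y + c = 0}"
proof -
  have "{y. a * y\<^sup>2 + b * y + c = 0} = {y. poly [:c, b, a:] y = 0}"
    by (auto simp: power2_eq_square algebra_simps)
  moreover have "finite {y. poly [:c, b, a:] y = 0}"
    using assms by (intro poly_roots_finite) simp
  ultimately show ?thesis by simp
qed

text \<open>Lagrange's theorem. The iterates are roots of integral quadratic polynomials whose
  coefficients \<open>F(p', q')\<close>, \<open>2 F((p, q), (p', q'))\<close>, \<open>F(p, q)\<close> are bounded, since
  \<open>F(X, Y) = a X\<^sup>2 + b X Y + c Y\<^sup>2\<close> vanishes at \<open>(x, 1)\<close> and \<open>\<bar>q x - p\<bar> \<le> 1 / q\<close>.\<close>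

lemma quadratic_orbit_repeats:
  assumes x: "0 \<le> x" "x < 1" and quad: "quadratic_irrational x"
  shows "\<exists>i p. 0 < p \<and> (gauss1 ^^ (i + p)) x = (gauss1 ^^ i) x"
proof -
  obtain a b c :: int where a: "a \<noteq> 0" and f: "of_int a * x\<^sup>2 + of_int b * x + of_int c = 0"
    and irr: "x \<notin> \<rat>"
    using quad by (auto simp: quadratic_irrational_def)
  \<comment> \<open>Every coefficient will have the form
    \<open>a * x * (2 * u) + b * v + a * w\<close> with \<open>u\<close>, \<open>v\<close>,
    \<open>w\<close> of absolute value at most 2; \<open>M\<close> bounds all such numbers.\<close>
  define M :: int where "M = \<lceil>4 * \<bar>of_int a * x\<bar> + 2 * \<bar>of_int b\<bar> + 2 * \<bar>of_int a\<bar>\<rceil>"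
  have M: "4 * \<bar>of_int a * x\<bar> + 2 * \<bar>of_int b\<bar> + 2 * \<bar>of_int a\<bar> \<le> of_int M"
    by (simp add: M_def)
  define R where "R = (\<Union>(A, B, C)\<in>{(A, B, C). A \<noteq> 0 \<and> A \<in> {-M..M} \<and> B \<in> {-M..M} \<and> C \<in> {-M..M}}.
     {y::real. of_int A * y\<^sup>2 + of_int B * y + of_int C = 0})"
  have "finite R"
  proof -
    have "{(A, B, C). A \<noteq> 0 \<and> A \<in> {-M..M} \<and> B \<in> {-M..M} \<and> C \<in> {-M..M}}
        \<subseteq> {-M..M} \<times> {-M..M} \<times> {-M..M}" by auto
    then have "finite {(A, B, C). A \<noteq> 0 \<and> A \<in> {-M..M} \<and> B \<in> {-M..M} \<and> C \<in> {-M..M}}"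
      by (rule finite_subset) auto
    then show ?thesis
      unfolding R_def by (auto intro!: finite_UN_I finite_quadratic_roots)
  qed
  have inR: "(gauss1 ^^ n) x \<in> R" for n
  proof -
    define y where "y = (gauss1 ^^ n) x"
    have y: "0 \<le> y" "y < 1"
      using funpow_gauss1_range[OF x] by (auto simp: y_def)
    obtain p q p' q' :: int where q: "1 \<le> q" "0 \<le> q'" "q' \<le> q"
      and d: "of_int q * x - of_int p = - y * (of_int q' * x - of_int p')"
      and e: "\<bar>of_int q' * x - of_int p'\<bar> * (of_int q + of_int q' * y) = 1"
      using gauss1_convergents[OF irr x, of n] by (auto simp: y_def)
    define s t where "s = of_int q * x - of_int p" and "t = of_int q' * x - of_int p'"
    have st: "s = - y * t" and t: "\<bar>t\<bar> * (of_int q + of_int q' * y) = 1"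
      using d e by (simp_all add: s_def t_def)
    have qr: "1 \<le> (of_int q :: real)" "0 \<le> (of_int q' :: real)" "(of_int q' :: real) \<le> of_int q"
      using q by simp_all
    have "\<bar>t\<bar> * of_int q \<le> \<bar>t\<bar> * (of_int q + of_int q' * y)"
      using qr y by (intro mult_left_mono) auto
    then have tq: "\<bar>t * of_int q\<bar> \<le> 1" using t qr by (simp add: abs_mult)
    have le: "\<bar>s * r\<bar> \<le> \<bar>t * r\<bar>" for r
      using y mult_right_mono[of y 1 "\<bar>t * r\<bar>"] by (simp add: st abs_mult mult.assoc)
    have "\<bar>t\<bar> * of_int q' \<le> \<bar>t\<bar> * of_int q"
      using qr by (intro mult_left_mono) auto
    then have tq': "\<bar>t * of_int q'\<bar> \<le> 1" using tq qr by (simp add: abs_mult)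
    have "\<bar>t\<bar> * 1 \<le> \<bar>t\<bar> * of_int q"
      using qr by (intro mult_left_mono) auto
    then have t1: "\<bar>t\<bar> \<le> 1" using tq qr by (simp add: abs_mult)
    have s1: "\<bar>s\<bar> \<le> 1" "\<bar>s * of_int q\<bar> \<le> 1" "\<bar>s * of_int q'\<bar> \<le> 1"
      using le[of 1] le[of "of_int q"] le[of "of_int q'"] t1 tq tq' by linarith+
    have p: "of_int p = of_int q * x - s" "of_int p' = of_int q' * x - t"
      by (simp_all add: s_def t_def)
    define A B C where "A = a * p'\<^sup>2 + b * p' * q' + c * q'\<^sup>2"
      and "B = 2 * a * p * p' + b * (p * q' + p' * q) + 2 * c * q * q'"
      and "C = a * p\<^sup>2 + b * p * q + c * q\<^sup>2"
    \<comment> \<open>Eliminating \<open>c\<close> by the equation, and \<open>p\<close>,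
      \<open>p'\<close> by the errors \<open>s\<close>, \<open>t\<close>, cancels the terms
      quadratic in the unbounded denominators. Each remaining product contains an error and is
      bounded.\<close>
    have c: "of_int c = - of_int a * x\<^sup>2 - of_int b * x"
      using f by simp
    have small: "\<bar>of_int a * x * (2 * u) + of_int b * v + of_int a * w\<bar> \<le> of_int M"
      if "\<bar>u\<bar> \<le> 2" "\<bar>v\<bar> \<le> 2" "\<bar>w\<bar> \<le> 2" for u v w
    proof -
      have "\<bar>of_int a * x\<bar> * \<bar>2 * u\<bar> \<le> \<bar>of_int a * x\<bar> * 4" "\<bar>of_int b :: real\<bar> * \<bar>v\<bar> \<le> \<bar>of_int b\<bar> * 2"
        "\<bar>of_int a :: real\<bar> * \<bar>w\<bar> \<le> \<bar>of_int a\<bar> * 2"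
        using that by (intro mult_left_mono; simp)+
      then show ?thesis using M
        unfolding abs_mult[symmetric] by linarith
    qed
    have "of_int C = of_int a * x * (2 * (- (s * of_int q))) + of_int b * (- (s * of_int q)) + of_int a * (s * s)"
      unfolding C_def of_int_add of_int_mult of_int_power p c by (simp add: power2_eq_square algebra_simps)
    moreover have "\<bar>s * s\<bar> \<le> 1" using mult_mono[of "\<bar>s\<bar>" 1 "\<bar>s\<bar>" 1] s1(1) by (simp add: abs_mult)
    ultimately have C: "\<bar>of_int C\<bar> \<le> (of_int M :: real)"
      using small[of "- (s * of_int q)" "- (s * of_int q)" "s * s"] s1 by simp
    have "of_int A = of_int a * x * (2 * (- (t * of_int q'))) + of_int b * (- (t * of_int q')) + of_int a * (t * t)"
      unfolding A_def of_int_add of_int_mult of_int_power p c by (simp add: power2_eq_square algebra_simps)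
    moreover have "\<bar>t * t\<bar> \<le> 1" using mult_mono[of "\<bar>t\<bar>" 1 "\<bar>t\<bar>" 1] t1 by (simp add: abs_mult)
    ultimately have A: "\<bar>of_int A\<bar> \<le> (of_int M :: real)"
      using small[of "- (t * of_int q')" "- (t * of_int q')" "t * t"] tq' by simp
    have "of_int B = of_int a * x * (2 * (- (s * of_int q' + t * of_int q)))
        + of_int b * (- (s * of_int q' + t * of_int q)) + of_int a * (2 * (s * t))"
      unfolding B_def of_int_add of_int_mult of_int_power of_int_numeral p c
      by (simp add: power2_eq_square algebra_simps)
    moreover have "\<bar>s * t\<bar> \<le> 1" using mult_mono[of "\<bar>s\<bar>" 1 "\<bar>t\<bar>" 1] s1 t1 by (simp add: abs_mult)
    moreover have "\<bar>s * of_int q' + t * of_int q\<bar> \<le> 2" using s1 tq by linarith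
    ultimately have B: "\<bar>of_int B\<bar> \<le> (of_int M :: real)"
      using small[of "- (s * of_int q' + t * of_int q)" "- (s * of_int q' + t * of_int q)" "2 * (s * t)"] by simp
    have py: "of_int p + of_int p' * y = x * (of_int q + of_int q' * y)"
      using d by (simp add: algebra_simps)
    have "of_int A * y\<^sup>2 + of_int B * y + of_int C
       = of_int a * (of_int p + of_int p' * y)\<^sup>2
         + of_int b * (of_int p + of_int p' * y) * (of_int q + of_int q' * y)
         + of_int c * (of_int q + of_int q' * y)\<^sup>2"
      by (simp add: A_def B_def C_def power2_eq_square algebra_simps)
    also have "\<dots> = (of_int a * x\<^sup>2 + of_int b * x + of_int c) * (of_int q + of_int q' * y)\<^sup>2"
      unfolding py by (simp add: power2_eq_square algebra_simps)
    finally have root: "of_int A * y\<^sup>2 + of_int B * y + of_int C = 0"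
      using f by simp
    \<comment> \<open>\<open>A / q'^2\<close> is the value of the original polynomial at the
      rational number \<open>p' / q'\<close>, hence nonzero. The case \<open>q' = 0\<close> is the
      formal convergent, where \<open>A = a * p'^2\<close>.\<close>
    have "A \<noteq> 0"
    proof (cases "q' = 0")
      case True
      then have "p' \<noteq> 0" using e by auto
      with True a show ?thesis by (simp add: A_def)
    next
      case False
      have "of_int A = of_int q' ^ 2 * (of_int a * (of_int p' / of_int q')\<^sup>2
          + of_int b * (of_int p' / of_int q') + (of_int c :: real))"
        using False by (simp add: A_def power2_eq_square field_simps)
      moreover have "of_int a * (of_int p' / of_int q')\<^sup>2
          + of_int b * (of_int p' / of_int q') + of_int c \<noteq> (0::real)"
        by (rule quadratic_other_root[OF irr a f]) auto
      ultimately show ?thesis using False by auto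
    qed
    moreover have "A \<in> {-M..M}" "B \<in> {-M..M}" "C \<in> {-M..M}"
      using A B C by (simp_all add: abs_le_iff)
    ultimately show ?thesis
      using root unfolding R_def y_def by blast
  qed
  then have "\<not> inj (\<lambda>n. (gauss1 ^^ n) x)"
    using \<open>finite R\<close> finite_subset[of "range (\<lambda>n. (gauss1 ^^ n) x)" R] range_inj_infinite by blast
  then obtain m n where "m \<noteq> n" "(gauss1 ^^ m) x = (gauss1 ^^ n) x"
    by (auto simp: inj_def)
  then show ?thesis
    by (metis add_diff_inverse_nat linorder_neqE_nat order_less_asym zero_less_diff)
qed

section \<open>Periodic digit sequences\<close>

lemma funpow_periodic:
  fixes f :: "'a \<Rightarrow> 'a"
  assumes "(f ^^ (i + p)) x = (f ^^ i) x" "i \<le> j"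
  shows "(f ^^ (j + k * p)) x = (f ^^ j) x"
proof (induction k)
  case (Suc k)
  have "(f ^^ (j + Suc k * p)) x = (f ^^ (j + k * p - i)) ((f ^^ (i + p)) x)"
    using assms(2) unfolding comp_apply[symmetric, of "f ^^ _" "f ^^ _" x] funpow_add[symmetric]
    by (simp add: algebra_simps)
  also have "\<dots> = (f ^^ (j + k * p)) x"
    unfolding assms(1) unfolding comp_apply[symmetric, of "f ^^ _" "f ^^ _" x] funpow_add[symmetric]
    using assms(2) by simp
  finally show ?case using Suc by simp
qed simp

lemma digit_eq_imp_digits_eq:
  assumes "\<forall>i\<ge>m. digit x (i + p) = digit x i" "1 \<le> m"
  shows "digits ((gauss_map ^^ (m + p)) x) n = digits ((gauss_map ^^ m) x) n"
proof (rule nth_equalityI)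
  fix i assume "i < length (digits ((gauss_map ^^ (m + p)) x) n)"
  moreover have "digit ((gauss_map ^^ k) x) (Suc i) = digit x (Suc (i + k))" for k
    by (simp add: digit_def funpow_add)
  moreover have "digit x (Suc (i + m) + p) = digit x (Suc (i + m))"
    using assms(1) by (rule allE[of _ "Suc (i + m)"]) simp
  ultimately show "digits ((gauss_map ^^ (m + p)) x) n ! i = digits ((gauss_map ^^ m) x) n ! i"
    by (simp add: digits_nth add.assoc)
qed simp

text \<open>Iterates with the same digit sequence coincide by contraction, so periodic digits mean a
  periodic orbit; this gives a fixed point of a power of \<open>gauss1\<close> in each coordinate.
  Conversely the coordinates repeat separately by Lagrange's theorem, with periods that may
  differ.\<close>

lemma eventually_periodic_digits_iff:
  assumes x: "x \<in> diamond" and irr: "diag1 x \<notin> \<rat>" "diag2 x \<notin> \<rat>"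
  shows "(\<exists>m\<ge>1. \<exists>p\<ge>1. \<forall>i\<ge>m. digit x (i + p) = digit x i) \<longleftrightarrow>
    quadratic_irrational (diag1 x) \<and> quadratic_irrational (diag2 x)"
proof -
  have nn: "(gauss_map ^^ i) x \<notin> null_cone" for i
    using irr infinite_orbit_iff[OF x] by simp
  have x01: "0 \<le> diag1 x" "diag1 x < 1" "0 \<le> diag2 x" "diag2 x < 1"
    using x by (auto simp: diamond_iff)
  show ?thesis
  proof
    assume "\<exists>m\<ge>1. \<exists>p\<ge>1. \<forall>i\<ge>m. digit x (i + p) = digit x i"
    then obtain m p where m: "1 \<le> m" and p: "1 \<le> p" and per: "\<forall>i\<ge>m. digit x (i + p) = digit x i"
      by blast
    define y z where "y = (gauss_map ^^ m) x" and "z = (gauss_map ^^ (m + p)) x"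
    have close: "\<bar>diag1 z - diag1 y\<bar> \<le> (1/4) ^ (n div 2) \<and> \<bar>diag2 z - diag2 y\<bar> \<le> (1/4) ^ (n div 2)" for n
    proof -
      have "(gauss_map ^^ i) y \<notin> null_cone" "(gauss_map ^^ i) z \<notin> null_cone" for i
        using nn[of "i + m"] nn[of "i + (m + p)"] by (simp_all add: y_def z_def funpow_add)
      then show ?thesis
        using same_digits_close[of z n y] digit_eq_imp_digits_eq[OF per m]
          funpow_gauss_map_in_diamond[OF x] by (simp add: y_def z_def)
    qed
    have "\<bar>diag1 z - diag1 y\<bar> \<le> 0" "\<bar>diag2 z - diag2 y\<bar> \<le> 0"
      by (rule LIMSEQ_le_const[OF tendsto_quarter_power]; use close in blast)+
    then have "z = y" by (simp add: diag_eq_iff)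
    \<comment> \<open>The period is doubled because an odd number of steps would exchange the
      coordinates.\<close>
    then have "(gauss_map ^^ (m + 2 * p)) x = (gauss_map ^^ m) x"
      using funpow_periodic[where f = gauss_map and i = m and p = p and x = x and j = m and k = 2] by (simp add: y_def z_def)
    then have "diag1 ((gauss_map ^^ (m + 2 * p)) x) = diag1 ((gauss_map ^^ m) x)"
      "diag2 ((gauss_map ^^ (m + 2 * p)) x) = diag2 ((gauss_map ^^ m) x)" by simp_all
    then have "(gauss1 ^^ (m + 2 * p)) (diag1 x) = (gauss1 ^^ m) (diag1 x)"
      "(gauss1 ^^ (m + 2 * p)) (diag2 x) = (gauss1 ^^ m) (diag2 x)"
      using nn by (simp_all add: diag_funpow_gauss_map split: if_splits)
    then have fp: "(gauss1 ^^ (2 * p)) ((gauss1 ^^ m) (diag1 x)) = (gauss1 ^^ m) (diag1 x)"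
      "(gauss1 ^^ (2 * p)) ((gauss1 ^^ m) (diag2 x)) = (gauss1 ^^ m) (diag2 x)"
      by (simp_all add: funpow_add add.commute[of m])
    have "quadratic_irrational ((gauss1 ^^ m) (diag1 x))" "quadratic_irrational ((gauss1 ^^ m) (diag2 x))"
      using fp p irr x01
      by (auto intro!: gauss1_fixed_point_quadratic[of _ "2 * p"] funpow_gauss1_irrational
          simp: funpow_gauss1_range)
    then show "quadratic_irrational (diag1 x) \<and> quadratic_irrational (diag2 x)"
      by (simp add: quadratic_irrational_funpow_gauss1_iff)
  next
    assume "quadratic_irrational (diag1 x) \<and> quadratic_irrational (diag2 x)"
    then obtain i p j q where p: "0 < p" and u: "(gauss1 ^^ (i + p)) (diag1 x) = (gauss1 ^^ i) (diag1 x)"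
      and q: "0 < q" and v: "(gauss1 ^^ (j + q)) (diag2 x) = (gauss1 ^^ j) (diag2 x)"
      using quadratic_orbit_repeats x01 by meson
    \<comment> \<open>\<open>2 * p * q\<close> is a common multiple of the two periods and even, so
      both iterates show the coordinates in the same order. Digit \<open>n\<close> is read off
      iterate \<open>n - 1\<close>.\<close>
    have "digit x (n + 2 * p * q) = digit x n" if "Suc (max i j) \<le> n" for n
    proof -
      define k where "k = n - 1"
      have k: "i \<le> k" "j \<le> k" "n = Suc k" using that by (auto simp: k_def)
      have "(gauss1 ^^ (k + 2 * p * q)) (diag1 x) = (gauss1 ^^ k) (diag1 x)"
        "(gauss1 ^^ (k + 2 * p * q)) (diag2 x) = (gauss1 ^^ k) (diag2 x)"
        using funpow_periodic[OF u k(1), of "2 * q"] funpow_periodic[OF v k(2), of "2 * p"]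
        by (simp_all add: mult.commute mult.left_commute)
      then have "(gauss_map ^^ (k + 2 * p * q)) x = (gauss_map ^^ k) x"
        using nn by (simp add: diag_eq_iff diag_funpow_gauss_map)
      then show ?thesis
        by (simp add: k digit_def)
    qed
    then show "\<exists>m\<ge>1. \<exists>p\<ge>1. \<forall>i\<ge>m. digit x (i + p) = digit x i"
      using p q by (intro exI[of _ "Suc (max i j)"] conjI exI[of _ "2 * p * q"] allI impI) auto
  qed
qed

section \<open>Irreducible quadratic polynomials and the equation over the lattice\<close>

text \<open>A rational root would split off a linear factor whose cofactor is again of degree 1, so
  that neither factor is a unit.\<close>

lemma irreducible_quadratic_root_irrational:
  assumes "degree p = 2" "irreducible (map_poly rat_of_int p)" "poly (map_poly real_of_int p) x = 0"
  shows "x \<notin> \<rat>"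
proof
  assume "x \<in> \<rat>"
  then obtain r where r: "x = real_of_rat r" by (auto elim: Rats_cases)
  have "map_poly real_of_int p = map_poly real_of_rat (map_poly rat_of_int p)"
    by (simp add: map_poly_map_poly o_def)
  moreover have "poly (map_poly real_of_rat f) (real_of_rat r) = real_of_rat (poly f r)" for f
    by (induction f) (auto simp: map_poly_pCons of_rat_add of_rat_mult)
  ultimately have "poly (map_poly rat_of_int p) r = 0"
    using assms(3) r by simp
  then obtain g where g: "map_poly rat_of_int p = [:-r, 1:] * g"
    unfolding poly_eq_0_iff_dvd by (auto elim: dvdE)
  have "degree (map_poly rat_of_int p) = 2"
    using assms(1) by (simp add: degree_map_poly)
  moreover from this have "g \<noteq> 0" unfolding g by auto
  ultimately have "degree g = 1"
    using degree_mult_eq[of "[:-r, 1:]" g] unfolding g by simp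
  have "[:-r, 1:] dvd 1 \<or> g dvd 1"
    using irreducibleD[OF assms(2) g] .
  then show False
    using \<open>degree g = 1\<close> by (auto dest!: dvd_imp_degree_le)
qed

text \<open>A proper factor would be linear and have a rational root, which cannot occur beside the
  irrational root \<open>x\<close>. Over the field of rationals the content of the polynomial is a
  unit.\<close>

lemma quadratic_irreducible:
  fixes a b c :: int
  assumes "x \<notin> \<rat>" "a \<noteq> 0" "of_int a * x\<^sup>2 + of_int b * x + of_int c = (0::real)"
  shows "irreducible (map_poly rat_of_int [:c, b, a:])"
proof (rule irreducibleI)
  let ?p = "map_poly rat_of_int [:c, b, a:]"
  have p: "?p = [:rat_of_int c, rat_of_int b, rat_of_int a:]"
    by (simp add: map_poly_pCons)
  show "?p \<noteq> 0" "\<not> ?p dvd 1"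
    using assms(2) by (auto simp: p dest!: dvd_imp_degree_le)
  fix f g assume fg: "?p = f * g"
  have nz: "f \<noteq> 0" "g \<noteq> 0" using fg p assms(2) by auto
  then have deg: "degree f + degree g = 2"
    using arg_cong[OF fg, of degree] assms(2) by (simp add: p degree_mult_eq)
  have lin: False if h: "degree h = 1" "h dvd ?p" for h
  proof -
    obtain d e where de: "h = [:d, e:]" "e \<noteq> 0"
      using h(1) by (metis degree_pCons_eq_if degree_eq_zeroE One_nat_def Suc_inject pCons_cases
          one_neq_zero pCons_0_0 zero_neq_one pCons_eq_0_iff)
    then have "poly h (- d / e) = 0" by simp
    then have "poly ?p (- d / e) = 0" using h(2) by (auto elim!: dvdE)
    then have "of_int a * (- d / e)\<^sup>2 + of_int b * (- d / e) + of_int c = 0"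
      by (simp add: p power2_eq_square algebra_simps)
    then have "real_of_rat (of_int a * (- d / e)\<^sup>2 + of_int b * (- d / e) + of_int c) = 0"
      by simp
    then have "of_int a * (real_of_rat (- d / e))\<^sup>2 + of_int b * real_of_rat (- d / e) + of_int c = 0"
      by (simp only: of_rat_add of_rat_mult of_rat_power of_rat_of_int_eq)
    moreover have "of_int a * (real_of_rat (- d / e))\<^sup>2 + of_int b * real_of_rat (- d / e) + of_int c \<noteq> 0"
      by (rule quadratic_other_root[OF assms]) auto
    ultimately show False by simp
  qed
  have "degree f \<noteq> 1" "degree g \<noteq> 1"
    using lin[of f] lin[of g] fg by auto
  then have "degree f = 0 \<or> degree g = 0" using deg by linarith
  then show "f dvd 1 \<or> g dvd 1"
    using nz by (auto simp: is_unit_iff_degree)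
qed

text \<open>Split multiplication is coordinatewise in the diagonal coordinates, so the equation
  decouples into two independent integral ones.\<close>

lemma root_of_nondegenerate_quadratic_iff:
  "root_of_nondegenerate_quadratic x \<longleftrightarrow>
     quadratic_irrational (diag1 x) \<and> quadratic_irrational (diag2 x)"
proof
  assume "root_of_nondegenerate_quadratic x"
  then obtain a b c where nd: "nondegenerate_quadratic a b c"
    and e: "split_mult a (split_mult x x) + split_mult b x + c = 0"
    unfolding root_of_nondegenerate_quadratic_def by blast
  have "quadratic_irrational (f x)"
    if f: "f \<in> {diag1, diag2}" and fe: "f a * (f x * f x) + f b * f x + f c = 0" for f
  proof -
    obtain p :: "int poly" where p: "map_poly real_of_int p = [:f c, f b, f a:]" "degree p = 2"
      "irreducible (map_poly rat_of_int p)"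
      using nd f unfolding nondegenerate_quadratic_def by blast
    have co: "f c = of_int (coeff p 0)" "f b = of_int (coeff p 1)" "f a = of_int (coeff p 2)"
      using arg_cong[OF p(1), of "\<lambda>q. coeff q 0"] arg_cong[OF p(1), of "\<lambda>q. coeff q 1"]
        arg_cong[OF p(1), of "\<lambda>q. coeff q 2"]
      by (simp_all add: coeff_map_poly numeral_2_eq_2)
    have "poly (map_poly real_of_int p) x' = f c + x' * (f b + x' * f a)" for x'
      by (simp add: p(1))
    then have "f x \<notin> \<rat>"
      using irreducible_quadratic_root_irrational[OF p(2,3), of "f x"] fe by (simp add: algebra_simps)
    moreover have "coeff p 2 \<noteq> 0" using p(2) by (metis leading_coeff_0_iff degree_0 zero_neq_numeral)
    moreover have "of_int (coeff p 2) * (f x)\<^sup>2 + of_int (coeff p 1) * f x + of_int (coeff p 0) = 0"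
      using fe by (simp add: co power2_eq_square)
    ultimately show ?thesis unfolding quadratic_irrational_def by metis
  qed
  moreover have "diag1 a * (diag1 x * diag1 x) + diag1 b * diag1 x + diag1 c = 0"
    "diag2 a * (diag2 x * diag2 x) + diag2 b * diag2 x + diag2 c = 0"
    using arg_cong[OF e, of diag1] arg_cong[OF e, of diag2] by (simp_all add: diag_split_mult)
  ultimately show "quadratic_irrational (diag1 x) \<and> quadratic_irrational (diag2 x)" by simp
next
  assume "quadratic_irrational (diag1 x) \<and> quadratic_irrational (diag2 x)"
  then obtain a b c a' b' c' :: int where
    1: "diag1 x \<notin> \<rat>" "a \<noteq> 0" "of_int a * (diag1 x)\<^sup>2 + of_int b * diag1 x + of_int c = 0" and
    2: "diag2 x \<notin> \<rat>" "a' \<noteq> 0" "of_int a' * (diag2 x)\<^sup>2 + of_int b' * diag2 x + of_int c' = 0"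
    unfolding quadratic_irrational_def by blast
  \<comment> \<open>The inverse of the isomorphism: \<open>pt m n\<close> has diagonal coordinates
    \<open>m\<close> and \<open>n\<close>, so two unrelated integral equations combine into one over
    the lattice.\<close>
  define pt :: "int \<Rightarrow> int \<Rightarrow> R11" where "pt m n = ((of_int m + of_int n) / 2, (of_int m - of_int n) / 2)" for m n
  have pt: "diag1 (pt m n) = of_int m" "diag2 (pt m n) = of_int n" for m n
    by (simp_all add: pt_def diag1_def diag2_def field_simps)
  have "nondegenerate_quadratic (pt a a') (pt b b') (pt c c')"
    unfolding nondegenerate_quadratic_def
  proof (intro conjI ballI)
    fix f assume "f \<in> {diag1, diag2}"
    then consider "f = diag1" | "f = diag2" by auto
    then show "\<exists>p::int poly. map_poly real_of_int p = [:f (pt c c'), f (pt b b'), f (pt a a'):] \<and>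
        degree p = 2 \<and> irreducible (map_poly rat_of_int p)"
    proof cases
      case 1
      then show ?thesis
        using quadratic_irreducible[OF \<open>diag1 x \<notin> \<rat>\<close> \<open>a \<noteq> 0\<close>] \<open>a \<noteq> 0\<close>
          \<open>of_int a * (diag1 x)\<^sup>2 + of_int b * diag1 x + of_int c = 0\<close>
        by (intro exI[of _ "[:c, b, a:]"]) (simp add: pt map_poly_pCons)
    next
      case 2
      then show ?thesis
        using quadratic_irreducible[OF \<open>diag2 x \<notin> \<rat>\<close> \<open>a' \<noteq> 0\<close>] \<open>a' \<noteq> 0\<close>
          \<open>of_int a' * (diag2 x)\<^sup>2 + of_int b' * diag2 x + of_int c' = 0\<close>
        by (intro exI[of _ "[:c', b', a':]"]) (simp add: pt map_poly_pCons)
    qed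
  qed (simp_all add: lattice_iff pt)
  moreover have "split_mult (pt a a') (split_mult x x) + split_mult (pt b b') x + pt c c' = 0"
    using 1(3) 2(3) by (simp add: diag_eq_iff diag_split_mult pt power2_eq_square)
  ultimately show "root_of_nondegenerate_quadratic x"
    unfolding root_of_nondegenerate_quadratic_def by blast
qed

theorem eventually_repeating_iff: "eventually_repeating x \<longleftrightarrow> root_of_nondegenerate_quadratic x"
proof (cases "infinite_expansion x")
  case True
  then have "diag1 (x - lattice_part x) \<notin> \<rat>" "diag2 (x - lattice_part x) \<notin> \<rat>"
    unfolding infinite_expansion_def infinite_orbit_iff[OF lattice_part_props(2)] by auto
  with True show ?thesis
    unfolding eventually_repeating_def root_of_nondegenerate_quadratic_iff
    using eventually_periodic_digits_iff[OF lattice_part_props(2)[of x]]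
    unfolding diag_fractional_part quadratic_irrational_frac_iff by simp
next
  case False
  then show ?thesis
    unfolding eventually_repeating_def root_of_nondegenerate_quadratic_iff infinite_expansion_iff
    by (auto simp: diagonally_completely_irrational_def quadratic_irrational_def diag1_def diag2_def)
qed

section \<open>Mixing from a Doeblin condition on cylinders\<close>

text \<open>\<open>I n\<close> indexes the cylinders of length \<open>n\<close>, so that the
  exponent in \<open>doeblin\<close> matches the cylinder. In \<open>approx\<close> one length
  serves the whole finite union; by disjointness its indicator is then a sum of indicators of
  cylinders.\<close>

locale doeblin_system = prob_space M for M :: "'a measure" and T :: "'a \<Rightarrow> 'a" +
  fixes I :: "nat \<Rightarrow> 'i set" and C :: "'i \<Rightarrow> 'a set" and c :: real
  assumes preserves: "preserves_measure M T"
    and C_sets: "\<And>n i. i \<in> I n \<Longrightarrow> C i \<in> sets M"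
    and C_disjoint: "\<And>n. disjoint_family_on C (I n)"
    and c_pos: "0 < c" and c_less: "c < 1"
    and doeblin: "\<And>n i B. \<lbrakk>i \<in> I n; B \<in> sets M\<rbrakk> \<Longrightarrow>
      c * measure M (C i) * measure M B \<le> measure M (C i \<inter> (T ^^ n) -` B)"
    and approx: "\<And>A e. \<lbrakk>A \<in> sets M; 0 < e\<rbrakk> \<Longrightarrow>
      \<exists>n F. finite F \<and> F \<subseteq> I n \<and> measure M (sym_diff A (\<Union>i\<in>F. C i)) < e"
begin

lemma T_measurable [measurable]: "T \<in> measurable M M"
  using preserves by (simp add: preserves_measure_def)

lemma T_power_measurable [measurable]: "T ^^ n \<in> measurable M M"
proof (induction n)
  case (Suc n)
  then show ?case by (auto simp: o_def)
qed (simp add: id_def)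

lemma distr_T_power: "distr M M (T ^^ n) = M"
proof (induction n)
  case (Suc n)
  have "distr (distr M M (T ^^ n)) M T = distr M M (T \<circ> T ^^ n)"
    by (rule distr_distr) auto
  then show ?case
    using Suc preserves by (simp add: preserves_measure_def o_def)
qed (simp add: distr_id2 id_def)

lemma sets_vimage: "B \<in> sets M \<Longrightarrow> (T ^^ n) -` B \<inter> space M \<in> sets M"
  by (rule measurable_sets[OF T_power_measurable])

lemma measure_vimage: "B \<in> sets M \<Longrightarrow> measure M ((T ^^ n) -` B \<inter> space M) = measure M B"
  using measure_distr[OF T_power_measurable, of B n] by (simp add: distr_T_power)

lemma space_T_power: "x \<in> space M \<Longrightarrow> (T ^^ n) x \<in> space M"
  using T_power_measurable[of n] by (auto simp: measurable_def)

text \<open>The two integrals are the values at \<open>B\<close> of the pushforward of \<open>f \<mu>\<close> by \<open>T^n\<close> and of the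
  invariant measure of the same mass.\<close>

definition deviation :: "real \<Rightarrow> ('a \<Rightarrow> real) \<Rightarrow> bool" where
  "deviation D f \<longleftrightarrow> (\<forall>e>0. \<exists>N. \<forall>n\<ge>N. \<forall>B\<in>sets M.
     \<bar>(\<integral>x. f x * indicator B ((T ^^ n) x) \<partial>M) - measure M B * (\<integral>x. f x \<partial>M)\<bar>
       \<le> D * (\<integral>x. f x \<partial>M) + e)"

lemma integrable_indicator [simp]: "A \<in> sets M \<Longrightarrow> integrable M (indicator A :: 'a \<Rightarrow> real)"
  by (intro integrable_real_indicator) (simp_all add: emeasure_eq_measure)

lemma integrable_times_indicator:
  assumes "integrable M f" "B \<in> sets M"
  shows "integrable M (\<lambda>x. f x * indicator B ((T ^^ n) x) :: real)"
proof (rule Bochner_Integration.integrable_bound[OF assms(1)])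
  note [measurable] = assms(2) borel_measurable_integrable[OF assms(1)]
  show "(\<lambda>x. f x * indicator B ((T ^^ n) x)) \<in> borel_measurable M" by measurable
qed (auto simp: indicator_def)

text \<open>The property is closed in the \<open>L^1\<close> norm: replacing \<open>f\<close> by
  \<open>g\<close> changes each integral by at most their distance, whatever \<open>n\<close> and
  \<open>B\<close> are.\<close>

lemma deviation_approx:
  assumes f: "integrable M f" and D: "0 \<le> D"
    and ap: "\<And>e. 0 < e \<Longrightarrow> \<exists>g. integrable M g \<and> deviation D g \<and> (\<integral>x. \<bar>f x - g x\<bar> \<partial>M) \<le> e"
  shows "deviation D f"
  unfolding deviation_def
proof (intro allI impI)
  fix e :: real assume "0 < e"
  \<comment> \<open>The two integrals on the left cost \<open>2 * d\<close> and the mass on the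
    right costs \<open>D * d\<close>, in total \<open>e / 2\<close>.\<close>
  define d where "d = e / (2 * (D + 2))"
  have "0 < d" using \<open>0 < e\<close> D by (simp add: d_def)
  then obtain g where g: "integrable M g" "deviation D g" and d: "(\<integral>x. \<bar>f x - g x\<bar> \<partial>M) \<le> d"
    using ap by blast
  obtain N where N: "\<And>n B. \<lbrakk>n \<ge> N; B \<in> sets M\<rbrakk> \<Longrightarrow>
      \<bar>(\<integral>x. g x * indicator B ((T ^^ n) x) \<partial>M) - measure M B * (\<integral>x. g x \<partial>M)\<bar>
       \<le> D * (\<integral>x. g x \<partial>M) + e / 2"
    using g(2) \<open>0 < e\<close> unfolding deviation_def by (meson half_gt_zero)
  show "\<exists>N. \<forall>n\<ge>N. \<forall>B\<in>sets M.
     \<bar>(\<integral>x. f x * indicator B ((T ^^ n) x) \<partial>M) - measure M B * (\<integral>x. f x \<partial>M)\<bar>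
       \<le> D * (\<integral>x. f x \<partial>M) + e"
  proof (intro exI[of _ N] allI impI ballI)
    fix n B assume n: "N \<le> n" and B: "B \<in> sets M"
    have int: "integrable M (\<lambda>x. f x - g x)" using f g by simp
    have "\<bar>(\<integral>x. f x \<partial>M) - (\<integral>x. g x \<partial>M)\<bar> = \<bar>\<integral>x. f x - g x \<partial>M\<bar>"
      using f g by simp
    also have "\<dots> \<le> (\<integral>x. \<bar>f x - g x\<bar> \<partial>M)" by (rule integral_abs_bound)
    finally have 1: "\<bar>(\<integral>x. f x \<partial>M) - (\<integral>x. g x \<partial>M)\<bar> \<le> d" using d by simp
    have "\<bar>(\<integral>x. f x * indicator B ((T ^^ n) x) \<partial>M) - (\<integral>x. g x * indicator B ((T ^^ n) x) \<partial>M)\<bar>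
        = \<bar>\<integral>x. (f x - g x) * indicator B ((T ^^ n) x) \<partial>M\<bar>"
      using integrable_times_indicator[OF f B] integrable_times_indicator[OF g(1) B]
      by (simp add: left_diff_distrib)
    also have "\<dots> \<le> (\<integral>x. \<bar>(f x - g x) * indicator B ((T ^^ n) x)\<bar> \<partial>M)" by (rule integral_abs_bound)
    also have "\<dots> \<le> (\<integral>x. \<bar>f x - g x\<bar> \<partial>M)"
      using integrable_times_indicator[OF int B] int
      by (intro integral_mono integrable_abs) (auto simp: indicator_def)
    finally have 2: "\<bar>(\<integral>x. f x * indicator B ((T ^^ n) x) \<partial>M)
       - (\<integral>x. g x * indicator B ((T ^^ n) x) \<partial>M)\<bar> \<le> d" using d by simp
    have 3: "\<bar>measure M B * (\<integral>x. f x \<partial>M) - measure M B * (\<integral>x. g x \<partial>M)\<bar> \<le> d"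
      using mult_mono[OF prob_le_1[of B] 1] by (simp add: abs_mult flip: right_diff_distrib)
    have "D * (\<integral>x. g x \<partial>M) \<le> D * ((\<integral>x. f x \<partial>M) + d)"
      using 1 D by (intro mult_left_mono) auto
    moreover have "D * d + 2 * d = e / 2"
    proof -
      have "D * d + 2 * d = (D + 2) * d" by (simp add: algebra_simps)
      also have "\<dots> = e / 2" using D unfolding d_def by (simp add: field_simps)
      finally show ?thesis .
    qed
    ultimately show "\<bar>(\<integral>x. f x * indicator B ((T ^^ n) x) \<partial>M) - measure M B * (\<integral>x. f x \<partial>M)\<bar>
       \<le> D * (\<integral>x. f x \<partial>M) + e"
      using N[OF n B] 2 3 unfolding distrib_left by linarith
  qed
qed

text \<open>The bound is proportional to the mass, so sums keep the same \<open>D\<close>.\<close>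

lemma deviation_add:
  assumes f: "integrable M f" "deviation D f" and g: "integrable M g" "deviation D g"
  shows "deviation D (\<lambda>x. f x + g x)"
  unfolding deviation_def
proof (intro allI impI)
  fix e :: real assume "0 < e"
  then obtain N where N: "\<And>n B. \<lbrakk>n \<ge> N; B \<in> sets M\<rbrakk> \<Longrightarrow>
      \<bar>(\<integral>x. f x * indicator B ((T ^^ n) x) \<partial>M) - measure M B * (\<integral>x. f x \<partial>M)\<bar>
       \<le> D * (\<integral>x. f x \<partial>M) + e / 2"
    using f(2) unfolding deviation_def by (meson half_gt_zero)
  obtain N' where N': "\<And>n B. \<lbrakk>n \<ge> N'; B \<in> sets M\<rbrakk> \<Longrightarrow>
      \<bar>(\<integral>x. g x * indicator B ((T ^^ n) x) \<partial>M) - measure M B * (\<integral>x. g x \<partial>M)\<bar>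
       \<le> D * (\<integral>x. g x \<partial>M) + e / 2"
    using g(2) \<open>0 < e\<close> unfolding deviation_def by (meson half_gt_zero)
  show "\<exists>N. \<forall>n\<ge>N. \<forall>B\<in>sets M.
     \<bar>(\<integral>x. (f x + g x) * indicator B ((T ^^ n) x) \<partial>M) - measure M B * (\<integral>x. f x + g x \<partial>M)\<bar>
       \<le> D * (\<integral>x. f x + g x \<partial>M) + e"
  proof (intro exI[of _ "max N N'"] allI impI ballI)
    fix n B assume n: "max N N' \<le> n" and B: "B \<in> sets M"
    have "(\<integral>x. (f x + g x) * indicator B ((T ^^ n) x) \<partial>M)
        = (\<integral>x. f x * indicator B ((T ^^ n) x) \<partial>M) + (\<integral>x. g x * indicator B ((T ^^ n) x) \<partial>M)"
      using integrable_times_indicator[OF f(1) B] integrable_times_indicator[OF g(1) B]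
      by (simp add: distrib_right)
    moreover have "(\<integral>x. f x + g x \<partial>M) = (\<integral>x. f x \<partial>M) + (\<integral>x. g x \<partial>M)"
      using f g by simp
    ultimately show "\<bar>(\<integral>x. (f x + g x) * indicator B ((T ^^ n) x) \<partial>M) - measure M B * (\<integral>x. f x + g x \<partial>M)\<bar>
       \<le> D * (\<integral>x. f x + g x \<partial>M) + e"
      using N[of n B] N'[of n B] n B unfolding distrib_left by (simp add: abs_le_iff algebra_simps)
  qed
qed

lemma deviation_0: "deviation D (\<lambda>x. 0)"
  by (auto simp: deviation_def)

lemma deviation_sum:
  assumes "finite F" "\<And>i. i \<in> F \<Longrightarrow> integrable M (f i)" "\<And>i. i \<in> F \<Longrightarrow> deviation D (f i)"
  shows "deviation D (\<lambda>x. \<Sum>i\<in>F. f i x)"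
  using assms by (induction F rule: finite_induct) (auto intro!: deviation_0 deviation_add)

lemma deviation_cmult:
  assumes f: "deviation D f" and "0 \<le> a"
  shows "deviation D (\<lambda>x. a * f x)"
proof (cases "a = 0")
  case False
  with \<open>0 \<le> a\<close> have a: "0 < a" by simp
  show ?thesis
    unfolding deviation_def
  proof (intro allI impI)
    fix e :: real assume "0 < e"
    then have "0 < e / a" using a by simp
    then obtain N where N: "\<And>n B. \<lbrakk>n \<ge> N; B \<in> sets M\<rbrakk> \<Longrightarrow>
        \<bar>(\<integral>x. f x * indicator B ((T ^^ n) x) \<partial>M) - measure M B * (\<integral>x. f x \<partial>M)\<bar>
         \<le> D * (\<integral>x. f x \<partial>M) + e / a"
      using f unfolding deviation_def by meson
    show "\<exists>N. \<forall>n\<ge>N. \<forall>B\<in>sets M.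
       \<bar>(\<integral>x. (a * f x) * indicator B ((T ^^ n) x) \<partial>M) - measure M B * (\<integral>x. a * f x \<partial>M)\<bar>
         \<le> D * (\<integral>x. a * f x \<partial>M) + e"
    proof (intro exI[of _ N] allI impI ballI)
      fix n B assume n: "N \<le> n" and B: "B \<in> sets M"
      have "\<bar>(\<integral>x. (a * f x) * indicator B ((T ^^ n) x) \<partial>M) - measure M B * (\<integral>x. a * f x \<partial>M)\<bar>
        = a * \<bar>(\<integral>x. f x * indicator B ((T ^^ n) x) \<partial>M) - measure M B * (\<integral>x. f x \<partial>M)\<bar>"
        using a by (simp add: mult.assoc abs_mult mult.left_commute[of _ a] flip: right_diff_distrib)
      also have "\<dots> \<le> a * (D * (\<integral>x. f x \<partial>M) + e / a)"
        using N[OF n B] a by (intro mult_left_mono) auto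
      finally show "\<bar>(\<integral>x. (a * f x) * indicator B ((T ^^ n) x) \<partial>M) - measure M B * (\<integral>x. a * f x \<partial>M)\<bar>
         \<le> D * (\<integral>x. a * f x \<partial>M) + e"
        using a by (simp add: algebra_simps)
    qed
  qed
qed (simp add: deviation_0)

text \<open>Start of the iteration: both compared quantities lie between \<open>0\<close> and the
  mass of \<open>f\<close>.\<close>

lemma deviation_1:
  assumes f: "integrable M f" "\<And>x. x \<in> space M \<Longrightarrow> 0 \<le> f x"
  shows "deviation 1 f"
  unfolding deviation_def
proof (intro allI impI exI[of _ 0] ballI)
  fix e :: real and n B assume "0 < e" and B: "B \<in> sets M"
  have I: "0 \<le> (\<integral>x. f x \<partial>M)" using f(2) by (intro integral_nonneg_AE) auto
  have "0 \<le> (\<integral>x. f x * indicator B ((T ^^ n) x) \<partial>M)"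
    using f(2) by (intro integral_nonneg_AE) auto
  moreover have "(\<integral>x. f x * indicator B ((T ^^ n) x) \<partial>M) \<le> (\<integral>x. f x \<partial>M)"
    using f integrable_times_indicator[OF f(1) B] by (intro integral_mono) (auto simp: indicator_def)
  moreover have "0 \<le> measure M B * (\<integral>x. f x \<partial>M)" "measure M B * (\<integral>x. f x \<partial>M) \<le> 1 * (\<integral>x. f x \<partial>M)"
    using I by (simp, intro mult_right_mono) auto
  ultimately show "\<bar>(\<integral>x. f x * indicator B ((T ^^ n) x) \<partial>M) - measure M B * (\<integral>x. f x \<partial>M)\<bar>
       \<le> 1 * (\<integral>x. f x \<partial>M) + e"
    using \<open>0 < e\<close> by linarith
qed

section \<open>The contraction on cylinders and its extension to all densities\<close>

text \<open>By invariance preimages of null sets are null, so the pushforward of the measure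
  restricted to \<open>A\<close> is absolutely continuous and Radon-Nikodym applies.\<close>

lemma pushforward_density:
  assumes A: "A \<in> sets M"
  obtains h :: "'a \<Rightarrow> real" where "integrable M h"
    "\<And>B. B \<in> sets M \<Longrightarrow> (\<integral>x. h x * indicator B x \<partial>M) = measure M (A \<inter> (T ^^ m) -` B)"
proof -
  note [measurable] = A
  define N where "N = distr (density M (indicator A)) M (T ^^ m)"
  have sets_N: "sets N = sets M" by (simp add: N_def)
  have em: "emeasure N B = emeasure M (A \<inter> (T ^^ m) -` B)" if [measurable]: "B \<in> sets M" for B
  proof -
    have eq: "A \<inter> (T ^^ m) -` B = A \<inter> ((T ^^ m) -` B \<inter> space M)"
      using sets.sets_into_space[OF A] by auto
    have "emeasure N B = emeasure (density M (indicator A)) ((T ^^ m) -` B \<inter> space M)"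
      by (simp add: N_def emeasure_distr)
    also have "\<dots> = emeasure M (A \<inter> ((T ^^ m) -` B \<inter> space M))"
      using sets_vimage[OF that] A by (simp add: emeasure_density nn_integral_indicator
          flip: indicator_inter_arith)
    finally show ?thesis by (simp add: eq)
  qed
  have "absolutely_continuous M N"
    unfolding absolutely_continuous_def
  proof
    fix B assume B: "B \<in> null_sets M"
    then have "B \<in> sets M" "measure M B = 0" by (auto simp: measure_def)
    then have "emeasure M ((T ^^ m) -` B \<inter> space M) = 0"
      by (simp add: emeasure_eq_measure measure_vimage)
    moreover have "emeasure M (A \<inter> (T ^^ m) -` B) \<le> emeasure M ((T ^^ m) -` B \<inter> space M)"
      using sets.sets_into_space[OF A] \<open>B \<in> sets M\<close> by (intro emeasure_mono sets_vimage) auto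
    ultimately show "B \<in> null_sets N"
      using \<open>B \<in> sets M\<close> by (simp add: null_sets_def sets_N em)
  qed
  then obtain f where f [measurable]: "f \<in> borel_measurable M" and N: "density M f = N"
    using Radon_Nikodym[OF _ sets_N] by blast
  have "(\<integral>\<^sup>+x. f x \<partial>M) = emeasure N (space M)"
    by (simp add: N[symmetric] emeasure_density cong: nn_integral_cong)
  also have "\<dots> < \<infinity>" by (simp add: em emeasure_eq_measure)
  finally have fin: "(\<integral>\<^sup>+x. f x \<partial>M) \<noteq> \<infinity>" by simp
  have ae: "AE x in M. f x \<noteq> \<infinity>" by (rule nn_integral_noteq_infinite[OF f fin])
  define h where "h x = enn2real (f x)" for x
  have h [measurable]: "h \<in> borel_measurable M" unfolding h_def by measurable
  have h0: "0 \<le> h x" for x by (simp add: h_def)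
  have aeh: "AE x in M. ennreal (h x) = f x"
    using ae by eventually_elim (simp add: h_def less_top)
  have "(\<integral>\<^sup>+x. ennreal (h x) \<partial>M) = (\<integral>\<^sup>+x. f x \<partial>M)"
    using aeh by (rule nn_integral_cong_AE)
  then have "integrable M h"
    using fin h0 by (intro integrableI_nonneg) (auto simp: less_top)
  moreover have "(\<integral>x. h x * indicator B x \<partial>M) = measure M (A \<inter> (T ^^ m) -` B)"
    if [measurable]: "B \<in> sets M" for B
  proof -
    have "(\<integral>\<^sup>+x. ennreal (h x * indicator B x) \<partial>M) = (\<integral>\<^sup>+x. f x * indicator B x \<partial>M)"
      using aeh by (intro nn_integral_cong_AE) (auto simp: indicator_def)
    also have "\<dots> = emeasure M (A \<inter> (T ^^ m) -` B)"
      using em[OF that] by (simp add: N[symmetric] emeasure_density)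
    finally show ?thesis
      using h0 by (subst integral_eq_nn_integral) (auto simp: measure_def)
  qed
  ultimately show ?thesis by (rule that)
qed

text \<open>The Doeblin condition splits the pushforward of \<open>\<mu>\<close> restricted to a cylinder as
  \<open>c \<mu>(C) \<mu> + h' \<mu>\<close> with \<open>h' \<ge> 0\<close>. The first part is invariant, so only the second one, of
  mass \<open>(1 - c) \<mu>(C)\<close>, contributes to the deviation.\<close>

lemma deviation_cylinder:
  assumes D: "\<And>f. \<lbrakk>integrable M f; \<And>x. x \<in> space M \<Longrightarrow> 0 \<le> f x\<rbrakk> \<Longrightarrow> deviation D f"
    and i: "i \<in> I m"
  shows "deviation ((1 - c) * D) (indicator (C i))"
proof -
  note C [measurable] = C_sets[OF i]
  obtain h :: "'a \<Rightarrow> real" where h: "integrable M h"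
    and hB: "\<And>B. B \<in> sets M \<Longrightarrow> (\<integral>x. h x * indicator B x \<partial>M) = measure M (C i \<inter> (T ^^ m) -` B)"
    using pushforward_density[OF C] by blast
  note [measurable] = borel_measurable_integrable[OF h]
  define k where "k = c * measure M (C i)"
  \<comment> \<open>Where \<open>h\<close> is below \<open>k\<close>: applying
    \<open>doeblin\<close> to \<open>E\<close> itself shows that the integral of the nonnegative
    function \<open>k - h\<close> over \<open>E\<close> is at most \<open>0\<close>, so
    \<open>E\<close> is a null set.\<close>
  define E where "E = {x \<in> space M. h x < k}"
  have [measurable]: "E \<in> sets M" unfolding E_def by measurable
  have iE: "integrable M (\<lambda>x. h x * indicator E x)"
    using integrable_times_indicator[OF h \<open>E \<in> sets M\<close>, of 0] by simp
  have "(\<integral>x. (k - h x) * indicator E x \<partial>M) = k * measure M E - (\<integral>x. h x * indicator E x \<partial>M)"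
    using iE by (simp add: left_diff_distrib)
  also have "\<dots> \<le> 0"
    using doeblin[OF i \<open>E \<in> sets M\<close>] by (simp add: hB k_def)
  finally have "(\<integral>x. (k - h x) * indicator E x \<partial>M) \<le> 0" .
  moreover have nn: "AE x in M. 0 \<le> (k - h x) * indicator E x"
    by (auto simp: E_def indicator_def)
  ultimately have "(\<integral>x. (k - h x) * indicator E x \<partial>M) = 0"
    using integral_nonneg_AE[OF nn] by simp
  moreover have "integrable M (\<lambda>x. (k - h x) * indicator E x)"
    using iE by (simp add: left_diff_distrib)
  ultimately have "AE x in M. (k - h x) * indicator E x = 0"
    using nn integral_nonneg_eq_0_iff_AE by blast
  then have aek: "AE x in M. k \<le> h x"
    using AE_space by eventually_elim (auto simp: E_def indicator_def split: if_splits)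
  \<comment> \<open>Almost everywhere this is \<open>h - k\<close>; the maximum makes it nonnegative
    at every point, as the assumption \<open>D\<close> demands.\<close>
  define g where "g x = max 0 (h x - k)" for x
  have g: "integrable M g" unfolding g_def[abs_def] using h by simp
  have aeg: "AE x in M. g x = h x - k"
    using aek by eventually_elim (simp add: g_def)
  have ig: "(\<integral>x. g x * indicator ((T ^^ n) -` B \<inter> space M) x \<partial>M)
      = measure M (C i \<inter> (T ^^ (n + m)) -` B) - k * measure M B"
    if B: "B \<in> sets M" for n B
  proof -
    let ?B = "(T ^^ n) -` B \<inter> space M"
    have [measurable]: "?B \<in> sets M" by (rule sets_vimage[OF B])
    have "(\<integral>x. g x * indicator ?B x \<partial>M) = (\<integral>x. h x * indicator ?B x - k * indicator ?B x \<partial>M)"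
      using aeg by (intro integral_cong_AE) (auto simp: g_def algebra_simps)
    also have "\<dots> = measure M (C i \<inter> (T ^^ m) -` ?B) - k * measure M ?B"
      using integrable_times_indicator[OF h \<open>?B \<in> sets M\<close>, of 0] by (simp add: hB)
    also have "C i \<inter> (T ^^ m) -` ?B = C i \<inter> (T ^^ (n + m)) -` B"
      using sets.sets_into_space[OF C] space_T_power[of _ m] by (auto simp: funpow_add)
    finally show ?thesis by (simp add: measure_vimage[OF B])
  qed
  have Ig: "(\<integral>x. g x \<partial>M) = (1 - c) * measure M (C i)"
  proof -
    have "(\<integral>x. g x \<partial>M) = (\<integral>x. g x * indicator ((T ^^ 0) -` space M \<inter> space M) x \<partial>M)"
      by (intro Bochner_Integration.integral_cong) auto
    also have "\<dots> = measure M (C i \<inter> (T ^^ m) -` space M) - k"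
      by (subst ig) (simp_all add: prob_space)
    also have "C i \<inter> (T ^^ m) -` space M = C i"
      using sets.sets_into_space[OF C] space_T_power[of _ m] by auto
    finally show ?thesis by (simp add: k_def algebra_simps)
  qed
  have dev: "deviation D g" by (rule D[OF g]) (simp add: g_def)
  show ?thesis
    unfolding deviation_def
  proof (intro allI impI)
    fix e :: real assume "0 < e"
    then obtain N where N: "\<And>n B. \<lbrakk>n \<ge> N; B \<in> sets M\<rbrakk> \<Longrightarrow>
        \<bar>(\<integral>x. g x * indicator B ((T ^^ n) x) \<partial>M) - measure M B * (\<integral>x. g x \<partial>M)\<bar>
         \<le> D * (\<integral>x. g x \<partial>M) + e"
      using dev unfolding deviation_def by meson
    show "\<exists>N. \<forall>n\<ge>N. \<forall>B\<in>sets M.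
       \<bar>(\<integral>x. indicator (C i) x * indicator B ((T ^^ n) x) \<partial>M) - measure M B * (\<integral>x. indicator (C i) x \<partial>M)\<bar>
         \<le> (1 - c) * D * (\<integral>x. indicator (C i) x \<partial>M) + e"
    \<comment> \<open>The first \<open>m\<close> steps turn the cylinder into a density; only the
      other \<open>n - m\<close> steps act on \<open>g\<close>.\<close>
    proof (intro exI[of _ "N + m"] allI impI ballI)
      fix n B assume n: "N + m \<le> n" and B: "B \<in> sets M"
      have "(\<integral>x. g x * indicator B ((T ^^ (n - m)) x) \<partial>M)
          = (\<integral>x. g x * indicator ((T ^^ (n - m)) -` B \<inter> space M) x \<partial>M)"
        by (intro Bochner_Integration.integral_cong) (auto simp: indicator_def)
      also have "\<dots> = measure M (C i \<inter> (T ^^ n) -` B) - k * measure M B"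
        using n by (simp add: ig[OF B])
      finally have 1: "(\<integral>x. g x * indicator B ((T ^^ (n - m)) x) \<partial>M)
          = measure M (C i \<inter> (T ^^ n) -` B) - k * measure M B" .
      have eq: "C i \<inter> (T ^^ n) -` B = C i \<inter> ((T ^^ n) -` B \<inter> space M)"
        using sets.sets_into_space[OF C] by auto
      have "(\<integral>x. indicator (C i) x * indicator B ((T ^^ n) x) \<partial>M)
          = (\<integral>x. indicator (C i \<inter> (T ^^ n) -` B) x \<partial>M :: real)"
        by (intro Bochner_Integration.integral_cong) (auto simp: indicator_def)
      also have "\<dots> = measure M (C i \<inter> (T ^^ n) -` B)"
        unfolding eq using sets_vimage[OF B, of n] by simp
      finally have 2: "(\<integral>x. indicator (C i) x * indicator B ((T ^^ n) x) \<partial>M)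
          = measure M (C i \<inter> (T ^^ n) -` B)" .
      have 3: "(\<integral>x. indicator (C i) x \<partial>M) = measure M (C i)" by simp
      have "N \<le> n - m" using n by simp
      from N[OF this B] show "\<bar>(\<integral>x. indicator (C i) x * indicator B ((T ^^ n) x) \<partial>M)
          - measure M B * (\<integral>x. indicator (C i) x \<partial>M)\<bar>
         \<le> (1 - c) * D * (\<integral>x. indicator (C i) x \<partial>M) + e"
        unfolding 1 2 3 Ig k_def by (simp add: algebra_simps)
    qed
  qed
qed

text \<open>Indicators are approximated by finite disjoint unions of cylinders. Nonnegative
  functions follow by induction over their measurable construction, monotone limits being limits in
  \<open>L^1\<close> by dominated convergence.\<close>

lemma deviation_nonneg:
  assumes cyl: "\<And>n i. i \<in> I n \<Longrightarrow> deviation D (indicator (C i))" and D: "0 \<le> D"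
    and f: "integrable M f" "\<And>x. x \<in> space M \<Longrightarrow> 0 \<le> f x"
  shows "deviation D f"
proof -
  have ind: "deviation D (indicator A)" if A [measurable]: "A \<in> sets M" for A
  proof (rule deviation_approx[OF _ D])
    fix e :: real assume "0 < e"
    then obtain n F where F: "finite F" "F \<subseteq> I n"
      and le: "measure M (sym_diff A (\<Union>i\<in>F. C i)) < e"
      using approx[OF A] by blast
    let ?U = "\<Union>i\<in>F. C i"
    have U [measurable]: "?U \<in> sets M"
      using F C_sets by (intro sets.finite_UN) auto
    have eq: "indicator ?U x = (\<Sum>i\<in>F. indicator (C i) x :: real)" for x
      using disjoint_family_on_mono[OF F(2) C_disjoint] F(1) by (intro indicator_UN_disjoint)
    have "deviation D (indicator ?U)"
      unfolding eq[abs_def] using F C_sets cyl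
      by (intro deviation_sum) (auto simp: subset_eq)
    moreover have "(\<integral>x. \<bar>indicator A x - indicator ?U x\<bar> \<partial>M)
        = (\<integral>x. indicator (sym_diff A ?U) x \<partial>M :: real)"
      by (intro Bochner_Integration.integral_cong) (auto simp: indicator_def)
    then have "(\<integral>x. \<bar>indicator A x - indicator ?U x\<bar> \<partial>M) = measure M (sym_diff A ?U)"
      by simp
    ultimately show "\<exists>g. integrable M g \<and> deviation D g \<and> (\<integral>x. \<bar>indicator A x - g x\<bar> \<partial>M) \<le> e"
      using le by (intro exI[of _ "indicator ?U"]) auto
  qed simp
  \<comment> \<open>The induction rule asks for nonnegativity everywhere, while \<open>f\<close> is
    controlled only on the space.\<close>
  define f' where "f' x = (if x \<in> space M then f x else 0)" for x
  have meas: "f' \<in> borel_measurable M"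
    using borel_measurable_integrable[OF f(1)] by (subst measurable_cong[of _ _ f]) (auto simp: f'_def)
  have nonneg: "0 \<le> f' x" for x using f(2) by (simp add: f'_def)
  have "integrable M f' \<longrightarrow> deviation D f'"
    using meas nonneg
  proof (induction rule: borel_measurable_induct_real)
    case (set A)
    then show ?case using ind by simp
  next
    case (mult u c)
    then show ?case
      by (cases "c = 0") (auto intro: deviation_cmult deviation_0)
  next
    case (add u v)
    show ?case
    proof
      assume int: "integrable M (\<lambda>x. v x + u x)"
      note [measurable] = add.hyps(1,3)
      have "integrable M u" "integrable M v"
        using add.hyps(2,4) by (auto intro!: Bochner_Integration.integrable_bound[OF int])
      then show "deviation D (\<lambda>x. v x + u x)"
        using add.IH by (intro deviation_add) auto
    qed
  next
    case (seq U)
    show ?case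
    proof
      assume int: "integrable M f'"
      note [measurable] = seq.hyps(1)
      have lim: "(\<lambda>i. U i x) \<longlonglongrightarrow> f' x" if "x \<in> space M" for x
        using seq.hyps(4) that .
      have mono: "U i x \<le> f' x" if "x \<in> space M" for i x
        using incseq_le[OF _ lim[OF that]] seq.hyps(3) by (auto simp: incseq_def le_fun_def)
      have intU: "integrable M (U i)" for i
        using seq.hyps(2) mono by (intro Bochner_Integration.integrable_bound[OF int]) (auto intro!: AE_I2 order_trans[OF _ abs_ge_self])
      have "(\<lambda>i. \<integral>x. \<bar>f' x - U i x\<bar> \<partial>M) \<longlonglongrightarrow> (\<integral>x. 0 \<partial>M)"
      proof (rule integral_dominated_convergence[where w = "\<lambda>x. \<bar>f' x\<bar>"])
        show "AE x in M. (\<lambda>i. \<bar>f' x - U i x\<bar>) \<longlonglongrightarrow> 0"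
          using lim by (intro AE_I2) (auto intro!: tendsto_eq_intros)
        show "AE x in M. norm \<bar>f' x - U i x\<bar> \<le> \<bar>f' x\<bar>" for i
        proof (rule AE_I2)
          fix x assume "x \<in> space M"
          then show "norm \<bar>f' x - U i x\<bar> \<le> \<bar>f' x\<bar>"
            using mono[of x i] seq.hyps(2)[of i x] by auto
        qed
      qed (use int intU in auto)
      then have conv: "(\<lambda>i. \<integral>x. \<bar>f' x - U i x\<bar> \<partial>M) \<longlonglongrightarrow> 0" by simp
      show "deviation D f'"
      proof (rule deviation_approx[OF int D])
        fix e :: real assume "0 < e"
        from order_tendstoD(2)[OF conv this]
        obtain i where "(\<integral>x. \<bar>f' x - U i x\<bar> \<partial>M) < e"
          by (auto dest: eventually_happens)
        then show "\<exists>g. integrable M g \<and> deviation D g \<and> (\<integral>x. \<bar>f' x - g x\<bar> \<partial>M) \<le> e"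
          using intU seq.IH[of i] by (intro exI[of _ "U i"]) auto
      qed
    qed
  qed
  moreover have "integrable M f'"
    using f(1) by (subst Bochner_Integration.integrable_cong[of _ M _ f]) (auto simp: f'_def)
  ultimately have dev: "deviation D f'" by simp
  show ?thesis
  proof (rule deviation_approx[OF f(1) D])
    fix e :: real assume "0 < e"
    have "(\<integral>x. \<bar>f x - f' x\<bar> \<partial>M) = (\<integral>x. 0 \<partial>M)"
      by (intro Bochner_Integration.integral_cong) (auto simp: f'_def)
    then show "\<exists>g. integrable M g \<and> deviation D g \<and> (\<integral>x. \<bar>f x - g x\<bar> \<partial>M) \<le> e"
      using dev \<open>integrable M f'\<close> \<open>0 < e\<close> by (intro exI[of _ f']) simp
  qed
qed

text \<open>Each round gains a factor \<open>1 - c\<close> on cylinders and passes it on to all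
  densities. The induction ranges over all \<open>f\<close> because the cylinder step needs the
  previous bound for its remainder \<open>g\<close>.\<close>

lemma deviation_power:
  assumes "integrable M f" "\<And>x. x \<in> space M \<Longrightarrow> 0 \<le> f x"
  shows "deviation ((1 - c) ^ k) f"
  using assms
proof (induction k arbitrary: f)
  case (Suc k)
  show ?case
    unfolding power_Suc
  proof (rule deviation_nonneg)
    show "deviation ((1 - c) * (1 - c) ^ k) (indicator (C i))" if "i \<in> I n" for n i
      using Suc.IH that by (rule deviation_cylinder)
    show "0 \<le> (1 - c) * (1 - c) ^ k" using c_less by simp
  qed (use Suc.prems in auto)
qed (simp add: deviation_1)

section \<open>Mixing, exactness and ergodicity\<close>

lemma uniform_mixing:
  assumes A: "A \<in> sets M" and e: "0 < e"
  shows "\<exists>N. \<forall>n\<ge>N. \<forall>B\<in>sets M. \<bar>measure M (A \<inter> (T ^^ n) -` B) - measure M A * measure M B\<bar> < e"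
proof -
  have "(\<lambda>k. (1 - c) ^ k) \<longlonglongrightarrow> 0"
    using c_pos c_less by (intro LIMSEQ_realpow_zero) auto
  from order_tendstoD(2)[OF this, of "e / 2"] obtain k where k: "(1 - c) ^ k < e / 2"
    using e by (auto dest: eventually_happens)
  have "deviation ((1 - c) ^ k) (indicator A)"
    using A by (intro deviation_power) auto
  then obtain N where N: "\<And>n B. \<lbrakk>n \<ge> N; B \<in> sets M\<rbrakk> \<Longrightarrow>
      \<bar>(\<integral>x. indicator A x * indicator B ((T ^^ n) x) \<partial>M) - measure M B * (\<integral>x. indicator A x \<partial>M)\<bar>
       \<le> (1 - c) ^ k * (\<integral>x. indicator A x \<partial>M) + e / 2"
    using e unfolding deviation_def by (meson half_gt_zero)
  show ?thesis
  proof (intro exI[of _ N] allI impI ballI)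
    fix n B assume n: "N \<le> n" and B: "B \<in> sets M"
    have eq: "A \<inter> (T ^^ n) -` B = A \<inter> ((T ^^ n) -` B \<inter> space M)"
      using sets.sets_into_space[OF A] by auto
    have "(\<integral>x. indicator A x * indicator B ((T ^^ n) x) \<partial>M)
        = (\<integral>x. indicator (A \<inter> (T ^^ n) -` B) x \<partial>M :: real)"
      by (intro Bochner_Integration.integral_cong) (auto simp: indicator_def)
    also have "\<dots> = measure M (A \<inter> (T ^^ n) -` B)"
      unfolding eq using sets_vimage[OF B, of n] A by simp
    finally have 1: "(\<integral>x. indicator A x * indicator B ((T ^^ n) x) \<partial>M)
        = measure M (A \<inter> (T ^^ n) -` B)" .
    have "(1 - c) ^ k * measure M A \<le> (1 - c) ^ k * 1"
      using c_less by (intro mult_left_mono) auto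
    then show "\<bar>measure M (A \<inter> (T ^^ n) -` B) - measure M A * measure M B\<bar> < e"
      using N[OF n B] k A unfolding 1 by (simp add: mult.commute)
  qed
qed

lemma exact:
  assumes image: "\<And>A. A \<in> sets M \<Longrightarrow> T ` A \<in> sets M"
  shows "exact_map M T"
  unfolding exact_map_def
proof (intro ballI impI)
  fix A assume A: "A \<in> sets M" and pos: "measure M A > 0"
  have im: "(T ^^ n) ` A \<in> sets M" for n
  proof (induction n)
    case (Suc n)
    have "(T ^^ Suc n) ` A = T ` (T ^^ n) ` A" by (simp add: image_comp)
    then show ?case using image[OF Suc] by simp
  qed (simp add: A)
  show "(\<lambda>n. measure M ((T ^^ n) ` A)) \<longlonglongrightarrow> 1"
    unfolding LIMSEQ_def
  proof (intro allI impI)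
    fix r :: real assume "0 < r"
    then have "0 < r * measure M A" using pos by simp
    then obtain N where N: "\<And>n B. \<lbrakk>n \<ge> N; B \<in> sets M\<rbrakk> \<Longrightarrow>
        \<bar>measure M (A \<inter> (T ^^ n) -` B) - measure M A * measure M B\<bar> < r * measure M A"
      using uniform_mixing[OF A] by meson
    show "\<exists>N. \<forall>n\<ge>N. dist (measure M ((T ^^ n) ` A)) 1 < r"
    proof (intro exI[of _ N] allI impI)
      fix n assume "N \<le> n"
      have "A \<inter> (T ^^ n) -` (T ^^ n) ` A = A" by auto
      then have "\<bar>measure M A - measure M A * measure M ((T ^^ n) ` A)\<bar> < r * measure M A"
        using N[OF \<open>N \<le> n\<close> im[of n]] by simp
      also have "measure M A - measure M A * measure M ((T ^^ n) ` A)
          = measure M A * (1 - measure M ((T ^^ n) ` A))"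
        by (simp add: right_diff_distrib)
      finally show "dist (measure M ((T ^^ n) ` A)) 1 < r"
        using pos by (simp add: abs_mult dist_real_def abs_minus_commute mult.commute)
    qed
  qed
qed

text \<open>For an invariant set the estimate with \<open>B = A\<close> says that its measure equals
  its own square.\<close>

lemma ergodic: "ergodic_map M T"
  unfolding ergodic_map_def
proof (intro ballI impI)
  fix A assume A: "A \<in> sets M" and inv: "T -` A \<inter> space M = A"
  have *: "A \<inter> (T ^^ n) -` A = A" for n
  proof (induction n)
    case (Suc n)
    have "(T ^^ Suc n) x \<in> A" if "x \<in> A" for x
    proof -
      have "(T ^^ n) x \<in> A" using Suc that by auto
      then show ?thesis using inv by auto
    qed
    then show ?case by auto
  qed simp
  have "\<bar>measure M A - measure M A * measure M A\<bar> < e" if "0 < e" for e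
    using uniform_mixing[OF A that] A * by (metis order_refl)
  then have "measure M A - measure M A * measure M A = 0"
    by (metis less_irrefl zero_less_abs_iff)
  then have "measure M A * (1 - measure M A) = 0"
    by (simp add: right_diff_distrib)
  then show "measure M A = 0 \<or> measure M A = 1" by auto
qed

lemma mixing: "mixing_of_all_orders M T"
  unfolding mixing_of_all_orders_def
proof (rule allI)
  fix k
  show "\<forall>A :: nat \<Rightarrow> 'a set. (\<forall>i\<le>k. A i \<in> sets M) \<longrightarrow>
       (\<forall>\<epsilon>>0. \<exists>N. \<forall>n :: nat \<Rightarrow> nat. (\<forall>j<k. n j \<ge> N) \<longrightarrow>
          \<bar>measure M (\<Inter>i\<le>k. (T ^^ (\<Sum>j<i. n j)) -` A i \<inter> space M)
             - (\<Prod>i\<le>k. measure M (A i))\<bar> < \<epsilon>)"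
  proof (induction k)
    case 0
    have "A 0 \<inter> space M = A 0" if "A 0 \<in> sets M" for A :: "nat \<Rightarrow> 'a set"
      using sets.sets_into_space[OF that] by auto
    then show ?case by simp
  next
    case (Suc k)
    show ?case
    proof (intro allI impI)
      fix A :: "nat \<Rightarrow> 'a set" and e :: real
      assume A: "\<forall>i\<le>Suc k. A i \<in> sets M" and e: "0 < e"
      then have "\<forall>i\<le>k. A (Suc i) \<in> sets M" by simp
      then obtain N where N: "\<And>n. (\<forall>j<k. n j \<ge> N) \<Longrightarrow>
          \<bar>measure M (\<Inter>i\<le>k. (T ^^ (\<Sum>j<i. n j)) -` A (Suc i) \<inter> space M)
             - (\<Prod>i\<le>k. measure M (A (Suc i)))\<bar> < e / 2"
        using Suc.IH[rule_format, of "\<lambda>i. A (Suc i)" "e / 2"] e by auto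
      have A0: "A 0 \<in> sets M" using A by simp
      then obtain N' where N': "\<And>n B. \<lbrakk>n \<ge> N'; B \<in> sets M\<rbrakk> \<Longrightarrow>
          \<bar>measure M (A 0 \<inter> (T ^^ n) -` B) - measure M (A 0) * measure M B\<bar> < e / 2"
        using uniform_mixing[OF A0, of "e / 2"] e by auto
      show "\<exists>N. \<forall>n :: nat \<Rightarrow> nat. (\<forall>j<Suc k. n j \<ge> N) \<longrightarrow>
          \<bar>measure M (\<Inter>i\<le>Suc k. (T ^^ (\<Sum>j<i. n j)) -` A i \<inter> space M)
             - (\<Prod>i\<le>Suc k. measure M (A i))\<bar> < e"
      proof (intro exI[of _ "max N N'"] allI impI)
        fix n :: "nat \<Rightarrow> nat" assume n: "\<forall>j<Suc k. n j \<ge> max N N'"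
        \<comment> \<open>All later conditions pulled back by the first gap only. \<open>B\<close>
          depends on the other gaps, but its measure is controlled by the induction hypothesis and
          \<open>N'\<close> does not depend on it.\<close>
        define B where "B = (\<Inter>i\<le>k. (T ^^ (\<Sum>j<i. n (Suc j))) -` A (Suc i) \<inter> space M)"
        have B: "B \<in> sets M"
          unfolding B_def using A by (intro sets.finite_INT sets_vimage) auto
        have "(\<Inter>i\<le>Suc k. (T ^^ (\<Sum>j<i. n j)) -` A i \<inter> space M)
          = (A 0 \<inter> space M) \<inter> (\<Inter>i\<le>k. (T ^^ (\<Sum>j<Suc i. n j)) -` A (Suc i) \<inter> space M)"
          unfolding atMost_Suc_eq_insert_0 by auto
        also have "\<dots> = A 0 \<inter> (T ^^ n 0) -` B"
          using sets.sets_into_space[OF A0] space_T_power[of _ "n 0"]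
          unfolding sum.lessThan_Suc_shift add.commute[of "n 0"] by (auto simp: B_def funpow_add)
        finally have 1: "(\<Inter>i\<le>Suc k. (T ^^ (\<Sum>j<i. n j)) -` A i \<inter> space M) = A 0 \<inter> (T ^^ n 0) -` B" .
        have 2: "(\<Prod>i\<le>Suc k. measure M (A i)) = measure M (A 0) * (\<Prod>i\<le>k. measure M (A (Suc i)))"
          by (rule prod.atMost_Suc_shift)
        have 3: "\<bar>measure M B - (\<Prod>i\<le>k. measure M (A (Suc i)))\<bar> < e / 2"
          unfolding B_def using n by (intro N) auto
        have 4: "\<bar>measure M (A 0 \<inter> (T ^^ n 0) -` B) - measure M (A 0) * measure M B\<bar> < e / 2"
          using n B by (intro N') auto
        have "\<bar>measure M (A 0) * measure M B - measure M (A 0) * (\<Prod>i\<le>k. measure M (A (Suc i)))\<bar>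
            \<le> 1 * \<bar>measure M B - (\<Prod>i\<le>k. measure M (A (Suc i)))\<bar>"
          unfolding right_diff_distrib[symmetric] abs_mult by (intro mult_right_mono) auto
        then show "\<bar>measure M (\<Inter>i\<le>Suc k. (T ^^ (\<Sum>j<i. n j)) -` A i \<inter> space M)
             - (\<Prod>i\<le>Suc k. measure M (A i))\<bar> < e"
          using 3 4 unfolding 1 2 mult_1 by linarith
      qed
    qed
  qed
qed

end

section \<open>Integration over the unit interval\<close>

lemma AE_lborel_irrational: "AE x in lborel. (x::real) \<notin> \<rat>"
proof -
  have "countable (\<rat> :: real set)" by (rule countable_rat)
  then have "\<rat> \<in> null_sets (lborel :: real measure)"
    using countable_imp_null_set_lborel by blast
  then show ?thesis by (rule AE_not_in)
qed

text \<open>The substitution \<open>x = 1 / (k + t)\<close>. It is decreasing, so a reflection comes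
  before it to make it increasing.\<close>

lemma nn_integral_reciprocal:
  fixes F :: "real \<Rightarrow> ennreal" and k :: real
  assumes [measurable]: "F \<in> borel_measurable borel" and k: "0 < k"
  shows "(\<integral>\<^sup>+x. F x * indicator {1 / (k + 1)..1 / k} x \<partial>lborel)
       = (\<integral>\<^sup>+t. F (1 / (k + t)) * ennreal (1 / (k + t)\<^sup>2) * indicator {0..1} t \<partial>lborel)"
proof -
  have "(\<integral>\<^sup>+x. F x * indicator {1 / (k + 1)..1 / k} x \<partial>lborel)
      = (\<integral>\<^sup>+x. F (- x) * indicator {1 / (k + 1)..1 / k} (- x) \<partial>lborel)"
    using nn_integral_real_affine[of "\<lambda>x. F x * indicator {1 / (k + 1)..1 / k} x" "-1" 0] by simp
  also have "\<dots> = (\<integral>\<^sup>+x. F (- x) * indicator {- 1 / (k + 0)..- 1 / (k + 1)} x \<partial>lborel)"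
    by (intro nn_integral_cong) (auto simp: indicator_def)
  also have "\<dots> = (\<integral>\<^sup>+t. F (- (- 1 / (k + t))) * ennreal (1 / (k + t)\<^sup>2) * indicator {0..1} t \<partial>lborel)"
  proof (rule nn_integral_substitution_aux[where g = "\<lambda>t. - 1 / (k + t)"])
    show "((\<lambda>t. - 1 / (k + t)) has_real_derivative 1 / (k + x)\<^sup>2) (at x)" if "x \<in> {0..1}" for x
      using that k by (auto intro!: derivative_eq_intros simp: power2_eq_square)
    show "continuous_on {0..1} (\<lambda>t. 1 / (k + t)\<^sup>2)"
      using k by (auto intro!: continuous_intros)
  qed auto
  finally show ?thesis by simp
qed

text \<open>The family of densities \<open>(1 + w) / (1 + w t)\<^sup>2\<close>, \<open>0 \<le> w \<le> 1\<close>, is stable (up to a factor)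
  under pushing the restriction to a cylinder forward by the Gauss map.\<close>

definition moebius_density :: "real \<Rightarrow> real \<Rightarrow> real" where
  "moebius_density w t = (1 + w) / (1 + w * t)\<^sup>2"

definition gauss_density :: "real \<Rightarrow> real" where
  "gauss_density t = 1 / (ln 2 * (1 + t))"

text \<open>The closed interval suits the substitution; it differs from the side of the half-open
  square by a null set.\<close>

definition on_unit :: "(real \<Rightarrow> real) \<Rightarrow> real \<Rightarrow> ennreal" where
  "on_unit d t = ennreal (d t) * indicator {0..1} t"

lemma moebius_density_measurable [measurable]: "moebius_density w \<in> borel_measurable borel"
  unfolding moebius_density_def by measurable

lemma gauss_density_measurable [measurable]: "gauss_density \<in> borel_measurable borel"
  unfolding gauss_density_def by measurable

lemma on_unit_measurable [measurable]:
  assumes [measurable]: "d \<in> borel_measurable borel" shows "on_unit d \<in> borel_measurable borel"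
proof -
  have "(\<lambda>t. ennreal (d t) * indicator {0..1} t) \<in> borel_measurable borel" by simp
  then show ?thesis unfolding on_unit_def[abs_def] .
qed

lemma gauss1_measurable [measurable]: "gauss1 \<in> borel_measurable borel"
  unfolding gauss1_def frac_def by measurable

text \<open>Irrationality removes the endpoint at which the closed interval and the half-open set of
  the digit differ.\<close>

lemma floor_reciprocal_irrational:
  fixes x :: real
  assumes "x \<notin> \<rat>" "0 < x" "1 \<le> k"
  shows "\<lfloor>1 / x\<rfloor> = k \<longleftrightarrow> x \<in> {1 / (of_int k + 1)..1 / of_int k}"
proof -
  have k: "0 < (of_int k :: real)" "0 < (of_int k + 1 :: real)" using assms(3) by auto
  have ne: "x \<noteq> 1 / (of_int k + 1)" using assms(1) by auto
  have "\<lfloor>1 / x\<rfloor> = k \<longleftrightarrow> of_int k * x \<le> 1 \<and> 1 < (of_int k + 1) * x"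
    unfolding floor_eq_iff pos_le_divide_eq[OF assms(2)] pos_divide_less_eq[OF assms(2)] ..
  also have "\<dots> \<longleftrightarrow> x \<le> 1 / of_int k \<and> 1 / (of_int k + 1) < x"
    unfolding pos_le_divide_eq[OF k(1)] pos_divide_less_eq[OF k(2)] by (simp only: mult.commute)
  also have "\<dots> \<longleftrightarrow> x \<in> {1 / (of_int k + 1)..1 / of_int k}"
    using ne by auto
  finally show ?thesis .
qed

text \<open>Substituting \<open>x = 1 / (k + t)\<close> gives
  \<open>(1 + w) / (k + w + t)^2\<close>, which is \<open>\<kappa>\<close> times the density with
  parameter \<open>w' = 1 / (k + w)\<close>; this lies in \<open>[0, 1]\<close> because
  \<open>k \<ge> 1\<close>. Test functions \<open>F\<close> express the equality of
  measures.\<close>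

lemma moebius_density_step:
  assumes w: "0 \<le> w" "w \<le> 1"
  shows "\<exists>\<kappa> w'. 0 \<le> w' \<and> w' \<le> 1 \<and> (\<forall>F\<in>borel_measurable borel.
     (\<integral>\<^sup>+x. on_unit (moebius_density w) x * (indicator {x. \<lfloor>1 / x\<rfloor> = k} x * F (gauss1 x)) \<partial>lborel)
       = \<kappa> * (\<integral>\<^sup>+t. on_unit (moebius_density w') t * F t \<partial>lborel))"
proof (cases "1 \<le> k")
  case False
  \<comment> \<open>Digits below 1 do not occur at irrational points of the unit interval, so
    \<open>\<kappa> = 0\<close> serves here.\<close>
  have "on_unit (moebius_density w) x * (indicator {x. \<lfloor>1 / x\<rfloor> = k} x * F (gauss1 x)) = 0"
    if "x \<notin> \<rat>" for x and F :: "real \<Rightarrow> ennreal"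
  proof -
    have "\<lfloor>1 / x\<rfloor> \<noteq> k" if "0 \<le> x" "x \<le> 1"
    proof -
      have "x \<noteq> 0" using \<open>x \<notin> \<rat>\<close> by auto
      then have "1 \<le> 1 / x" using that by simp
      then show ?thesis using False by linarith
    qed
    then show ?thesis by (auto simp: on_unit_def indicator_def)
  qed
  then have "AE x in lborel. on_unit (moebius_density w) x * (indicator {x. \<lfloor>1 / x\<rfloor> = k} x * F (gauss1 x)) = 0"
    for F :: "real \<Rightarrow> ennreal"
    by (rule eventually_mono[OF AE_lborel_irrational])
  then have "(\<integral>\<^sup>+x. on_unit (moebius_density w) x * (indicator {x. \<lfloor>1 / x\<rfloor> = k} x * F (gauss1 x)) \<partial>lborel)
      = (\<integral>\<^sup>+(x::real). 0 \<partial>lborel)" for F :: "real \<Rightarrow> ennreal"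
    by (rule nn_integral_cong_AE)
  then show ?thesis by (intro exI[of _ 0]) auto
next
  case True
  define w' where "w' = 1 / (of_int k + w)"
  define \<kappa> where "\<kappa> = (1 + w) / ((1 + w') * (of_int k + w)\<^sup>2)"
  have k1: "1 \<le> (of_int k :: real)" using True by simp
  then have w': "0 \<le> w'" "w' \<le> 1" using w by (auto simp: w'_def)
  have \<kappa>: "0 \<le> \<kappa>" using w w' by (simp add: \<kappa>_def)
  have "(\<integral>\<^sup>+x. on_unit (moebius_density w) x * (indicator {x. \<lfloor>1 / x\<rfloor> = k} x * F (gauss1 x)) \<partial>lborel)
     = ennreal \<kappa> * (\<integral>\<^sup>+t. on_unit (moebius_density w') t * F t \<partial>lborel)"
    if [measurable]: "F \<in> borel_measurable borel" for F
  proof -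
    let ?I = "{1 / (of_int k + 1)..1 / (of_int k :: real)}"
    have "AE x in lborel. on_unit (moebius_density w) x * (indicator {x. \<lfloor>1 / x\<rfloor> = k} x * F (gauss1 x))
      = (ennreal (moebius_density w x) * F (1 / x - of_int k)) * indicator ?I x"
      using AE_lborel_irrational
    proof eventually_elim
      fix x :: real assume x: "x \<notin> \<rat>"
      show "on_unit (moebius_density w) x * (indicator {x. \<lfloor>1 / x\<rfloor> = k} x * F (gauss1 x))
          = (ennreal (moebius_density w x) * F (1 / x - of_int k)) * indicator ?I x"
      proof (cases "x \<in> ?I")
        case True
        moreover have "0 < 1 / (of_int k + (1::real))" "1 / (of_int k :: real) \<le> 1" using k1 by auto
        ultimately have "0 < x" "x \<le> 1" by (auto simp del: zero_less_divide_1_iff divide_le_eq_1)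
        moreover from this have "\<lfloor>1 / x\<rfloor> = k"
          using floor_reciprocal_irrational[OF x _ \<open>1 \<le> k\<close>] True by simp
        ultimately show ?thesis
          using True by (simp add: on_unit_def gauss1_def frac_def)
      next
        case False
        have "x \<noteq> 0" using x by auto
        then have "\<lfloor>1 / x\<rfloor> \<noteq> k \<or> x \<notin> {0..1}"
          using floor_reciprocal_irrational[OF x _ \<open>1 \<le> k\<close>] False by auto
        then show ?thesis using False by (auto simp: on_unit_def)
      qed
    qed
    then have "(\<integral>\<^sup>+x. on_unit (moebius_density w) x * (indicator {x. \<lfloor>1 / x\<rfloor> = k} x * F (gauss1 x)) \<partial>lborel)
      = (\<integral>\<^sup>+x. (ennreal (moebius_density w x) * F (1 / x - of_int k)) * indicator ?I x \<partial>lborel)"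
      by (rule nn_integral_cong_AE)
    also have "\<dots> = (\<integral>\<^sup>+t. (ennreal (moebius_density w (1 / (of_int k + t))) * F (1 / (1 / (of_int k + t)) - of_int k))
        * ennreal (1 / (of_int k + t)\<^sup>2) * indicator {0..1} t \<partial>lborel)"
      using k1 by (intro nn_integral_reciprocal) auto
    also have "\<dots> = (\<integral>\<^sup>+t. ennreal \<kappa> * (on_unit (moebius_density w') t * F t) \<partial>lborel)"
    proof (intro nn_integral_cong)
      fix t :: real
      show "(ennreal (moebius_density w (1 / (of_int k + t))) * F (1 / (1 / (of_int k + t)) - of_int k))
        * ennreal (1 / (of_int k + t)\<^sup>2) * indicator {0..1} t
        = ennreal \<kappa> * (on_unit (moebius_density w') t * F t)"
      proof (cases "t \<in> {0..1}")
        case True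
        define a where "a = of_int k + t"
        define b where "b = of_int k + w"
        have pos: "0 < a" "0 < b" "0 < a + w" "0 < b + 1" using True k1 w by (auto simp: a_def b_def)
        have "1 + w * (1 / a) = (a + w) / a" "1 + w' * t = (a + w) / b" "1 + w' = (b + 1) / b"
          using pos by (auto simp: w'_def a_def b_def field_simps)
        then have *: "moebius_density w (1 / a) = (1 + w) / ((a + w) / a)\<^sup>2"
          "moebius_density w' t = ((b + 1) / b) / ((a + w) / b)\<^sup>2" "\<kappa> = (1 + w) / ((b + 1) / b * b\<^sup>2)"
          unfolding moebius_density_def \<kappa>_def b_def[symmetric] by simp_all
        have "moebius_density w (1 / a) * (1 / a\<^sup>2) = (1 + w) / (a + w)\<^sup>2"
          unfolding * using pos by (simp add: power_divide)
        moreover have "\<kappa> * moebius_density w' t = (1 + w) / (a + w)\<^sup>2"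
        proof -
          have "r / (p / b * b\<^sup>2) * ((p / b) / (q / b)\<^sup>2) = r / q\<^sup>2" if "0 < p" "0 < q" for p q r :: real
            using that pos(2) by (simp add: power2_eq_square divide_simps)
          from this[OF pos(4,3)] show ?thesis unfolding * .
        qed
        ultimately have eq: "moebius_density w (1 / a) * (1 / a\<^sup>2) = \<kappa> * moebius_density w' t" by simp
        have nn: "0 \<le> moebius_density w (1 / a)" "0 \<le> moebius_density w' t"
          using w w' by (simp_all add: moebius_density_def)
        have "ennreal (moebius_density w (1 / a)) * ennreal (1 / a\<^sup>2) = ennreal \<kappa> * ennreal (moebius_density w' t)"
          using eq nn \<kappa> by (simp flip: ennreal_mult)
        then show ?thesis
          using True by (simp add: on_unit_def flip: a_def) (simp add: a_def mult.commute mult.left_commute)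
      qed (simp add: on_unit_def)
    qed
    also have "\<dots> = ennreal \<kappa> * (\<integral>\<^sup>+t. on_unit (moebius_density w') t * F t \<partial>lborel)"
      by (intro nn_integral_cmult) measurable
    finally show ?thesis .
  qed
  with w' show ?thesis by blast
qed

section \<open>Gauss's invariant density\<close>

text \<open>Gauss's computation: after the substitution on each branch, partial fractions turn the
  transported densities into differences \<open>1 / (ln 2 * a) - 1 / (ln 2 * (a + 1))\<close> with
  \<open>a = k + t\<close>, and the sum over the digits \<open>k \<ge> 1\<close> telescopes.\<close>

lemma gauss_density_invariant:
  assumes [measurable]: "F \<in> borel_measurable borel"
  shows "(\<integral>\<^sup>+x. on_unit gauss_density x * F (gauss1 x) \<partial>lborel) = (\<integral>\<^sup>+t. on_unit gauss_density t * F t \<partial>lborel)"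
proof -
  \<comment> \<open>Summation starts at 0 while digits start at 1, hence
    \<open>Suc k\<close>.\<close>
  let ?I = "\<lambda>k::nat. {1 / (real (Suc k) + 1)..1 / real (Suc k)}"
  let ?h = "\<lambda>k x. (ennreal (gauss_density x) * F (1 / x - real (Suc k))) * indicator (?I k) x"
  have "AE x in lborel. on_unit gauss_density x * F (gauss1 x) = (\<Sum>k. ?h k x)"
    using AE_lborel_irrational
  proof eventually_elim
    fix x :: real assume x: "x \<notin> \<rat>"
    then have x0: "x \<noteq> 0" by auto
    have mem: "x \<in> ?I k \<longleftrightarrow> \<lfloor>1 / x\<rfloor> = int (Suc k)" if "0 < x" for k
      using floor_reciprocal_irrational[OF x that, of "int (Suc k)"] by simp
    have pos: "0 < x" "x \<le> 1" if "x \<in> ?I k" for k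
    proof -
      have "0 < 1 / (real (Suc k) + 1)" "1 / real (Suc k) \<le> 1" by simp_all
      with that show "0 < x" "x \<le> 1"
        unfolding atLeastAtMost_iff by linarith+
    qed
    show "on_unit gauss_density x * F (gauss1 x) = (\<Sum>k. ?h k x)"
    proof (cases "x \<in> {0..1}")
      case False
      then have "x \<notin> ?I k" for k using pos[of k] by auto
      then have "(\<lambda>k. ?h k x) = (\<lambda>k. 0)" by (intro ext) simp
      then have "(\<Sum>k. ?h k x) = 0" by (simp only: suminf_zero)
      then show ?thesis using False by (simp add: on_unit_def)
    next
      case True
      then have "0 < x" using x0 by auto
      moreover have "1 \<le> 1 / x" using True \<open>0 < x\<close> by simp
      ultimately obtain n where n: "\<lfloor>1 / x\<rfloor> = int (Suc n)"
        by (metis le_floor_iff of_int_1 int_ops(4) nonneg_int_cases zle_iff_zadd add.commute of_nat_1 of_nat_Suc)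
      have "(\<Sum>k. ?h k x) = (\<Sum>k\<in>{n}. ?h k x)"
        using mem[OF \<open>0 < x\<close>] n by (intro suminf_finite) auto
      also have "\<dots> = on_unit gauss_density x * F (gauss1 x)"
        using mem[OF \<open>0 < x\<close>, of n] n True by (simp add: on_unit_def gauss1_def frac_def)
      finally show ?thesis by simp
    qed
  qed
  then have "(\<integral>\<^sup>+x. on_unit gauss_density x * F (gauss1 x) \<partial>lborel) = (\<integral>\<^sup>+x. (\<Sum>k. ?h k x) \<partial>lborel)"
    by (rule nn_integral_cong_AE)
  also have "\<dots> = (\<Sum>k. \<integral>\<^sup>+x. ?h k x \<partial>lborel)"
    by (intro nn_integral_suminf) measurable
  also have "\<dots> = (\<Sum>k. \<integral>\<^sup>+t. (ennreal (gauss_density (1 / (real (Suc k) + t))) * F (1 / (1 / (real (Suc k) + t)) - real (Suc k)))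
        * ennreal (1 / (real (Suc k) + t)\<^sup>2) * indicator {0..1} t \<partial>lborel)"
    by (intro suminf_cong nn_integral_reciprocal) auto
  also have "\<dots> = (\<integral>\<^sup>+t. (\<Sum>k. (ennreal (gauss_density (1 / (real (Suc k) + t))) * F (1 / (1 / (real (Suc k) + t)) - real (Suc k)))
        * ennreal (1 / (real (Suc k) + t)\<^sup>2) * indicator {0..1} t) \<partial>lborel)"
    by (intro nn_integral_suminf[symmetric]) measurable
  also have "\<dots> = (\<integral>\<^sup>+t. on_unit gauss_density t * F t \<partial>lborel)"
  proof (intro nn_integral_cong)
    fix t :: real
    show "(\<Sum>k. (ennreal (gauss_density (1 / (real (Suc k) + t))) * F (1 / (1 / (real (Suc k) + t)) - real (Suc k)))
        * ennreal (1 / (real (Suc k) + t)\<^sup>2) * indicator {0..1} t) = on_unit gauss_density t * F t"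
    proof (cases "t \<in> {0..1}")
      case True
      have ln2: "0 < ln (2::real)" by simp
      let ?a = "\<lambda>k::nat. 1 / (ln 2 * (real k + 1 + t))"
      have trm: "(ennreal (gauss_density (1 / (real (Suc k) + t))) * F (1 / (1 / (real (Suc k) + t)) - real (Suc k)))
        * ennreal (1 / (real (Suc k) + t)\<^sup>2) * indicator {0..1} t = ennreal (?a k - ?a (Suc k)) * F t" for k
      proof -
        define a where "a = real (Suc k) + t"
        have a: "0 < a" using True by (auto simp: a_def)
        have "1 + 1 / a = (a + 1) / a" using a by (simp add: field_simps)
        then have "gauss_density (1 / a) = a / (ln 2 * (a + 1))"
          by (simp add: gauss_density_def)
        moreover have "a / (l * (a + 1)) * (1 / a\<^sup>2) = 1 / (l * a) - 1 / (l * (a + 1))" if "0 < l" for l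
          using a that by (simp add: power2_eq_square divide_simps)
        ultimately have "gauss_density (1 / a) * (1 / a\<^sup>2) = 1 / (ln 2 * a) - 1 / (ln 2 * (a + 1))"
          using ln2 by simp
        also have "\<dots> = ?a k - ?a (Suc k)" by (simp add: a_def algebra_simps)
        finally have eq: "gauss_density (1 / a) * (1 / a\<^sup>2) = ?a k - ?a (Suc k)" .
        have "ennreal (gauss_density (1 / a)) * ennreal (1 / a\<^sup>2) = ennreal (?a k - ?a (Suc k))"
          unfolding eq[symmetric] using a by (intro ennreal_mult[symmetric]) (auto simp: gauss_density_def)
        then show ?thesis
          using True by (simp add: mult.commute mult.left_commute flip: a_def) (simp add: a_def)
      qed
      have mono: "0 \<le> ?a k - ?a (Suc k)" for k
        using True ln2 by (simp add: frac_le)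
      have "(\<lambda>k. 1 / (ln 2 * (real k + 1 + t))) \<longlonglongrightarrow> 0"
        using ln2 by real_asymp
      from telescope_sums'[OF this] have sums: "(\<lambda>k. ?a k - ?a (Suc k)) sums (?a 0 - 0)" .
      have "(\<Sum>k. ennreal (?a k - ?a (Suc k)) * F t) = (\<Sum>k. ennreal (?a k - ?a (Suc k))) * F t"
        by (rule ennreal_suminf_multc)
      also have "(\<Sum>k. ennreal (?a k - ?a (Suc k))) = ennreal (?a 0 - 0)"
        using mono sums by (rule suminf_ennreal_eq)
      finally show ?thesis
        using True unfolding trm by (simp add: on_unit_def gauss_density_def)
    qed (simp add: on_unit_def)
  qed
  finally show ?thesis .
qed

lemma gauss_density_total: "(\<integral>\<^sup>+t. on_unit gauss_density t \<partial>lborel) = 1"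
proof -
  have "(\<integral>\<^sup>+t. ennreal (gauss_density t) * indicator {0..1} t \<partial>lborel) = ennreal (ln (1 + 1) / ln 2 - ln (1 + 0) / ln 2)"
  proof (rule nn_integral_FTC_Icc)
    fix x :: real assume "x \<in> {0..1}"
    then show "((\<lambda>t. ln (1 + t) / ln 2) has_real_derivative gauss_density x) (at x)"
      by (auto intro!: derivative_eq_intros simp: gauss_density_def)
  qed (auto simp: gauss_density_def)
  then show ?thesis by (simp add: on_unit_def)
qed

section \<open>The invariant measure in diagonal coordinates\<close>

definition of_diag :: "real \<Rightarrow> real \<Rightarrow> R11" where
  "of_diag u v = ((u + v) / 2, (u - v) / 2)"

lemma diag_of_diag [simp]: "diag1 (of_diag u v) = u" "diag2 (of_diag u v) = v"
  by (simp_all add: of_diag_def diag1_def diag2_def field_simps)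

lemma of_diag_diag [simp]: "of_diag (diag1 x) (diag2 x) = x"
  by (simp add: diag_eq_iff)

lemma of_diag_measurable [measurable]:
  assumes [measurable]: "f \<in> borel_measurable M" "g \<in> borel_measurable M"
  shows "(\<lambda>x. of_diag (f x) (g x)) \<in> borel_measurable M"
  unfolding of_diag_def by measurable

lemma diag_measurable [measurable]: "diag1 \<in> borel_measurable borel" "diag2 \<in> borel_measurable borel"
  unfolding diag1_def[abs_def] diag2_def[abs_def]
  by (auto intro!: borel_measurable_continuous_onI continuous_intros)

lemma Q_measurable [measurable]: "Q \<in> borel_measurable borel"
  unfolding Q_diag[abs_def] by measurable

lemma null_cone_borel [measurable]: "null_cone \<in> sets borel"
  unfolding null_cone_def by measurable

lemma diamond_borel [measurable]: "diamond \<in> sets borel"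
proof -
  have "diamond = {x. 0 \<le> diag1 x \<and> diag1 x < 1 \<and> 0 \<le> diag2 x \<and> diag2 x < 1}"
    by (auto simp: diamond_iff)
  also have "\<dots> \<in> sets borel" by measurable
  finally show ?thesis .
qed

lemma iota_measurable [measurable]: "iota \<in> borel_measurable borel"
  unfolding iota_def[abs_def] by measurable

lemma lattice_part_eq: "lattice_part x = of_diag (of_int \<lfloor>diag1 x\<rfloor>) (of_int \<lfloor>diag2 x\<rfloor>)"
  by (simp add: diag_eq_iff diag_lattice_part)

lemma lattice_part_measurable [measurable]: "lattice_part \<in> borel_measurable borel"
  unfolding lattice_part_eq[abs_def] by measurable

lemma gauss_map_measurable [measurable]: "gauss_map \<in> borel_measurable borel"
  unfolding gauss_map_def[abs_def] by measurable

lemma sets_gauss_measure: "A \<in> sets gauss_measure \<longleftrightarrow> A \<subseteq> diamond \<and> A \<in> sets borel"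
  by (simp add: gauss_measure_def sets_restrict_space_iff)

lemma space_gauss_measure: "space gauss_measure = diamond"
  by (simp add: gauss_measure_def space_restrict_space)

lemma gauss_map_measurable_gauss_measure: "gauss_map \<in> measurable gauss_measure gauss_measure"
proof -
  have "gauss_map \<in> measurable (restrict_space borel diamond) (restrict_space borel diamond)"
    by (rule measurable_restrict_space3) (auto simp: gauss_map_in_diamond)
  moreover have "sets gauss_measure = sets (restrict_space borel diamond)"
    by (simp add: gauss_measure_def sets_restrict_space)
  ultimately show ?thesis by (simp cong: measurable_cong_sets)
qed

text \<open>The Jacobian 1/2 comes from two affine substitutions in one variable:
  \<open>a = u - b\<close> for fixed \<open>b\<close>, and \<open>b = (u - v) / 2\<close> for fixed
  \<open>u\<close>.\<close>

lemma nn_integral_lborel_R11: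
  fixes H :: "R11 \<Rightarrow> ennreal"
  assumes [measurable]: "H \<in> borel_measurable borel"
  shows "(\<integral>\<^sup>+x. H x \<partial>lborel) = (\<integral>\<^sup>+u. \<integral>\<^sup>+v. ennreal (1 / 2) * H (of_diag u v) \<partial>lborel \<partial>lborel)"
proof -
  have "(\<integral>\<^sup>+x. H x \<partial>lborel) = (\<integral>\<^sup>+b. \<integral>\<^sup>+a. H (a, b) \<partial>lborel \<partial>lborel)"
    unfolding lborel_prod[symmetric] by (rule lborel_pair.nn_integral_snd[symmetric]) (simp add: lborel_prod)
  also have "\<dots> = (\<integral>\<^sup>+b. \<integral>\<^sup>+u. H (u - b, b) \<partial>lborel \<partial>lborel)"
  proof (rule nn_integral_cong)
    fix b :: real
    show "(\<integral>\<^sup>+a. H (a, b) \<partial>lborel) = (\<integral>\<^sup>+u. H (u - b, b) \<partial>lborel)"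
      using nn_integral_real_affine[of "\<lambda>a. H (a, b)" 1 "- b"] by simp
  qed
  also have "\<dots> = (\<integral>\<^sup>+u. \<integral>\<^sup>+b. H (u - b, b) \<partial>lborel \<partial>lborel)"
    by (rule lborel_pair.Fubini') measurable
  also have "\<dots> = (\<integral>\<^sup>+u. \<integral>\<^sup>+v. ennreal (1 / 2) * H (of_diag u v) \<partial>lborel \<partial>lborel)"
  proof (rule nn_integral_cong)
    fix u :: real
    have "(\<integral>\<^sup>+b. H (u - b, b) \<partial>lborel) = ennreal \<bar>- (1/2)\<bar> * (\<integral>\<^sup>+v. H (u - (u / 2 + - (1/2) * v), u / 2 + - (1/2) * v) \<partial>lborel)"
      by (rule nn_integral_real_affine[of "\<lambda>b. H (u - b, b)" "- (1/2)" "u / 2"]) auto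
    also have "\<dots> = (\<integral>\<^sup>+v. ennreal \<bar>- (1/2)\<bar> * H (u - (u / 2 + - (1/2) * v), u / 2 + - (1/2) * v) \<partial>lborel)"
      by (intro nn_integral_cmult[symmetric]) measurable
    also have "\<dots> = (\<integral>\<^sup>+v. ennreal (1 / 2) * H (of_diag u v) \<partial>lborel)"
      by (intro nn_integral_cong arg_cong2[where f = "(*)"] arg_cong[where f = H])
        (auto simp: of_diag_def field_simps)
    finally show "(\<integral>\<^sup>+b. H (u - b, b) \<partial>lborel) = (\<integral>\<^sup>+v. ennreal (1 / 2) * H (of_diag u v) \<partial>lborel)" .
  qed
  finally show ?thesis .
qed

text \<open>An iterated integral, so that the one-dimensional statements apply to each variable in
  turn.\<close>

definition diag_integral :: "(real \<Rightarrow> real) \<Rightarrow> (real \<Rightarrow> real) \<Rightarrow> (R11 \<Rightarrow> ennreal) \<Rightarrow> ennreal" where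
  "diag_integral d e F = (\<integral>\<^sup>+u. \<integral>\<^sup>+v. on_unit d u * (on_unit e v * F (of_diag u v)) \<partial>lborel \<partial>lborel)"

text \<open>Points with a rational coordinate form a null set. This disposes of the null cone, of
  the boundary of the square and of finite expansions.\<close>

lemma diag_integral_cong:
  assumes "\<And>u v. \<lbrakk>u \<notin> \<rat>; v \<notin> \<rat>; 0 < u; u < 1; 0 < v; v < 1\<rbrakk> \<Longrightarrow> F (of_diag u v) = F' (of_diag u v)"
  shows "diag_integral d e F = diag_integral d e F'"
proof -
  have *: "0 < u \<and> u < 1" if "u \<notin> \<rat>" "u \<in> {0..1}" for u :: real
  proof -
    have "u \<noteq> 0" "u \<noteq> 1" using that(1) by auto
    then show ?thesis using that(2) by auto
  qed
  have "AE v in lborel. on_unit d u * (on_unit e v * F (of_diag u v)) = on_unit d u * (on_unit e v * F' (of_diag u v))"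
    if "u \<notin> \<rat>" for u
    using AE_lborel_irrational
  proof eventually_elim
    case (elim v)
    show ?case
      using assms[OF that elim] *[OF that] *[OF elim] by (auto simp: on_unit_def indicator_def)
  qed
  then have "AE u in lborel. (\<integral>\<^sup>+v. on_unit d u * (on_unit e v * F (of_diag u v)) \<partial>lborel)
      = (\<integral>\<^sup>+v. on_unit d u * (on_unit e v * F' (of_diag u v)) \<partial>lborel)"
    using AE_lborel_irrational by (auto elim!: eventually_mono intro: nn_integral_cong_AE)
  then show ?thesis
    unfolding diag_integral_def by (rule nn_integral_cong_AE)
qed

text \<open>The denominator factors as \<open>(1 + u) * (1 + v)\<close>, and the Jacobian 1/2
  cancels the factor 2 of the density.\<close>

lemma nn_integral_gauss_measure:
  assumes [measurable]: "F \<in> borel_measurable borel"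
  shows "(\<integral>\<^sup>+x. F x \<partial>gauss_measure) = diag_integral gauss_density gauss_density F"
proof -
  let ?d = "\<lambda>x. ennreal (2 / (ln 2)\<^sup>2 * (1 / ((1 + fst x)\<^sup>2 - (snd x)\<^sup>2)))"
  have [measurable]: "?d \<in> borel_measurable (borel :: R11 measure)"
  proof -
    have [measurable]: "fst \<in> borel_measurable (borel :: R11 measure)" "snd \<in> borel_measurable (borel :: R11 measure)"
      by (auto intro!: borel_measurable_continuous_onI continuous_intros)
    have "(\<lambda>x::R11. 2 / (ln 2)\<^sup>2 * (1 / ((1 + fst x)\<^sup>2 - (snd x)\<^sup>2))) \<in> borel_measurable borel"
      by (intro borel_measurable_times borel_measurable_divide borel_measurable_diff
        borel_measurable_power borel_measurable_add borel_measurable_const) fact+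
    then show ?thesis by (rule measurable_compose[OF _ measurable_ennreal])
  qed
  have [measurable]: "?d \<in> borel_measurable (restrict_space lborel diamond)"
    by (intro measurable_restrict_space1, subst measurable_lborel2) fact
  have [measurable]: "F \<in> borel_measurable (restrict_space lborel diamond)"
    by (intro measurable_restrict_space1) simp
  have "(\<integral>\<^sup>+x. F x \<partial>gauss_measure) = (\<integral>\<^sup>+x. ?d x * F x \<partial>restrict_space lborel diamond)"
    unfolding gauss_measure_def by (rule nn_integral_density) measurable
  also have "\<dots> = (\<integral>\<^sup>+x. (?d x * F x) * indicator diamond x \<partial>lborel)"
    by (rule nn_integral_restrict_space) simp
  also have "\<dots> = (\<integral>\<^sup>+u. \<integral>\<^sup>+v. ennreal (1 / 2) * (?d (of_diag u v) * F (of_diag u v) * indicator diamond (of_diag u v)) \<partial>lborel \<partial>lborel)"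
    by (rule nn_integral_lborel_R11) measurable
  also have "\<dots> = (\<integral>\<^sup>+u. \<integral>\<^sup>+v. on_unit gauss_density u * (on_unit gauss_density v * (F (of_diag u v) * indicator diamond (of_diag u v))) \<partial>lborel \<partial>lborel)"
  proof (intro nn_integral_cong)
    fix u v :: real
    show "ennreal (1 / 2) * (?d (of_diag u v) * F (of_diag u v) * indicator diamond (of_diag u v))
      = on_unit gauss_density u * (on_unit gauss_density v * (F (of_diag u v) * indicator diamond (of_diag u v)))"
    proof (cases "of_diag u v \<in> diamond")
      case True
      then have uv: "0 \<le> u" "u < 1" "0 \<le> v" "v < 1" by (auto simp: diamond_iff)
      have "(1 + fst (of_diag u v))\<^sup>2 - (snd (of_diag u v))\<^sup>2 = (1 + u) * (1 + v)"
        by (simp add: of_diag_def power2_eq_square field_simps)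
      then have "1 / 2 * (2 / (ln 2)\<^sup>2 * (1 / ((1 + fst (of_diag u v))\<^sup>2 - (snd (of_diag u v))\<^sup>2)))
          = gauss_density u * gauss_density v"
        using uv by (simp add: gauss_density_def power2_eq_square)
      moreover have "0 \<le> gauss_density u" "0 \<le> gauss_density v"
        using uv by (auto simp: gauss_density_def)
      ultimately have "ennreal (1 / 2) * ?d (of_diag u v) = ennreal (gauss_density u) * ennreal (gauss_density v)"
        by (simp add: ennreal_mult'[symmetric] del: ennreal_half)
      then show ?thesis
        using uv True by (simp add: on_unit_def mult.assoc[symmetric])
    qed simp
  qed
  also have "\<dots> = diag_integral gauss_density gauss_density (\<lambda>x. F x * indicator diamond x)"
    by (simp add: diag_integral_def)
  also have "\<dots> = diag_integral gauss_density gauss_density F"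
    by (rule diag_integral_cong) (simp add: diamond_iff)
  finally show ?thesis .
qed

lemma emeasure_gauss_measure:
  assumes [measurable]: "A \<in> sets borel"
  shows "emeasure gauss_measure (A \<inter> diamond) = diag_integral gauss_density gauss_density (indicator A)"
proof -
  have "A \<inter> diamond \<in> sets gauss_measure" by (simp add: sets_gauss_measure)
  then have "emeasure gauss_measure (A \<inter> diamond) = (\<integral>\<^sup>+x. indicator (A \<inter> diamond) x \<partial>gauss_measure)"
    by (rule nn_integral_indicator[symmetric])
  also have "\<dots> = diag_integral gauss_density gauss_density (indicator (A \<inter> diamond))"
    by (rule nn_integral_gauss_measure) measurable
  also have "\<dots> = diag_integral gauss_density gauss_density (indicator A)"
    by (rule diag_integral_cong) (simp add: diamond_iff indicator_def)
  finally show ?thesis .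
qed

section \<open>Invariance of the measure\<close>

lemma diag_integral_swap:
  assumes [measurable]: "F \<in> borel_measurable borel" "d \<in> borel_measurable borel" "e \<in> borel_measurable borel"
  shows "diag_integral d e (\<lambda>x. F (of_diag (diag2 x) (diag1 x))) = diag_integral e d F"
proof -
  have "diag_integral d e (\<lambda>x. F (of_diag (diag2 x) (diag1 x)))
      = (\<integral>\<^sup>+u. \<integral>\<^sup>+v. on_unit d u * (on_unit e v * F (of_diag v u)) \<partial>lborel \<partial>lborel)"
    by (simp add: diag_integral_def)
  also have "\<dots> = (\<integral>\<^sup>+v. \<integral>\<^sup>+u. on_unit d u * (on_unit e v * F (of_diag v u)) \<partial>lborel \<partial>lborel)"
    by (rule lborel_pair.Fubini') measurable
  finally show ?thesis
    by (simp add: diag_integral_def mult.left_commute)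
qed

lemma prob_space_gauss_measure: "prob_space gauss_measure"
proof (rule prob_spaceI)
  have "emeasure gauss_measure (space gauss_measure) = diag_integral gauss_density gauss_density (indicator UNIV)"
    using emeasure_gauss_measure[of UNIV] by (simp add: space_gauss_measure)
  also have "\<dots> = (\<integral>\<^sup>+u. on_unit gauss_density u * 1 \<partial>lborel)"
    unfolding diag_integral_def by (simp add: nn_integral_cmult gauss_density_total)
  finally show "emeasure gauss_measure (space gauss_measure) = 1"
    by (simp add: gauss_density_total)
qed

lemma gauss_map_of_diag:
  "u \<noteq> 0 \<Longrightarrow> v \<noteq> 0 \<Longrightarrow> gauss_map (of_diag u v) = of_diag (gauss1 v) (gauss1 u)"
  by (simp add: diag_eq_iff diag_gauss_map null_cone_iff)

text \<open>The one-dimensional invariance applies in each variable, and the remaining swap is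
  harmless because both factors carry the same density.\<close>

lemma preserves_gauss_measure: "preserves_measure gauss_measure gauss_map"
  unfolding preserves_measure_def
proof
  show T: "gauss_map \<in> measurable gauss_measure gauss_measure"
    by (rule gauss_map_measurable_gauss_measure)
  show "distr gauss_measure gauss_measure gauss_map = gauss_measure"
  proof (rule measure_eqI)
    fix A assume "A \<in> sets (distr gauss_measure gauss_measure gauss_map)"
    then have A: "A \<in> sets gauss_measure" and [measurable]: "A \<in> sets borel" and sub: "A \<subseteq> diamond"
      by (auto simp: sets_gauss_measure)
    have [measurable]: "gauss_map -` A \<in> sets borel"
      using measurable_sets[OF gauss_map_measurable \<open>A \<in> sets borel\<close>] by simp
    let ?g = "on_unit gauss_density"
    let ?F = "\<lambda>u v. indicator A (of_diag v u) :: ennreal"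
    have "emeasure (distr gauss_measure gauss_measure gauss_map) A = emeasure gauss_measure (gauss_map -` A \<inter> diamond)"
      using T A by (simp add: emeasure_distr space_gauss_measure)
    also have "\<dots> = diag_integral gauss_density gauss_density (indicator (gauss_map -` A))"
      by (rule emeasure_gauss_measure) measurable
    also have "\<dots> = diag_integral gauss_density gauss_density (\<lambda>x. ?F (gauss1 (diag1 x)) (gauss1 (diag2 x)))"
      by (rule diag_integral_cong) (simp add: gauss_map_of_diag indicator_def)
    also have "\<dots> = (\<integral>\<^sup>+u. ?g u * (\<integral>\<^sup>+v. ?g v * ?F (gauss1 u) (gauss1 v) \<partial>lborel) \<partial>lborel)"
      by (simp add: diag_integral_def nn_integral_cmult)
    also have "\<dots> = (\<integral>\<^sup>+u. ?g u * (\<integral>\<^sup>+v. ?g v * ?F (gauss1 u) v \<partial>lborel) \<partial>lborel)"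
      by (intro nn_integral_cong arg_cong2[where f = "(*)"] refl gauss_density_invariant) measurable
    also have "\<dots> = (\<integral>\<^sup>+u. ?g u * (\<integral>\<^sup>+v. ?g v * ?F u v \<partial>lborel) \<partial>lborel)"
      by (rule gauss_density_invariant[of "\<lambda>u. \<integral>\<^sup>+v. ?g v * ?F u v \<partial>lborel"]) measurable
    also have "\<dots> = diag_integral gauss_density gauss_density (\<lambda>x. indicator A (of_diag (diag2 x) (diag1 x)))"
      by (simp add: diag_integral_def nn_integral_cmult)
    also have "\<dots> = diag_integral gauss_density gauss_density (indicator A)"
      by (rule diag_integral_swap) measurable
    also have "\<dots> = emeasure gauss_measure A"
      using emeasure_gauss_measure[of A] sub by (simp add: Int_absorb2)
    finally show "emeasure (distr gauss_measure gauss_measure gauss_map) A = emeasure gauss_measure A" .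
  qed simp
qed

section \<open>The Doeblin condition for cylinders\<close>

lemma cylinder_Nil: "cylinder [] = diamond"
  by (simp add: cylinder_def)

lemma cylinder_single: "cylinder [b] = {x \<in> diamond. x \<notin> null_cone \<and> lattice_part (iota x) = b}"
  by (simp add: cylinder_def digit_def)

lemma cylinder_iff:
  "x \<in> cylinder s \<longleftrightarrow> x \<in> diamond \<and> (\<forall>i<length s. (gauss_map ^^ i) x \<notin> null_cone) \<and> digits x (length s) = s"
proof -
  have ball: "(\<forall>i\<in>{1..n}. P i) \<longleftrightarrow> (\<forall>i<n. P (Suc i))" for n and P :: "nat \<Rightarrow> bool"
    by (metis One_nat_def Suc_le_eq Suc_pred atLeastAtMost_iff less_Suc_eq_le zero_less_Suc le_simps(3) not0_implies_Suc not_one_le_zero)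
  show ?thesis
    unfolding cylinder_def mem_Collect_eq ball list_eq_iff_nth_eq by (auto simp: digits_nth)
qed

lemma digits_0: "digits x 0 = []"
  by (simp add: digits_def)

lemma cylinder_Cons: "x \<in> cylinder (b # s) \<longleftrightarrow> x \<in> cylinder [b] \<and> gauss_map x \<in> cylinder s"
proof -
  have all: "(\<forall>i<Suc n. P i) \<longleftrightarrow> P 0 \<and> (\<forall>i<n. P (Suc i))" for n and P :: "nat \<Rightarrow> bool"
    using less_Suc_eq_0_disj by auto
  show ?thesis
    unfolding cylinder_iff length_Cons all
    by (auto simp: digits_Suc digits_0 gauss_map_in_diamond funpow_swap1)
qed

lemma cylinder_borel [measurable]: "cylinder s \<in> sets borel"
proof (induction s)
  case (Cons b s)
  have "cylinder [b] = diamond \<inter> (- null_cone) \<inter> (lattice_part \<circ> iota) -` {b}"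
    by (auto simp: cylinder_single)
  moreover have "(lattice_part \<circ> iota) -` {b} \<inter> space borel \<in> sets borel"
    by (rule measurable_sets[of _ borel borel]) auto
  ultimately have "cylinder [b] \<in> sets borel" by auto
  moreover have "gauss_map -` cylinder s \<inter> space borel \<in> sets borel"
    by (rule measurable_sets[OF gauss_map_measurable Cons])
  moreover have "cylinder (b # s) = cylinder [b] \<inter> gauss_map -` cylinder s"
    unfolding set_eq_iff Int_iff vimage_eq using cylinder_Cons by blast
  ultimately show ?case by auto
qed (simp add: cylinder_Nil)

lemma cylinder_subset_diamond: "cylinder s \<subseteq> diamond"
  by (auto simp: cylinder_iff)

lemma cylinder_sets_gauss_measure: "cylinder s \<in> sets gauss_measure"
  by (simp add: sets_gauss_measure cylinder_subset_diamond)

lemma gauss_map_funpow_measurable [measurable]: "gauss_map ^^ n \<in> borel_measurable borel"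
proof (induction n)
  case (Suc n)
  then show ?case by (auto simp: o_def)
qed (simp add: id_def)

text \<open>A digit prescribes \<open>\<lfloor>1 / u\<rfloor>\<close> and
  \<open>\<lfloor>1 / v\<rfloor>\<close> separately, so the one-dimensional step applies to each
  variable; the swap then exchanges the new parameters. If \<open>b\<close> is not a lattice point,
  the cylinder is empty.\<close>

lemma diag_integral_cylinder_single:
  assumes w: "0 \<le> w" "w \<le> 1" "0 \<le> z" "z \<le> 1"
  shows "\<exists>\<kappa> w' z'. 0 \<le> w' \<and> w' \<le> 1 \<and> 0 \<le> z' \<and> z' \<le> 1 \<and> (\<forall>F\<in>borel_measurable borel.
     diag_integral (moebius_density w) (moebius_density z) (\<lambda>x. indicator (cylinder [b]) x * F (gauss_map x))
       = \<kappa> * diag_integral (moebius_density w') (moebius_density z') F)"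
proof (cases "b \<in> lattice")
  case False
  then have "cylinder [b] = {}"
    using lattice_part_props(1) unfolding cylinder_single by blast
  then show ?thesis
    using w by (intro exI[of _ 0] exI[of _ w] exI[of _ z]) (simp add: diag_integral_def)
next
  case True
  then obtain m n where mn: "diag1 b = of_int m" "diag2 b = of_int n"
    by (auto simp: lattice_iff elim!: Ints_cases)
  obtain \<kappa> w' where w': "0 \<le> w'" "w' \<le> 1" and \<kappa>: "\<And>F. F \<in> borel_measurable borel \<Longrightarrow>
     (\<integral>\<^sup>+x. on_unit (moebius_density w) x * (indicator {x. \<lfloor>1 / x\<rfloor> = n} x * F (gauss1 x)) \<partial>lborel)
       = \<kappa> * (\<integral>\<^sup>+t. on_unit (moebius_density w') t * F t \<partial>lborel)"
    using moebius_density_step[OF w(1,2), of n] by blast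
  obtain \<kappa>' z' where z': "0 \<le> z'" "z' \<le> 1" and \<kappa>': "\<And>F. F \<in> borel_measurable borel \<Longrightarrow>
     (\<integral>\<^sup>+x. on_unit (moebius_density z) x * (indicator {x. \<lfloor>1 / x\<rfloor> = m} x * F (gauss1 x)) \<partial>lborel)
       = \<kappa>' * (\<integral>\<^sup>+t. on_unit (moebius_density z') t * F t \<partial>lborel)"
    using moebius_density_step[OF w(3,4), of m] by blast
  have "diag_integral (moebius_density w) (moebius_density z) (\<lambda>x. indicator (cylinder [b]) x * F (gauss_map x))
       = (\<kappa> * \<kappa>') * diag_integral (moebius_density z') (moebius_density w') F"
    if [measurable]: "F \<in> borel_measurable borel" for F
  proof -
    let ?m = "\<lambda>w. on_unit (moebius_density w)"
    let ?I = "\<lambda>k. indicator {x::real. \<lfloor>1 / x\<rfloor> = k} :: real \<Rightarrow> ennreal"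
    have [measurable]: "?I k \<in> borel_measurable borel" for k
      by (intro borel_measurable_indicator) measurable
    have "diag_integral (moebius_density w) (moebius_density z) (\<lambda>x. indicator (cylinder [b]) x * F (gauss_map x))
      = diag_integral (moebius_density w) (moebius_density z)
        (\<lambda>x. ?I n (diag1 x) * (?I m (diag2 x) * F (of_diag (gauss1 (diag2 x)) (gauss1 (diag1 x)))))"
    proof (rule diag_integral_cong)
      fix u v :: real assume uv: "0 < u" "u < 1" "0 < v" "v < 1"
      then have "of_diag u v \<notin> null_cone" "of_diag u v \<in> diamond"
        by (auto simp: null_cone_iff diamond_iff)
      then have "of_diag u v \<in> cylinder [b] \<longleftrightarrow> \<lfloor>1 / u\<rfloor> = n \<and> \<lfloor>1 / v\<rfloor> = m"
        by (auto simp: cylinder_single diag_eq_iff[of _ b] diag_lattice_part diag_iota mn)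
      then show "indicator (cylinder [b]) (of_diag u v) * F (gauss_map (of_diag u v)) =
        ?I n (diag1 (of_diag u v)) * (?I m (diag2 (of_diag u v)) *
          F (of_diag (gauss1 (diag2 (of_diag u v))) (gauss1 (diag1 (of_diag u v)))))"
        using uv by (simp add: indicator_def gauss_map_of_diag)
    qed
    also have "\<dots> = (\<integral>\<^sup>+u. ?m w u * (?I n u * (\<integral>\<^sup>+v. ?m z v * (?I m v * F (of_diag (gauss1 v) (gauss1 u))) \<partial>lborel)) \<partial>lborel)"
      unfolding diag_integral_def diag_of_diag
      by (intro nn_integral_cong) (simp add: nn_integral_cmult[symmetric] mult.left_commute)
    also have "\<dots> = (\<integral>\<^sup>+u. ?m w u * (?I n u * (\<kappa>' * (\<integral>\<^sup>+t. ?m z' t * F (of_diag t (gauss1 u)) \<partial>lborel))) \<partial>lborel)"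
      by (intro nn_integral_cong arg_cong2[where f = "(*)"] refl \<kappa>') measurable
    also have "\<dots> = \<kappa> * (\<integral>\<^sup>+s. ?m w' s * (\<kappa>' * (\<integral>\<^sup>+t. ?m z' t * F (of_diag t s) \<partial>lborel)) \<partial>lborel)"
      by (rule \<kappa>[of "\<lambda>s. \<kappa>' * (\<integral>\<^sup>+t. ?m z' t * F (of_diag t s) \<partial>lborel)"]) measurable
    also have "\<dots> = (\<kappa> * \<kappa>') * (\<integral>\<^sup>+s. ?m w' s * (\<integral>\<^sup>+t. ?m z' t * F (of_diag t s) \<partial>lborel) \<partial>lborel)"
      by (simp add: mult.left_commute[of _ \<kappa>'] nn_integral_cmult mult.assoc)
    also have "(\<integral>\<^sup>+s. ?m w' s * (\<integral>\<^sup>+t. ?m z' t * F (of_diag t s) \<partial>lborel) \<partial>lborel)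
        = diag_integral (moebius_density w') (moebius_density z') (\<lambda>x. F (of_diag (diag2 x) (diag1 x)))"
      by (simp add: diag_integral_def nn_integral_cmult)
    also have "\<dots> = diag_integral (moebius_density z') (moebius_density w') F"
      by (rule diag_integral_swap) measurable
    finally show ?thesis .
  qed
  with w' z' show ?thesis by blast
qed

text \<open>The parameters return to \<open>[0, 1]\<close> after every digit, which makes the later
  bounds independent of the length of \<open>s\<close>.\<close>

lemma diag_integral_cylinder:
  assumes w: "0 \<le> w" "w \<le> 1" "0 \<le> z" "z \<le> 1"
  shows "\<exists>\<kappa> w' z'. 0 \<le> w' \<and> w' \<le> 1 \<and> 0 \<le> z' \<and> z' \<le> 1 \<and> (\<forall>F\<in>borel_measurable borel.
     diag_integral (moebius_density w) (moebius_density z) (\<lambda>x. indicator (cylinder s) x * F ((gauss_map ^^ length s) x))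
       = \<kappa> * diag_integral (moebius_density w') (moebius_density z') F)"
  using w
proof (induction s arbitrary: w z)
  case Nil
  have "diag_integral (moebius_density w) (moebius_density z) (\<lambda>x. indicator (cylinder []) x * F ((gauss_map ^^ length []) x))
       = 1 * diag_integral (moebius_density w) (moebius_density z) F" for F
    unfolding mult_1 by (rule diag_integral_cong) (simp add: cylinder_Nil diamond_iff)
  then show ?case using Nil by blast
next
  case (Cons b s)
  obtain \<kappa> w' z' where wz': "0 \<le> w'" "w' \<le> 1" "0 \<le> z'" "z' \<le> 1" and \<kappa>: "\<And>F. F \<in> borel_measurable borel \<Longrightarrow>
     diag_integral (moebius_density w) (moebius_density z) (\<lambda>x. indicator (cylinder [b]) x * F (gauss_map x))
       = \<kappa> * diag_integral (moebius_density w') (moebius_density z') F"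
    using diag_integral_cylinder_single[OF Cons.prems, of b] by blast
  obtain \<kappa>' w'' z'' where wz'': "0 \<le> w''" "w'' \<le> 1" "0 \<le> z''" "z'' \<le> 1" and \<kappa>': "\<And>F. F \<in> borel_measurable borel \<Longrightarrow>
     diag_integral (moebius_density w') (moebius_density z') (\<lambda>x. indicator (cylinder s) x * F ((gauss_map ^^ length s) x))
       = \<kappa>' * diag_integral (moebius_density w'') (moebius_density z'') F"
    using Cons.IH[OF wz'] by blast
  have "diag_integral (moebius_density w) (moebius_density z)
       (\<lambda>x. indicator (cylinder (b # s)) x * F ((gauss_map ^^ length (b # s)) x))
     = (\<kappa> * \<kappa>') * diag_integral (moebius_density w'') (moebius_density z'') F"
    if [measurable]: "F \<in> borel_measurable borel" for F
  proof -
    let ?H = "\<lambda>x. indicator (cylinder s) x * F ((gauss_map ^^ length s) x)"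
    have [measurable]: "?H \<in> borel_measurable borel" by measurable
    have "(\<lambda>x. indicator (cylinder (b # s)) x * F ((gauss_map ^^ length (b # s)) x))
        = (\<lambda>x. indicator (cylinder [b]) x * ?H (gauss_map x))"
      by (auto simp: indicator_def cylinder_Cons[of _ b s] funpow_swap1)
    then show ?thesis
      using \<kappa>[OF \<open>?H \<in> borel_measurable borel\<close>] \<kappa>'[OF that] by (simp add: mult.assoc)
  qed
  with wz'' show ?case by blast
qed

section \<open>Comparison of densities\<close>

lemma diag_integral_mono_density:
  assumes "\<And>u v. \<lbrakk>0 \<le> u; u \<le> 1; 0 \<le> v; v \<le> 1\<rbrakk> \<Longrightarrow> a * (d u * e v) \<le> b * (d' u * e' v)"
    and nn: "0 \<le> a" "0 \<le> b" "\<And>u. \<lbrakk>0 \<le> u; u \<le> 1\<rbrakk> \<Longrightarrow> 0 \<le> d u \<and> 0 \<le> e u \<and> 0 \<le> d' u \<and> 0 \<le> e' u"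
    and [measurable]: "F \<in> borel_measurable borel" "d \<in> borel_measurable borel" "e \<in> borel_measurable borel"
      "d' \<in> borel_measurable borel" "e' \<in> borel_measurable borel"
  shows "ennreal a * diag_integral d e F \<le> ennreal b * diag_integral d' e' F"
proof -
  have "ennreal a * diag_integral d e F
      = (\<integral>\<^sup>+u. \<integral>\<^sup>+v. ennreal a * (on_unit d u * (on_unit e v * F (of_diag u v))) \<partial>lborel \<partial>lborel)"
    by (simp add: diag_integral_def nn_integral_cmult)
  also have "\<dots> \<le> (\<integral>\<^sup>+u. \<integral>\<^sup>+v. ennreal b * (on_unit d' u * (on_unit e' v * F (of_diag u v))) \<partial>lborel \<partial>lborel)"
  proof (intro nn_integral_mono)
    fix u v :: real
    show "ennreal a * (on_unit d u * (on_unit e v * F (of_diag u v)))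
        \<le> ennreal b * (on_unit d' u * (on_unit e' v * F (of_diag u v)))"
    proof (cases "u \<in> {0..1} \<and> v \<in> {0..1}")
      case True
      then have "ennreal (a * (d u * e v)) \<le> ennreal (b * (d' u * e' v))"
        using assms(1)[of u v] by (intro ennreal_leI) auto
      then have "ennreal a * (ennreal (d u) * ennreal (e v)) \<le> ennreal b * (ennreal (d' u) * ennreal (e' v))"
        using nn(1,2) nn(3)[of u] nn(3)[of v] True by (simp add: ennreal_mult)
      from mult_right_mono[OF this, of "F (of_diag u v)"] show ?thesis
        using True by (simp add: on_unit_def mult.assoc)
    qed (auto simp: on_unit_def)
  qed
  also have "\<dots> = ennreal b * diag_integral d' e' F"
    by (simp add: diag_integral_def nn_integral_cmult)
  finally show ?thesis .
qed

text \<open>From \<open>1 \<le> 1 + w * t \<le> 1 + w\<close>, the density lies between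
  \<open>1 / (1 + w)\<close> and \<open>1 + w\<close>.\<close>

lemma moebius_density_bounds:
  assumes "0 \<le> w" "w \<le> 1" "0 \<le> t" "t \<le> 1"
  shows "1 / 2 \<le> moebius_density w t" "moebius_density w t \<le> 2"
proof -
  have "w * t \<le> w * 1" using assms by (intro mult_left_mono) auto
  moreover have "0 \<le> w * t" using assms by simp
  ultimately have *: "1 \<le> 1 + w * t" "1 + w * t \<le> 1 + w" by auto
  have "(1 + w * t)\<^sup>2 \<le> (1 + w)\<^sup>2" using * by (intro power_mono) auto
  also have "\<dots> \<le> 2 * (1 + w)"
    using assms unfolding power2_eq_square by (intro mult_right_mono) auto
  finally have "(1 + w * t)\<^sup>2 \<le> 2 * (1 + w)" .
  moreover have "1 \<le> (1 + w * t)\<^sup>2" using * by simp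
  moreover have "1 / 2 \<le> (1 + w) / X \<and> (1 + w) / X \<le> 2" if "X \<le> 2 * (1 + w)" "1 \<le> X" for X
    using assms(2) that by (simp add: divide_simps)
  ultimately show "1 / 2 \<le> moebius_density w t" "moebius_density w t \<le> 2"
    unfolding moebius_density_def by blast+
qed

lemma gauss_density_bounds:
  assumes "0 \<le> t" "t \<le> 1" shows "1 / 2 \<le> ln 2 * gauss_density t" "ln 2 * gauss_density t \<le> 1"
  using assms by (simp_all add: gauss_density_def divide_simps)

lemma moebius_density_0 [simp]: "moebius_density 0 t = 1"
  by (simp add: moebius_density_def)

text \<open>Lebesgue measure in the diagonal coordinates is the member \<open>w = z = 0\<close> of
  the Moebius family, so cylinders can be pushed forward from it.\<close>

abbreviation lebesgue_diag :: "(R11 \<Rightarrow> ennreal) \<Rightarrow> ennreal" where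
  "lebesgue_diag \<equiv> diag_integral (moebius_density 0) (moebius_density 0)"

abbreviation gauss_diag :: "(R11 \<Rightarrow> ennreal) \<Rightarrow> ennreal" where
  "gauss_diag \<equiv> diag_integral gauss_density gauss_density"

lemma gauss_diag_le:
  assumes "F \<in> borel_measurable borel"
  shows "ennreal ((ln 2)\<^sup>2) * gauss_diag F \<le> ennreal 1 * lebesgue_diag F"
proof (rule diag_integral_mono_density)
  fix u v :: real assume "0 \<le> u" "u \<le> 1" "0 \<le> v" "v \<le> 1"
  then have "(ln 2 * gauss_density u) * (ln 2 * gauss_density v) \<le> 1 * 1"
    using gauss_density_bounds[of u] gauss_density_bounds[of v] by (intro mult_mono) auto
  then show "(ln 2)\<^sup>2 * (gauss_density u * gauss_density v) \<le> 1 * (moebius_density 0 u * moebius_density 0 v)"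
    by (simp add: power2_eq_square mult_ac)
qed (use assms in \<open>auto simp: gauss_density_def\<close>)

lemma lebesgue_diag_le:
  assumes "F \<in> borel_measurable borel"
  shows "ennreal 1 * lebesgue_diag F \<le> ennreal (4 * (ln 2)\<^sup>2) * gauss_diag F"
proof (rule diag_integral_mono_density)
  fix u v :: real assume "0 \<le> u" "u \<le> 1" "0 \<le> v" "v \<le> 1"
  then have "(1 / 2) * (1 / 2) \<le> (ln 2 * gauss_density u) * (ln 2 * gauss_density v)"
    using gauss_density_bounds[of u] gauss_density_bounds[of v] by (intro mult_mono) auto
  then show "1 * (moebius_density 0 u * moebius_density 0 v) \<le> 4 * (ln 2)\<^sup>2 * (gauss_density u * gauss_density v)"
    by (simp add: power2_eq_square mult_ac)
qed (use assms in \<open>auto simp: gauss_density_def\<close>)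

lemma lebesgue_diag_le_moebius:
  assumes w: "0 \<le> w" "w \<le> 1" "0 \<le> z" "z \<le> 1" and F: "F \<in> borel_measurable borel"
  shows "ennreal 1 * lebesgue_diag F \<le> ennreal 4 * diag_integral (moebius_density w) (moebius_density z) F"
proof (rule diag_integral_mono_density)
  fix u v :: real assume "0 \<le> u" "u \<le> 1" "0 \<le> v" "v \<le> 1"
  then have "(1 / 2) * (1 / 2) \<le> moebius_density w u * moebius_density z v"
    using moebius_density_bounds(1)[of w u] moebius_density_bounds(1)[of z v] w by (intro mult_mono) auto
  then show "1 * (moebius_density 0 u * moebius_density 0 v) \<le> 4 * (moebius_density w u * moebius_density z v)"
    by simp
qed (use w F in \<open>auto simp: moebius_density_def\<close>)

lemma moebius_diag_1_le:
  assumes w: "0 \<le> w" "w \<le> 1" "0 \<le> z" "z \<le> 1"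
  shows "diag_integral (moebius_density w) (moebius_density z) (\<lambda>_. 1) \<le> ennreal 4"
proof -
  have "ennreal 1 * diag_integral (moebius_density w) (moebius_density z) (\<lambda>_. 1) \<le> ennreal 4 * lebesgue_diag (\<lambda>_. 1)"
  proof (rule diag_integral_mono_density)
    fix u v :: real assume uv: "0 \<le> u" "u \<le> 1" "0 \<le> v" "v \<le> 1"
    have "moebius_density w u * moebius_density z v \<le> 2 * 2"
      using moebius_density_bounds[of w u] moebius_density_bounds[of z v] w uv by (intro mult_mono) auto
    then show "1 * (moebius_density w u * moebius_density z v) \<le> 4 * (moebius_density 0 u * moebius_density 0 v)"
      by simp
  qed (use w in \<open>auto simp: moebius_density_def\<close>)
  also have "lebesgue_diag (\<lambda>_. 1) = 1"
  proof -
    have "(\<integral>\<^sup>+v. on_unit (moebius_density 0) v \<partial>lborel) = 1"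
      by (simp add: on_unit_def)
    then show ?thesis
      by (simp add: diag_integral_def nn_integral_cmult)
  qed
  finally show ?thesis by simp
qed

text \<open>Let \<open>q = (ln 2)^2\<close>. The measure of the cylinder times \<open>q\<close> is
  at most \<open>4 * \<kappa>\<close>, that of \<open>B\<close> times \<open>q\<close> is at most 4
  times its Moebius integral, and \<open>\<kappa>\<close> times this integral is the Lebesgue
  measure of the intersection, at most \<open>4 * q\<close> times its invariant measure. Multiplying
  gives \<open>q^2\<close> against \<open>64 * q\<close>.\<close>

lemma cylinder_doeblin:
  assumes B: "B \<in> sets gauss_measure"
  shows "(ln 2)\<^sup>2 / 64 * measure gauss_measure (cylinder s) * measure gauss_measure B
    \<le> measure gauss_measure (cylinder s \<inter> (gauss_map ^^ length s) -` B)"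
proof -
  interpret prob_space gauss_measure by (rule prob_space_gauss_measure)
  have Bb [measurable]: "B \<in> sets borel" and Bsub: "B \<subseteq> diamond"
    using B by (auto simp: sets_gauss_measure)
  let ?T = "gauss_map ^^ length s"
  let ?C = "cylinder s"
  have [measurable]: "?T -` B \<in> sets borel"
    using measurable_sets[OF gauss_map_funpow_measurable Bb] by simp
  obtain \<kappa> w z where wz: "0 \<le> w" "w \<le> 1" "0 \<le> z" "z \<le> 1" and \<kappa>: "\<And>F. F \<in> borel_measurable borel \<Longrightarrow>
     lebesgue_diag (\<lambda>x. indicator ?C x * F (?T x))
       = \<kappa> * diag_integral (moebius_density w) (moebius_density z) F"
    using diag_integral_cylinder[of 0 0 s] by auto
  define q :: ennreal where "q = ennreal ((ln 2)\<^sup>2)"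
  have em: "emeasure gauss_measure A = gauss_diag (indicator A)" if "A \<in> sets borel" "A \<subseteq> diamond" for A
    using emeasure_gauss_measure[OF that(1)] that(2) by (simp add: Int_absorb2)
  have "q * gauss_diag (indicator ?C) \<le> lebesgue_diag (indicator ?C)"
    using gauss_diag_le[of "indicator ?C"] by (simp add: q_def)
  also have "lebesgue_diag (indicator ?C) = \<kappa> * diag_integral (moebius_density w) (moebius_density z) (\<lambda>_. 1)"
    using \<kappa>[of "\<lambda>_. 1"] by simp
  also have "\<dots> \<le> \<kappa> * ennreal 4"
    using moebius_diag_1_le[OF wz] by (intro mult_left_mono) auto
  finally have 1: "q * gauss_diag (indicator ?C) \<le> \<kappa> * ennreal 4" .
  have "q * gauss_diag (indicator B) \<le> lebesgue_diag (indicator B)"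
    using gauss_diag_le[of "indicator B"] by (simp add: q_def)
  also have "\<dots> \<le> ennreal 4 * diag_integral (moebius_density w) (moebius_density z) (indicator B)"
    using lebesgue_diag_le_moebius[OF wz, of "indicator B"] by simp
  finally have 2: "q * gauss_diag (indicator B) \<le> ennreal 4 * diag_integral (moebius_density w) (moebius_density z) (indicator B)" .
  have eq: "(\<lambda>x. indicator ?C x * indicator B (?T x)) = (indicator (?C \<inter> ?T -` B) :: R11 \<Rightarrow> ennreal)"
    by (auto simp: indicator_def)
  have "(q * gauss_diag (indicator ?C)) * (q * gauss_diag (indicator B))
     \<le> (\<kappa> * ennreal 4) * (ennreal 4 * diag_integral (moebius_density w) (moebius_density z) (indicator B))"
    by (rule mult_mono[OF 1 2]) auto
  also have "\<dots> = ennreal 16 * (\<kappa> * diag_integral (moebius_density w) (moebius_density z) (indicator B))"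
  proof -
    have "ennreal 4 * ennreal 4 = ennreal 16" by (simp flip: ennreal_mult)
    then show ?thesis by (metis mult.assoc mult.commute)
  qed
  also have "\<kappa> * diag_integral (moebius_density w) (moebius_density z) (indicator B) = lebesgue_diag (indicator (?C \<inter> ?T -` B))"
    using \<kappa>[of "indicator B"] unfolding eq by simp
  also have "ennreal 16 * lebesgue_diag (indicator (?C \<inter> ?T -` B))
      \<le> ennreal 16 * (ennreal (4 * (ln 2)\<^sup>2) * gauss_diag (indicator (?C \<inter> ?T -` B)))"
    using lebesgue_diag_le[of "indicator (?C \<inter> ?T -` B)"] by (intro mult_left_mono) auto
  finally have "(q * gauss_diag (indicator ?C)) * (q * gauss_diag (indicator B))
     \<le> ennreal 16 * (ennreal (4 * (ln 2)\<^sup>2) * gauss_diag (indicator (?C \<inter> ?T -` B)))" .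
  moreover have "gauss_diag (indicator ?C) = ennreal (measure gauss_measure ?C)"
    "gauss_diag (indicator B) = ennreal (measure gauss_measure B)"
    "gauss_diag (indicator (?C \<inter> ?T -` B)) = ennreal (measure gauss_measure (?C \<inter> ?T -` B))"
    using cylinder_subset_diamond[of s] Bsub by (subst em[symmetric]; auto simp: emeasure_eq_measure)+
  ultimately have "((ln 2)\<^sup>2 * measure gauss_measure ?C) * ((ln 2)\<^sup>2 * measure gauss_measure B)
      \<le> 16 * (4 * (ln 2)\<^sup>2 * measure gauss_measure (?C \<inter> ?T -` B))"
    unfolding q_def by (simp add: ennreal_le_iff flip: ennreal_mult ennreal_numeral)
  then have "(ln 2)\<^sup>2 * ((ln 2)\<^sup>2 / 64 * measure gauss_measure ?C * measure gauss_measure B)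
      \<le> (ln 2)\<^sup>2 * measure gauss_measure (?C \<inter> ?T -` B)"
    by (simp add: field_simps)
  then show ?thesis by (simp only: mult_le_cancel_left_pos[of "(ln 2)\<^sup>2"] zero_less_power2 ln_eq_zero_iff)
qed

section \<open>Images under the Gauss map\<close>

lemma countable_lattice: "countable lattice"
proof -
  have "lattice \<subseteq> (\<lambda>(m, n). of_diag (of_int m) (of_int n)) ` UNIV"
  proof
    fix z assume "z \<in> lattice"
    then obtain m n where "diag1 z = of_int m" "diag2 z = of_int n"
      by (auto simp: lattice_iff elim!: Ints_cases)
    then have "z = (\<lambda>(m, n). of_diag (of_int m) (of_int n)) (m, n)" by (simp add: diag_eq_iff)
    then show "z \<in> (\<lambda>(m, n). of_diag (of_int m) (of_int n)) ` UNIV" by blast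
  qed
  then show ?thesis by (rule countable_subset) auto
qed

lemma lattice_part_add:
  assumes "b \<in> lattice" "y \<in> diamond" shows "lattice_part (b + y) = b"
  using assms by (auto simp: diag_eq_iff diag_lattice_part lattice_iff diamond_iff floor_eq_iff elim!: Ints_cases)

text \<open>Forward images of Borel sets are not Borel in general. Here the image is a countable
  union of preimages under the inverse branches \<open>iota (b + y)\<close>, apart from the null
  cone, whose image is at most the origin.\<close>

lemma gauss_map_image_sets:
  assumes "B \<in> sets gauss_measure" shows "gauss_map ` B \<in> sets gauss_measure"
proof -
  have [measurable]: "B \<in> sets borel" and sub: "B \<subseteq> diamond"
    using assms by (auto simp: sets_gauss_measure)
  define E where "E b = {y \<in> diamond. b + y \<notin> null_cone \<and> iota (b + y) \<in> B - null_cone}" for b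
  have "gauss_map ` (B - null_cone) = (\<Union>b\<in>lattice. E b)"
  proof (intro equalityI subsetI)
    fix y assume "y \<in> gauss_map ` (B - null_cone)"
    then obtain x where x: "x \<in> B" "x \<notin> null_cone" "y = gauss_map x" by auto
    have "lattice_part (iota x) + y = iota x" by (simp add: x(3) gauss_map_def)
    moreover have "iota x \<notin> null_cone" using x(2) by (simp add: null_cone_iff diag_iota)
    ultimately have "y \<in> E (lattice_part (iota x))"
      using x iota_iota[of x] by (simp add: E_def gauss_map_in_diamond)
    then show "y \<in> (\<Union>b\<in>lattice. E b)" using lattice_part_props(1) by blast
  next
    fix y assume "y \<in> (\<Union>b\<in>lattice. E b)"
    then obtain b where b: "b \<in> lattice" "y \<in> diamond" "b + y \<notin> null_cone" "iota (b + y) \<in> B - null_cone"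
      by (auto simp: E_def)
    have "gauss_map (iota (b + y)) = y"
      unfolding gauss_map_def iota_iota[OF b(3)] lattice_part_add[OF b(1,2)] by simp
    then show "y \<in> gauss_map ` (B - null_cone)" using b(4) by (metis image_eqI)
  qed
  moreover have "E b \<in> sets borel" for b
  proof -
    have [measurable]: "(\<lambda>y. b + y) \<in> borel_measurable borel" by simp
    have "(\<lambda>y. b + y) -` (- null_cone) \<inter> space borel \<in> sets borel"
      by (rule measurable_sets[of _ borel borel]) auto
    moreover have "(\<lambda>y. iota (b + y)) -` (B - null_cone) \<inter> space borel \<in> sets borel"
      by (rule measurable_sets[of _ borel borel]) auto
    moreover have "E b = diamond \<inter> ((\<lambda>y. b + y) -` (- null_cone) \<inter> (\<lambda>y. iota (b + y)) -` (B - null_cone))"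
      by (auto simp: E_def)
    ultimately show ?thesis by auto
  qed
  ultimately have 1: "gauss_map ` (B - null_cone) \<in> sets borel"
    using countable_lattice by (auto intro: sets.countable_UN')
  have "gauss_map ` (B \<inter> null_cone) \<subseteq> {0}" by (auto simp: gauss_map_null_cone)
  then have 2: "gauss_map ` (B \<inter> null_cone) \<in> sets borel"
    by (metis borel_singleton sets.empty_sets subset_singletonD)
  have "gauss_map ` B = gauss_map ` (B - null_cone) \<union> gauss_map ` (B \<inter> null_cone)" by auto
  with 1 2 have "gauss_map ` B \<in> sets borel" by (metis sets.Un)
  moreover have "gauss_map ` B \<subseteq> diamond" using gauss_map_in_diamond by auto
  ultimately show ?thesis by (simp add: sets_gauss_measure)
qed

lemma gauss_map_funpow_image_sets:
  assumes "B \<in> sets gauss_measure" shows "(gauss_map ^^ n) ` B \<in> sets gauss_measure"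
proof (induction n)
  case (Suc n)
  have "(gauss_map ^^ Suc n) ` B = gauss_map ` (gauss_map ^^ n) ` B" by (simp add: image_comp)
  then show ?case using gauss_map_image_sets[OF Suc] by simp
qed (simp add: assms)

section \<open>Full cylinders and Renyi's condition\<close>

lemma inj_on_cylinder: "inj_on (gauss_map ^^ length s) (cylinder s)"
  by (rule inj_onI) (metis cf_fold_digits cylinder_iff)

text \<open>The Doeblin bound is applied to the complement of the image: its preimage misses the
  cylinder, so it is a null set.\<close>

lemma full_cylinders: full_cylinders
  unfolding full_cylinders_def
proof (intro allI conjI impI)
  interpret prob_space gauss_measure by (rule prob_space_gauss_measure)
  fix s
  show "cylinder s \<in> sets gauss_measure" by (rule cylinder_sets_gauss_measure)
  then have im: "(gauss_map ^^ length s) ` cylinder s \<in> sets gauss_measure"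
    by (rule gauss_map_funpow_image_sets)
  assume pos: "measure gauss_measure (cylinder s) > 0"
  let ?B = "space gauss_measure - (gauss_map ^^ length s) ` cylinder s"
  have B: "?B \<in> sets gauss_measure" using im by auto
  have "cylinder s \<inter> (gauss_map ^^ length s) -` ?B = {}" by blast
  then have "(ln 2)\<^sup>2 / 64 * measure gauss_measure (cylinder s) * measure gauss_measure ?B \<le> 0"
    using cylinder_doeblin[OF B, of s] by simp
  moreover have "0 < (ln 2)\<^sup>2 / 64 * measure gauss_measure (cylinder s)" using pos by simp
  ultimately have "measure gauss_measure ?B \<le> 0" by (metis linorder_not_le mult_pos_pos)
  then show "measure gauss_measure ((gauss_map ^^ length s) ` cylinder s) = 1"
    using prob_compl[OF im] measure_nonneg[of gauss_measure ?B] by linarith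
qed

text \<open>By injectivity \<open>B\<close> is the part of the cylinder sent into the image of
  \<open>B\<close>, so the Doeblin bound for this image, divided by its constant, is Renyi's
  inequality.\<close>

lemma renyi_condition: renyi_condition
  unfolding renyi_condition_def
proof (intro exI[of _ "64 / (ln 2)\<^sup>2"] allI conjI impI ballI)
  show "0 < 64 / (ln 2 :: real)\<^sup>2" by simp
  fix s show "cylinder s \<in> sets gauss_measure" by (rule cylinder_sets_gauss_measure)
  fix B assume pos: "measure gauss_measure (cylinder s) > 0"
    and B: "B \<in> sets gauss_measure" and sub: "B \<subseteq> cylinder s"
  show im: "(gauss_map ^^ length s) ` B \<in> sets gauss_measure"
    by (rule gauss_map_funpow_image_sets[OF B])
  have "cylinder s \<inter> (gauss_map ^^ length s) -` (gauss_map ^^ length s) ` B = B"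
  proof (intro equalityI subsetI)
    fix x assume "x \<in> cylinder s \<inter> (gauss_map ^^ length s) -` (gauss_map ^^ length s) ` B"
    then obtain y where "x \<in> cylinder s" "y \<in> B" "(gauss_map ^^ length s) x = (gauss_map ^^ length s) y"
      by blast
    then show "x \<in> B"
      using inj_onD[OF inj_on_cylinder[of s], of x y] sub by blast
  qed (use sub in blast)
  then have "(ln 2)\<^sup>2 / 64 * measure gauss_measure (cylinder s) * measure gauss_measure ((gauss_map ^^ length s) ` B)
      \<le> measure gauss_measure B"
    using cylinder_doeblin[OF im, of s] by simp
  then show "measure gauss_measure ((gauss_map ^^ length s) ` B)
      \<le> 64 / (ln 2)\<^sup>2 * measure gauss_measure B / measure gauss_measure (cylinder s)"
    using pos by (simp add: field_simps)
qed

section \<open>Approximation by cylinders\<close>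

definition irrational_diamond :: "R11 set" where
  "irrational_diamond = {x \<in> diamond. diag1 x \<notin> \<rat> \<and> diag2 x \<notin> \<rat>}"

lemma irrational_diamond_sets: "irrational_diamond \<in> sets gauss_measure"
proof -
  have [measurable]: "(\<rat> :: real set) \<in> sets borel"
    using countable_rat by (rule sets.countable[rotated]) auto
  have "irrational_diamond = diamond \<inter> {x. diag1 x \<notin> \<rat>} \<inter> {x. diag2 x \<notin> \<rat>}"
    by (auto simp: irrational_diamond_def)
  also have "\<dots> \<in> sets borel" by measurable
  finally show ?thesis
    by (auto simp: sets_gauss_measure irrational_diamond_def)
qed

lemma AE_irrational_diamond: "AE x in gauss_measure. x \<in> irrational_diamond"
proof -
  have [measurable]: "irrational_diamond \<in> sets borel"
    using irrational_diamond_sets by (simp add: sets_gauss_measure)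
  have "emeasure gauss_measure (diamond - irrational_diamond) = gauss_diag (indicator (- irrational_diamond))"
    using emeasure_gauss_measure[of "- irrational_diamond"] by (simp add: Diff_eq Int_commute)
  also have "\<dots> = gauss_diag (\<lambda>_. 0)"
    by (rule diag_integral_cong) (simp add: irrational_diamond_def diamond_iff)
  also have "\<dots> = 0" by (simp add: diag_integral_def)
  finally have "diamond - irrational_diamond \<in> null_sets gauss_measure"
    using irrational_diamond_sets by (auto simp: null_sets_def sets_gauss_measure)
  then show ?thesis
    by (rule AE_I') (auto simp: space_gauss_measure)
qed

lemma cylinder_disjoint:
  assumes "length s = length t" "x \<in> cylinder s" "x \<in> cylinder t" shows "s = t"
  using assms by (metis cylinder_iff)

lemma in_cylinder_digits:
  assumes "x \<in> irrational_diamond" shows "x \<in> cylinder (digits x n)"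
  using assms infinite_orbit_iff[of x] by (simp add: cylinder_iff irrational_diamond_def)

lemma cylinder_diameter:
  assumes "x \<in> cylinder s" "y \<in> cylinder s" shows "dist x y \<le> 2 * (1/4) ^ (length s div 2)"
proof -
  have b: "\<bar>diag1 x - diag1 y\<bar> \<le> (1/4) ^ (length s div 2)" "\<bar>diag2 x - diag2 y\<bar> \<le> (1/4) ^ (length s div 2)"
    using assms same_digits_close[of x "length s" y] by (simp_all add: cylinder_iff)
  have "fst x - fst y = ((diag1 x - diag1 y) + (diag2 x - diag2 y)) / 2"
    "snd x - snd y = ((diag1 x - diag1 y) - (diag2 x - diag2 y)) / 2"
    by (simp_all add: diag1_def diag2_def)
  moreover have "\<bar>(p + q) / 2\<bar> \<le> c \<and> \<bar>(p - q) / 2\<bar> \<le> c" if "\<bar>p\<bar> \<le> c" "\<bar>q\<bar> \<le> c" for p q c :: real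
    using that by (simp add: abs_le_iff)
  ultimately have "dist (fst x) (fst y) \<le> (1/4) ^ (length s div 2)" "dist (snd x) (snd y) \<le> (1/4) ^ (length s div 2)"
    using b unfolding dist_real_def by simp_all
  then show ?thesis
    using sqrt_sum_squares_le_sum_abs[of "dist (fst x) (fst y)" "dist (snd x) (snd y)"]
    by (simp add: dist_prod_def)
qed

lemma cylinder_in_open:
  assumes "x \<in> irrational_diamond" "open V" "x \<in> V"
  shows "\<forall>\<^sub>F n in sequentially. cylinder (digits x n) \<subseteq> V"
proof -
  obtain r where r: "0 < r" "ball x r \<subseteq> V" using assms(2,3) by (auto simp: open_contains_ball)
  have "(\<lambda>n. 2 * (1/4 :: real) ^ (n div 2)) \<longlonglongrightarrow> 2 * 0"
    by (intro tendsto_mult tendsto_const tendsto_quarter_power)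
  then have "\<forall>\<^sub>F n in sequentially. 2 * (1/4) ^ (n div 2) < r"
    using r(1) by (intro order_tendstoD(2)) auto
  then show ?thesis
  proof eventually_elim
    case (elim n)
    show ?case
    proof
      fix y assume "y \<in> cylinder (digits x n)"
      then have "dist x y < r"
        using cylinder_diameter[OF in_cylinder_digits[OF assms(1)], of y n] elim by simp
      then show "y \<in> V" using r(2) by auto
    qed
  qed
qed

lemma gauss_measure_outer_open:
  assumes A: "A \<in> sets gauss_measure" and e: "0 < e"
  obtains V where "open V" "A \<subseteq> V" "measure gauss_measure (V \<inter> diamond) < measure gauss_measure A + e"
proof -
  interpret prob_space gauss_measure by (rule prob_space_gauss_measure)
  have Ab: "A \<in> sets borel" and sub: "A \<subseteq> diamond" using A by (auto simp: sets_gauss_measure)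
  \<comment> \<open>Outer regularity is applied to a Borel measure on the whole plane, so the
    measure is extended by zero outside the diamond.\<close>
  define N where "N = distr gauss_measure (borel :: R11 measure) (\<lambda>x. x)"
  have id: "(\<lambda>x. x) \<in> measurable gauss_measure (borel :: R11 measure)"
  proof -
    have "(\<lambda>x. x) \<in> measurable (restrict_space borel diamond) (borel :: R11 measure)"
      by (intro measurable_restrict_space1) simp
    moreover have "sets gauss_measure = sets (restrict_space borel diamond)"
      by (simp add: gauss_measure_def sets_restrict_space)
    ultimately show ?thesis by (simp cong: measurable_cong_sets)
  qed
  have em: "emeasure N B = emeasure gauss_measure (B \<inter> diamond)" if "B \<in> sets borel" for B
    using emeasure_distr[OF id that] by (simp add: N_def space_gauss_measure)
  have "emeasure N A = (INF U \<in> {U. A \<subseteq> U \<and> open U}. emeasure N U)"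
    using Ab by (intro outer_regular) (simp_all add: N_def em[unfolded N_def] emeasure_eq_measure)
  moreover have "emeasure N A < ennreal (measure gauss_measure A + e)"
    using e sub by (simp add: em[OF Ab] Int_absorb2 emeasure_eq_measure ennreal_less_iff)
  ultimately obtain V where V: "A \<subseteq> V" "open V" "emeasure N V < ennreal (measure gauss_measure A + e)"
    by (auto simp: INF_less_iff)
  then have "measure gauss_measure (V \<inter> diamond) < measure gauss_measure A + e"
    using em[of V] by (simp add: emeasure_eq_measure ennreal_less_iff)
  with V(1,2) show ?thesis by (intro that)
qed

text \<open>\<open>A\<close> is enclosed in a relatively open set \<open>W\<close>, which is
  exhausted almost everywhere by the cylinders of length \<open>n\<close> inside it as
  \<open>n\<close> grows. There may be infinitely many of these, so a finite subfamily is chosen;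
  each of the three errors is below \<open>e / 4\<close>.\<close>

lemma cylinder_approximation:
  assumes A: "A \<in> sets gauss_measure" and e: "0 < e"
  shows "\<exists>n F. finite F \<and> F \<subseteq> {s. length s = n} \<and> measure gauss_measure (sym_diff A (\<Union>s\<in>F. cylinder s)) < e"
proof -
  interpret prob_space gauss_measure by (rule prob_space_gauss_measure)
  note irr = irrational_diamond_sets
  obtain V where V: "open V" "A \<subseteq> V" "measure gauss_measure (V \<inter> diamond) < measure gauss_measure A + e / 4"
    using gauss_measure_outer_open[OF A, of "e / 4"] e by auto
  define W where "W = V \<inter> diamond"
  have W: "W \<in> sets gauss_measure" using V(1) by (auto simp: W_def sets_gauss_measure)
  \<comment> \<open>Digits are restricted to the lattice for countability; all other lists have
    empty cylinders.\<close>
  define S where "S n = {s. length s = n \<and> set s \<subseteq> lattice \<and> cylinder s \<subseteq> V}" for n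
  define E where "E n = (\<Union>s\<in>S n. cylinder s)" for n
  have cS: "countable (S n)" for n
  proof -
    have "S n \<subseteq> lists lattice" by (auto simp: S_def)
    then show ?thesis using countable_lists[OF countable_lattice] countable_subset by blast
  qed
  have E: "E n \<in> sets gauss_measure" for n
    unfolding E_def using cS by (intro sets.countable_UN') (auto simp: cylinder_sets_gauss_measure)
  have EW: "E n \<subseteq> W" for n
    using cylinder_subset_diamond by (auto simp: E_def S_def W_def)
  have mem: "x \<in> E n \<longleftrightarrow> cylinder (digits x n) \<subseteq> V" if x: "x \<in> irrational_diamond" for x n
  proof
    assume "x \<in> E n"
    then obtain s where s: "s \<in> S n" "x \<in> cylinder s" by (auto simp: E_def)
    then have "digits x n = s" by (auto simp: S_def cylinder_iff)
    with s(1) show "cylinder (digits x n) \<subseteq> V" by (simp add: S_def)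
  next
    assume "cylinder (digits x n) \<subseteq> V"
    moreover have "set (digits x n) \<subseteq> lattice" by (auto simp: digits_def digit_lattice)
    ultimately have "digits x n \<in> S n" by (simp add: S_def)
    then show "x \<in> E n" using in_cylinder_digits[OF x] unfolding E_def by blast
  qed
  have "(\<lambda>n. measure gauss_measure (E n)) \<longlonglongrightarrow> measure gauss_measure W"
  proof -
    have "(\<lambda>n. \<integral>x. indicator (E n) x \<partial>gauss_measure) \<longlonglongrightarrow> (\<integral>x. indicator W x \<partial>gauss_measure :: real)"
    proof (rule integral_dominated_convergence[where w = "\<lambda>_. 1"])
      \<comment> \<open>A point of \<open>W\<close> with infinite expansion has its cylinder of
        length \<open>n\<close> inside \<open>V\<close> for all large \<open>n\<close>, because the
        diameters tend to \<open>0\<close>.\<close>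
      show "AE x in gauss_measure. (\<lambda>n. indicator (E n) x :: real) \<longlonglongrightarrow> indicator W x"
        using AE_irrational_diamond
      proof eventually_elim
        case (elim x)
        show ?case
        proof (cases "x \<in> W")
          case True
          then have "\<forall>\<^sub>F n in sequentially. x \<in> E n"
            using cylinder_in_open[OF elim V(1)] by (auto simp: W_def mem[OF elim])
          then have "\<forall>\<^sub>F n in sequentially. indicator (E n) x = (indicator W x :: real)"
            using True by (auto elim: eventually_mono)
          then show ?thesis by (rule tendsto_eventually)
        next
          case False
          then have "x \<notin> E n" for n using EW by blast
          then show ?thesis using False by simp
        qed
      qed
    qed (use E W in \<open>auto simp: indicator_def\<close>)
    then show ?thesis using E W by simp
  qed
  then have "\<forall>\<^sub>F n in sequentially. measure gauss_measure W - e / 4 < measure gauss_measure (E n)"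
    using e by (intro order_tendstoD(1)) auto
  then obtain n where n: "measure gauss_measure W - e / 4 < measure gauss_measure (E n)"
    by (auto dest: eventually_happens)
  obtain F where F: "finite F" "F \<subseteq> S n"
    "measure gauss_measure (E n) - e / 4 < measure gauss_measure (\<Union>s\<in>F. cylinder s)"
  proof (cases "finite (S n)")
    case True
    then show ?thesis using that[of "S n"] e by (simp add: E_def)
  next
    case False
    have lim: "(\<lambda>k. measure gauss_measure (\<Union>i\<in>{..<k}. cylinder (from_nat_into (S n) i))) \<longlonglongrightarrow>
      measure gauss_measure (\<Union>k. \<Union>i\<in>{..<k}. cylinder (from_nat_into (S n) i))"
      by (intro finite_Lim_measure_incseq) (auto simp: incseq_def cylinder_sets_gauss_measure, fastforce)
    have "(\<Union>k. \<Union>i\<in>{..<k}. cylinder (from_nat_into (S n) i)) = (\<Union>i. cylinder (from_nat_into (S n) i))"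
      by auto
    also have "\<dots> = (\<Union>s\<in>range (from_nat_into (S n)). cylinder s)" by simp
    also have "\<dots> = E n"
      using cS[of n] False by (subst range_from_nat_into) (auto simp: E_def)
    finally have "\<forall>\<^sub>F k in sequentially. measure gauss_measure (E n) - e / 4 <
        measure gauss_measure (\<Union>i\<in>{..<k}. cylinder (from_nat_into (S n) i))"
      using lim e by (intro order_tendstoD(1)) auto
    then obtain k where k: "measure gauss_measure (E n) - e / 4 <
        measure gauss_measure (\<Union>i\<in>{..<k}. cylinder (from_nat_into (S n) i))"
      by (auto dest: eventually_happens)
    have "S n \<noteq> {}" using False by auto
    show ?thesis
      using k from_nat_into[OF \<open>S n \<noteq> {}\<close>] by (intro that[of "from_nat_into (S n) ` {..<k}"]) auto
  qed
  let ?U = "\<Union>s\<in>F. cylinder s"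
  have U: "?U \<in> sets gauss_measure"
    using F(1) by (intro sets.finite_UN) (auto simp: cylinder_sets_gauss_measure)
  have UW: "?U \<subseteq> W" using F(2) EW[of n] by (auto simp: E_def)
  have AW: "A \<subseteq> W" using V(2) A by (auto simp: W_def sets_gauss_measure)
  have "measure gauss_measure (sym_diff A ?U) \<le> measure gauss_measure (W - ?U) + measure gauss_measure (W - A)"
  proof -
    have "measure gauss_measure (sym_diff A ?U) \<le> measure gauss_measure ((W - ?U) \<union> (W - A))"
      using A U W UW AW by (intro finite_measure_mono) auto
    also have "\<dots> \<le> measure gauss_measure (W - ?U) + measure gauss_measure (W - A)"
      using A U W by (intro measure_Un_le) auto
    finally show ?thesis .
  qed
  also have "\<dots> = (measure gauss_measure W - measure gauss_measure ?U) + (measure gauss_measure W - measure gauss_measure A)"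
    using finite_measure_Diff[OF W U UW] finite_measure_Diff[OF W A AW] by simp
  also have "\<dots> < e"
    using n F(3) V(3) e unfolding W_def[symmetric] by linarith
  finally show ?thesis using F by (intro exI[of _ n] exI[of _ F]) (auto simp: S_def)
qed

lemma doeblin_system_gauss_map:
  "doeblin_system gauss_measure gauss_map (\<lambda>n. {s. length s = n}) cylinder ((ln 2)\<^sup>2 / 64)"
proof -
  interpret prob_space gauss_measure by (rule prob_space_gauss_measure)
  have "ln (2::real) \<le> 1" using ln_le_minus_one[of 2] by simp
  then have "(ln 2 :: real)\<^sup>2 \<le> 1\<^sup>2" by (intro power_mono) auto
  then have "(ln 2 :: real)\<^sup>2 / 64 < 1" by simp
  then show ?thesis
    using cylinder_approximation cylinder_doeblin preserves_gauss_measure cylinder_disjoint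
    by unfold_locales (auto simp: cylinder_sets_gauss_measure disjoint_family_on_def)
qed

theorem theorem4:
  "(\<forall>x. infinite_expansion x \<longleftrightarrow> diagonally_completely_irrational x)
   \<and> (\<forall>x. eventually_repeating x \<longleftrightarrow> root_of_nondegenerate_quadratic x)
   \<and> (\<forall>x\<in>diamond. diagonally_completely_irrational x \<longrightarrow>
        (\<lambda>n. convergent_of x n) \<longlonglongrightarrow> x \<and> (\<lambda>n. Q (convergent_of x n - x)) \<longlonglongrightarrow> 0)
   \<and> (prob_space gauss_measure \<and> preserves_measure gauss_measure gauss_map)
   \<and> (full_cylinders \<and> renyi_condition \<and> exact_map gauss_measure gauss_map
      \<and> mixing_of_all_orders gauss_measure gauss_map \<and> ergodic_map gauss_measure gauss_map)"
proof -
  interpret doeblin_system gauss_measure gauss_map "\<lambda>n. {s. length s = n}" cylinder "(ln 2)\<^sup>2 / 64"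
    by (rule doeblin_system_gauss_map)
  show ?thesis
    using infinite_expansion_iff eventually_repeating_iff convergent_of_tendsto prob_space_gauss_measure
      preserves_gauss_measure full_cylinders renyi_condition exact[OF gauss_map_image_sets] mixing ergodic
    by blast
qed

end
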